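(* Let $\mathbb{X}=\{1,2,3,\dots\}$, let $f:\mathbb{X}\to[0,\infty)$ be a non-negative function with envelope family $\Lambda_f=\{\mu\in\mathcal{P}(\mathbb{X}):\mu(x)\le f(x)\ \forall x\in\mathbb{X}\}$, and let $\rho:\mathbb{X}\times\mathbb{X}\to[0,\infty)$ be an unbounded distortion function that is consistent with respect to the Euclidean norm. Suppose that $\Lambda_f\subset\mathcal{H}(\mathbb{X})$ and that $$\limsup_{k\to\infty}\frac{\sum_{i\ge k}f(i)\log\frac1{f(i)}}{\tilde\mu_f(\mathcal{T}_k)\log\frac{1}{\tilde\mu_f(\mathcal{T}_k)}}<\infty,\qquad \mathcal{T}_k=\{k,k+1,\dots\}\subset\mathbb{X}.$$ Then for any $d>0$ there exist a $D$-semifaithful coding scheme $\{\xi_n^*,n\ge1\}$ operating at distortion $d$ (with respect to $\{\rho_n,n\ge1\}$) and constants $C_0,C_1,C_2$ such that for all $n\ge1$ $$\sup_{\mu\in\Lambda_f}\left[R(\xi_n^*,\mu^n)-\mathcal{R}_n(d,\mu^n)\right]\le C_0\frac{u_f(n)\log n}{n}+C_1\frac{\log n}{n}+C_2\frac1n,$$ where $u_f(n)=\min\{k\ge1:\tilde\mu_f(\mathcal{T}_{k+1})<1/n\}$.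
   Context: $\mathcal{P}(S)$ is the set of probability measures on a countable set $S$; $\log$ is base $2$; $\mu(x)$ denotes the probability mass function; $\mu^n$ is the $n$-fold product of $\mu\in\mathcal{P}(\mathbb{X})$; $\mathcal{H}(\mathbb{X})$ is the set of $\mu\in\mathcal{P}(\mathbb{X})$ with finite Shannon entropy $H(\mu)=-\sum_x\mu(x)\log\mu(x)$. The condition $\Lambda_f\subset\mathcal{H}(\mathbb{X})$ implies $f\in\ell_1(\mathbb{X})$. Envelope distribution: with $\tau_f=\min\{k\ge1:\sum_{x\ge k}f(x)\le1\}$, set $\tilde\mu_f(x)=f(x)$ for $x\ge\tau_f$, $\tilde\mu_f(\tau_f-1)=1-\sum_{x\ge\tau_f}f(x)$, and $\tilde\mu_f(x)=0$ for $x<\tau_f-1$ (if $\tau_f=1$, the point $\tau_f-1=0$ carries the remaining mass, if any). Distortions $\rho$ satisfy $\rho(x,x)=0$ and $\rho(x,\bar x)>0$ for $x\ne\bar x$, and $\rho_n(x^n,\bar x^n)=\frac1n\sum_{i=1}^n\rho(x_i,\bar x_i)$. An unbounded distortion $\rho$ is consistent with respect to the Euclidean norm if for any $K>0$ there exists $\epsilon>0$ such that for all $i,j\in\mathbb{X}$, $|i-j|\ge\epsilon$ implies $\rho(i,j)\ge K$. $D$-semifaithful code of length $n$ operating at distortion $d$: a triplet $\xi_n=(\phi_n,\mathcal{C}_n,\mathcal{D}_n)$, where $\phi_n:\mathbb{X}^n\to\mathcal{B}_n\subset\mathbb{X}^n$ is a quantizer with range $\mathcal{B}_n=\phi_n(\mathbb{X}^n)$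 such that $\rho_n(x^n,\phi_n(x^n))\le d$ for every $x^n\in\mathbb{X}^n$ and $y^n\in\phi_n^{-1}(\{y^n\})$ for every $y^n\in\mathcal{B}_n$; $\mathcal{C}_n:\mathcal{B}_n\to\{0,1\}^*=\bigcup_{k\ge1}\{0,1\}^k$ is a prefix-free variable-length binary encoder (so $\sum_{y\in\mathcal{B}_n}2^{-\mathcal{L}(\mathcal{C}_n(y))}\le1$, where $\mathcal{L}$ is the length of a binary string); and $\mathcal{D}_n:\{0,1\}^*\to\mathcal{B}_n$ is the corresponding decoder. A $D$-semifaithful coding scheme operating at distortion $d$ is a sequence $\{\xi_n,n\ge1\}$ of such codes, $\xi_n$ of length $n$. Rate: $R(\xi_n,\mu^n)=\frac1n\mathbb{E}_{X^n\sim\mu^n}\{\mathcal{L}(\mathcal{C}_n(\phi_n(X^n)))\}$. For a partition $\pi$ of $\mathbb{X}^n$ and $\mu\in\mathcal{P}(\mathbb{X}^n)$, $H_{\sigma(\pi)}(\mu)=-\sum_{A\in\pi}\mu(A)\log\mu(A)$. $\mathcal{Q}_n(d)$ is the collection of partitions $\pi$ of $\mathbb{X}^n$ such that for every $A\in\pi$ there is $y^n\in A$ with $\sup_{x^n\in A}\rho_n(x^n,y^n)\le d$. Define $\mathcal{R}_n(d,\mu^n)=\inf_{\pi\in\mathcal{Q}_n(d)}\frac1nH_{\sigma(\pi)}(\mu^n)$. *)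

theory Defs
  imports "HOL-Probability.Probability" "HOL-Library.Sublist"
begin

definition alphabet :: "nat set" where
  "alphabet = {1..}"

definition words :: "nat \<Rightarrow> nat list set" where
  "words n = {xs. length xs = n \<and> set xs \<subseteq> alphabet}"

definition prob_measures :: "nat pmf set" where
  "prob_measures = {\<mu>. set_pmf \<mu> \<subseteq> alphabet}"

(* Extended-real valued, so an infinite entropy really is infinite; 0 * log 2 0 = 0. *)
definition shannon_entropy :: "nat pmf \<Rightarrow> ereal" where
  "shannon_entropy \<mu> = (\<Sum>\<^sub>\<infinity>x\<in>alphabet. ereal (- (pmf \<mu> x * log 2 (pmf \<mu> x))))"

definition finite_entropy :: "nat pmf set" where
  "finite_entropy = {\<mu> \<in> prob_measures. shannon_entropy \<mu> < \<infinity>}"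

definition envelope_family :: "(nat \<Rightarrow> real) \<Rightarrow> nat pmf set" where
  "envelope_family f = {\<mu> \<in> prob_measures. \<forall>x\<in>alphabet. pmf \<mu> x \<le> f x}"

(* The real-valued sums in the next definitions are meaningful when f is summable; this
   follows from envelope_family f \<subseteq> finite_entropy. *)
definition env_tau :: "(nat \<Rightarrow> real) \<Rightarrow> nat" where
  "env_tau f = (LEAST k. k \<ge> 1 \<and> (\<Sum>\<^sub>\<infinity>x\<in>{k..}. f x) \<le> 1)"

(* Defined on all of nat: if env_tau f = 1, the remaining mass sits at the point 0, which
   lies outside the alphabet. The value f 0 is never used. *)
definition env_dist :: "(nat \<Rightarrow> real) \<Rightarrow> nat \<Rightarrow> real" where
  "env_dist f x =
     (if x \<ge> env_tau f then f x
      else if x + 1 = env_tau f then 1 - (\<Sum>\<^sub>\<infinity>y\<in>{env_tau f..}. f y)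
      else 0)"

definition env_tail :: "(nat \<Rightarrow> real) \<Rightarrow> nat \<Rightarrow> real" where
  "env_tail f k = (\<Sum>\<^sub>\<infinity>x\<in>{k..}. env_dist f x)"

definition env_u :: "(nat \<Rightarrow> real) \<Rightarrow> nat \<Rightarrow> nat" where
  "env_u f n = (LEAST k. k \<ge> 1 \<and> env_tail f (k + 1) < 1 / real n)"

(* Zero terms: 0 * log 2 (1 / 0) = 0. If f vanishes from k on, the quotient is 0 / 0 = 0,
   so envelopes of finite support satisfy the condition. *)
definition envelope_tail_condition :: "(nat \<Rightarrow> real) \<Rightarrow> bool" where
  "envelope_tail_condition f \<longleftrightarrow>
     limsup (\<lambda>k. (\<Sum>\<^sub>\<infinity>i\<in>{k..}. ereal (f i * log 2 (1 / f i)))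
                 / ereal (env_tail f k * log 2 (1 / env_tail f k))) < \<infinity>"

definition distortion :: "(nat \<Rightarrow> nat \<Rightarrow> real) \<Rightarrow> bool" where
  "distortion \<rho> \<longleftrightarrow>
     (\<forall>x\<in>alphabet. \<rho> x x = 0) \<and> (\<forall>x\<in>alphabet. \<forall>y\<in>alphabet. x \<noteq> y \<longrightarrow> \<rho> x y > 0)"

definition unbounded_distortion :: "(nat \<Rightarrow> nat \<Rightarrow> real) \<Rightarrow> bool" where
  "unbounded_distortion \<rho> \<longleftrightarrow>
     distortion \<rho> \<and> (\<forall>K. \<exists>x\<in>alphabet. \<exists>y\<in>alphabet. \<rho> x y > K)"

definition euclidean_consistent :: "(nat \<Rightarrow> nat \<Rightarrow> real) \<Rightarrow> bool" where
  "euclidean_consistent \<rho> \<longleftrightarrow>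
     (\<forall>K>0. \<exists>\<epsilon>>0. \<forall>i\<in>alphabet. \<forall>j\<in>alphabet. \<bar>real i - real j\<bar> \<ge> \<epsilon> \<longrightarrow> \<rho> i j \<ge> K)"

definition block_distortion ::
    "(nat \<Rightarrow> nat \<Rightarrow> real) \<Rightarrow> nat \<Rightarrow> nat list \<Rightarrow> nat list \<Rightarrow> real" where
  "block_distortion \<rho> n xs ys = (1 / real n) * (\<Sum>i<n. \<rho> (xs ! i) (ys ! i))"

type_synonym code_triple =
  "(nat list \<Rightarrow> nat list) \<times> (nat list \<Rightarrow> bool list) \<times> (bool list \<Rightarrow> nat list)"

definition prefix_free_on :: "nat list set \<Rightarrow> (nat list \<Rightarrow> bool list) \<Rightarrow> bool" where
  "prefix_free_on B c \<longleftrightarrow> (\<forall>y\<in>B. \<forall>z\<in>B. prefix (c y) (c z) \<longrightarrow> y = z)"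

(* Binary strings are the nonempty ones. *)
definition semifaithful_code ::
    "(nat \<Rightarrow> nat \<Rightarrow> real) \<Rightarrow> real \<Rightarrow> nat \<Rightarrow> code_triple \<Rightarrow> bool" where
  "semifaithful_code \<rho> d n \<xi> \<longleftrightarrow>
     (case \<xi> of (quant, enc, dec) \<Rightarrow>
       (let B = quant ` words n in
          B \<subseteq> words n
        \<and> (\<forall>xs\<in>words n. block_distortion \<rho> n xs (quant xs) \<le> d)
        \<and> (\<forall>ys\<in>B. quant ys = ys)
        \<and> (\<forall>ys\<in>B. enc ys \<noteq> [])
        \<and> prefix_free_on B enc
        \<and> (\<forall>s. s \<noteq> [] \<longrightarrow> dec s \<in> B)
        \<and> (\<forall>ys\<in>B. dec (enc ys) = ys)))"

definition semifaithful_scheme ::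
    "(nat \<Rightarrow> nat \<Rightarrow> real) \<Rightarrow> real \<Rightarrow> (nat \<Rightarrow> code_triple) \<Rightarrow> bool" where
  "semifaithful_scheme \<rho> d \<xi> \<longleftrightarrow> (\<forall>n\<ge>1. semifaithful_code \<rho> d n (\<xi> n))"

definition code_rate :: "nat \<Rightarrow> code_triple \<Rightarrow> nat list pmf \<Rightarrow> ereal" where
  "code_rate n \<xi> P =
     (case \<xi> of (quant, enc, dec) \<Rightarrow>
       ereal (1 / real n) * enn2ereal (\<integral>\<^sup>+xs. of_nat (length (enc (quant xs))) \<partial>measure_pmf P))"

definition partition_entropy :: "nat list set set \<Rightarrow> nat list pmf \<Rightarrow> ereal" where
  "partition_entropy \<pi> P =
     (\<Sum>\<^sub>\<infinity>A\<in>\<pi>. ereal (- (measure_pmf.prob P A * log 2 (measure_pmf.prob P A))))"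

definition distortion_partitions ::
    "(nat \<Rightarrow> nat \<Rightarrow> real) \<Rightarrow> nat \<Rightarrow> real \<Rightarrow> nat list set set set" where
  "distortion_partitions \<rho> n d =
     {\<pi>. partition_on (words n) \<pi> \<and>
         (\<forall>A\<in>\<pi>. \<exists>ys\<in>A. (SUP xs\<in>A. ereal (block_distortion \<rho> n xs ys)) \<le> ereal d)}"

definition optimal_rate ::
    "(nat \<Rightarrow> nat \<Rightarrow> real) \<Rightarrow> nat \<Rightarrow> real \<Rightarrow> nat list pmf \<Rightarrow> ereal" where
  "optimal_rate \<rho> n d P =
     (INF \<pi>\<in>distortion_partitions \<rho> n d. ereal (1 / real n) * partition_entropy \<pi> P)"

end

theory Submission
  imports Defs
begin

text \<open>Fix the block length n and put U = u_f(n). Call the multiset of letters of a word its type; a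
  product source is uniform on every type class. For a type T let M(T) be the largest number of
  words of type T in one distortion ball. Every admissible partition has entropy at least
  E log (|T| / M(T)), so it suffices to construct one code whose expected length exceeds this by the
  stated amount.

  Covering a type class by translates of its best ball, under permutations of the positions, gives
  words of the right number, but a quantizer must fix its code words, so a code word that happens to
  be typical for another source is expensive. To keep the code words sparse in every type class,
  the best centre is first made exact at the letters above U and at two occurrences of every other
  letter; this costs O((U + #large letters) log n) bits. If the modified centre still differs from
  the source word in h places, the two exact occurrences can be exchanged with mismatches, which
  produces order h^2 equivalent centres, while all types that share the same type of centres differ
  from it in at most h letters. A single greedy sequence of O(h) times the necessary length serves
  all of them, and the fraction O(1/h) of used up code words balances the additional cost
  O(h log n) of each. The letters above U cost O(log n) bits in expectation by the tail condition.\<close>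

section \<open>Prefix codes, covering sequences and Hamming balls\<close>

text \<open>The square in the number of equivalent centres is the crux. Let kappa be U plus the
  number of large letters plus one. Up to (2h+1)^(U + large letters) types share one class S of
  centres, so a sequence serving all of them is longer than a covering of a single type by a factor
  of order h kappa. Divided by order h^2 equivalent centres, this leaves a fraction of order kappa /
  h of S used up. A used word costs up to log M(S) bits more than its share, which is of order (h +
  kappa) log n, so the average loss is of order kappa log n. If all mismatches carry one letter, a
  single exact occurrence would allow only h such exchanges, and the loss would still grow with h.
  Words that the sequence misses represent themselves and carry the same surcharge; therefore the
  sequence is run until only a fraction of order 1 / h is missed. There are infinitely many types,
  so a type cannot be named by a uniform index. It is described through weights derived from the
  envelope.\<close>

lemma ln_2_ge_half: "ln 2 \<ge> (1/2::real)"
proof -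
  have "ln (1/2::real) \<le> 1/2 - 1" by (intro ln_le_minus_one) auto
  then show ?thesis by (simp add: ln_div)
qed

lemma log2_le_self: "log 2 x \<le> x" if "x > 0" for x :: real
proof -
  \<comment> \<open>The tangent of \<open>ln\<close> at 2: the tangent at 1 has slope 1 / ln 2 > 1
    after the change to base 2 and would fail for large x.\<close>
  have "ln (x / 2) \<le> x / 2 - 1" using that by (intro ln_le_minus_one) auto
  then have a: "ln x \<le> x / 2 - 1 + ln 2" using that by (simp add: ln_div)
  have "ln x \<le> x * ln 2"
  proof (cases "x \<ge> 1")
    case True
    then have "0 \<le> (x - 1) * (ln 2 - 1/2)" using ln_2_ge_half by simp
    also have "\<dots> = x * ln 2 - x / 2 - ln 2 + 1 / 2"
      by (simp add: left_diff_distrib right_diff_distrib diff_divide_distrib)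
    finally show ?thesis using a by linarith
  next
    case False
    then have "ln x \<le> 0" using that by simp
    moreover have "0 \<le> x * ln 2" using that by simp
    ultimately show ?thesis by linarith
  qed
  then show ?thesis by (simp add: log_def divide_le_eq)
qed

text \<open>Level sizes of at most 2^k do not give Kraft's inequality. Announcing the level in a
  self-delimiting way, as in the Elias codes, repairs this: if L has J binary digits, then J ones, a
  zero and J digits take 2J + 1 bits in front of the L bits that name the element, and J \<le> log
  (1 + L) + 1.\<close>

lemma prefix_code_exists:
  fixes L :: "'a \<Rightarrow> nat"
  assumes fin: "\<And>k. finite {y \<in> B. L y = k}"
    and card: "\<And>k. card {y \<in> B. L y = k} \<le> 2 ^ k"
  obtains enc :: "'a \<Rightarrow> bool list"
  where "\<And>y z. y \<in> B \<Longrightarrow> z \<in> B \<Longrightarrow> prefix (enc y) (enc z) \<Longrightarrow> y = z"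
    and "\<And>y. y \<in> B \<Longrightarrow> enc y \<noteq> []"
    and "\<And>y. y \<in> B \<Longrightarrow> real (length (enc y)) \<le> real (L y) + 2 * log 2 (1 + real (L y)) + 3"
proof -
  define bl where "bl j = {bs :: bool list. length bs = j}" for j
  have fbl: "finite (bl j)" for j
    unfolding bl_def using finite_lists_length_eq[of "UNIV :: bool set" j] by simp
  have cbl: "card (bl j) = 2 ^ j" for j
    unfolding bl_def using card_lists_length_eq[of "UNIV :: bool set" j] by simp
  have "\<forall>k. \<exists>g. inj_on g {y \<in> B. L y = k} \<and> g ` {y \<in> B. L y = k} \<subseteq> bl k"
    using card_le_inj[OF fin fbl] card cbl by metis
  then obtain g where g: "\<And>k. inj_on (g k) {y \<in> B. L y = k}" "\<And>k. g k ` {y \<in> B. L y = k} \<subseteq> bl k"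
    by metis
  have "\<forall>j. \<exists>c. inj_on c {..<2 ^ j :: nat} \<and> c ` {..<2 ^ j} \<subseteq> bl j"
    using card_le_inj[OF finite_lessThan fbl] cbl by (metis card_lessThan le_refl)
  then obtain c where c: "\<And>j. inj_on (c j) {..<2 ^ j :: nat}" "\<And>j. c j ` {..<2 ^ j} \<subseteq> bl j"
    by metis
  define J where "J k = (LEAST j. k < 2 ^ j)" for k :: nat
  have J: "k < 2 ^ J k" for k
    unfolding J_def by (rule LeastI[of _ k]) (rule less_exp)
  have Jle: "real (J k) \<le> log 2 (1 + real k) + 1" for k
  proof (cases "J k")
    case (Suc j)
    have "\<not> k < 2 ^ j" using not_less_Least[of j "\<lambda>j. k < 2 ^ j"] Suc unfolding J_def by simp
    then have "2 ^ j \<le> k + 1" by simp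
    then have "real (2 ^ j) \<le> real (k + 1)" using of_nat_mono by blast
    then have "2 ^ j \<le> 1 + real k" by simp
    then have "log 2 (2 ^ j) \<le> log 2 (1 + real k)" by (subst log_le_cancel_iff) auto
    then show ?thesis using Suc by (simp add: log_nat_power)
  qed simp
  define enc where "enc y = replicate (J (L y)) True @ False # c (J (L y)) (L y) @ g (L y) y" for y
  have lc: "length (c (J k) k) = J k" for k using c(2)[of "J k"] J[of k] by (auto simp: bl_def)
  have lg: "length (g (L y) y) = L y" if "y \<in> B" for y using g(2)[of "L y"] that by (auto simp: bl_def)
  have unary: "i = j \<and> prefix xs ys"
    if "prefix (replicate i True @ False # xs) (replicate j True @ False # ys)" for i j xs ys
    using that
  proof (induction i arbitrary: j)
    case 0 then show ?case by (cases j) auto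
  next
    case (Suc i) then show ?case by (cases j) auto
  qed
  have eqlen: "a = b \<and> prefix xs ys" if "prefix (a @ xs) (b @ ys)" "length a = length b"
    for a b xs ys :: "bool list"
    using that by (auto simp: prefix_def)
  show ?thesis
  proof (rule that[of enc])
    fix y z assume y: "y \<in> B" and z: "z \<in> B" and p: "prefix (enc y) (enc z)"
    from unary[OF p[unfolded enc_def]]
    have j: "J (L y) = J (L z)"
      and p2: "prefix (c (J (L y)) (L y) @ g (L y) y) (c (J (L z)) (L z) @ g (L z) z)" by auto
    have "length (c (J (L y)) (L y)) = length (c (J (L z)) (L z))" by (subst (1 2) lc) (rule j)
    note split = eqlen[OF p2 this]
    have "c (J (L z)) (L y) = c (J (L z)) (L z)" using split j by metis
    then have L: "L y = L z"
      using inj_onD[OF c(1)[of "J (L z)"]] J[of "L y"] J[of "L z"] j by (metis lessThan_iff)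
    have "g (L y) y = g (L z) z" using split lg[OF y] lg[OF z] L by (auto simp: prefix_def)
    then have "g (L z) y = g (L z) z" by (simp only: L)
    then show "y = z" using y z L by (intro inj_onD[OF g(1)[of "L z"]]) auto
  next
    fix y assume "y \<in> B"
    then show "real (length (enc y)) \<le> real (L y) + 2 * log 2 (1 + real (L y)) + 3"
      using lc lg Jle[of "L y"] by (simp add: enc_def)
  qed (simp add: enc_def)
qed

text \<open>Derandomised covering: the weighted potential of uncovered fractions does not increase
  when the next element of the sequence is chosen better than average.\<close>

lemma simultaneous_covering_sequence:
  fixes Y :: "'b set" and I :: "'i set" and X :: "'i \<Rightarrow> 'a set" and p w :: "'i \<Rightarrow> real"
  assumes Y: "finite Y" "Y \<noteq> {}" and I: "finite I" and X: "\<And>t. t \<in> I \<Longrightarrow> finite (X t)"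
    and w: "\<And>t. t \<in> I \<Longrightarrow> w t > 0" "sum w I \<le> 1"
    and p: "\<And>t x. t \<in> I \<Longrightarrow> x \<in> X t \<Longrightarrow> p t * real (card Y) \<le> real (card {y \<in> Y. R t x y})"
  obtains s :: "nat \<Rightarrow> 'b"
  where "\<And>i. s i \<in> Y"
    and "\<And>N t. t \<in> I \<Longrightarrow> real (card {x \<in> X t. \<forall>i<N. \<not> R t x (s i)})
           \<le> exp (- p t * real N) / w t * real (card (X t))"
proof -
  define un where "un t ys = {x \<in> X t. \<forall>y\<in>set ys. \<not> R t x y}" for t ys
  \<comment> \<open>Dividing by the size of \<open>X t\<close> makes the initial potential at most
    the sum of the weights. The \<open>of_bool\<close> term only avoids a zero denominator for an
    empty \<open>X t\<close>.\<close>
  define c where "c t = w t / (real (card (X t)) + of_bool (card (X t) = 0))" for t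
  have c0: "c t \<ge> 0" if "t \<in> I" for t using w(1)[OF that] by (simp add: c_def)
  define Phi where "Phi ys = (\<Sum>t\<in>I. c t * exp (p t * real (length ys)) * real (card (un t ys)))" for ys
  have fun_un: "finite (un t ys)" if "t \<in> I" for t ys using X[OF that] by (simp add: un_def)
  have step: "\<exists>y\<in>Y. Phi (y # ys) \<le> Phi ys" for ys
  proof (rule ccontr)
    assume "\<not> ?thesis"
    then have "\<And>y. y \<in> Y \<Longrightarrow> Phi ys < Phi (y # ys)" by auto
    then have "(\<Sum>y\<in>Y. Phi ys) < (\<Sum>y\<in>Y. Phi (y # ys))" using Y by (intro sum_strict_mono) auto
    moreover have "(\<Sum>y\<in>Y. Phi (y # ys)) \<le> (\<Sum>y\<in>Y. Phi ys)"
    proof -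
      have per: "(\<Sum>y\<in>Y. real (card (un t (y # ys)))) \<le> real (card Y) * (exp (- p t) * real (card (un t ys)))"
        if t: "t \<in> I" for t
      proof -
        have e: "real (card (un t (y # ys))) = real (card (un t ys)) - real (card {x \<in> un t ys. R t x y})" for y
        proof -
          have "un t ys = un t (y # ys) \<union> {x \<in> un t ys. R t x y}" by (auto simp: un_def)
          moreover have "un t (y # ys) \<inter> {x \<in> un t ys. R t x y} = {}" by (auto simp: un_def)
          ultimately have "card (un t ys) = card (un t (y # ys)) + card {x \<in> un t ys. R t x y}"
            using fun_un[OF t] by (metis (no_types, lifting) card_Un_disjoint finite_Un)
          then show ?thesis by simp
        qed
        \<comment> \<open>Double counting: every uncovered x is related to at least a fraction
          \<open>p t\<close> of Y, so an average y covers at least that fraction of the uncovered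
          elements.\<close>
        have "(\<Sum>y\<in>Y. real (card {x \<in> un t ys. R t x y})) = (\<Sum>x\<in>un t ys. real (card {y \<in> Y. R t x y}))"
          using sum.swap_restrict[OF Y(1) fun_un[OF t, of ys], of "\<lambda>_ _. 1::real" "\<lambda>y x. R t x y"]
          by simp
        also have "\<dots> \<ge> (\<Sum>x\<in>un t ys. p t * real (card Y))"
          using p[OF t] by (intro sum_mono) (auto simp: un_def)
        finally have "(\<Sum>y\<in>Y. real (card (un t (y # ys))))
            \<le> real (card Y) * ((1 - p t) * real (card (un t ys)))"
          by (simp add: e sum_subtractf algebra_simps)
        \<comment> \<open>Weakening 1 - p to exp (- p) makes the shrinkage cancel exactly against
          the factor exp p that the potential gains with one more element.\<close>
        also have "\<dots> \<le> real (card Y) * (exp (- p t) * real (card (un t ys)))"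
          using exp_ge_add_one_self[of "- p t"] by (intro mult_left_mono mult_right_mono) auto
        finally show ?thesis .
      qed
      have "(\<Sum>y\<in>Y. Phi (y # ys)) = (\<Sum>t\<in>I. c t * exp (p t * real (length ys) + p t) * (\<Sum>y\<in>Y. real (card (un t (y # ys)))))"
        unfolding Phi_def sum_distrib_left
        by (subst sum.swap, intro sum.cong refl) (simp add: distrib_left add.commute)
      also have "\<dots> \<le> (\<Sum>t\<in>I. c t * exp (p t * real (length ys) + p t) * (real (card Y) * (exp (- p t) * real (card (un t ys)))))"
        using per c0 by (intro sum_mono mult_left_mono) auto
      also have "\<dots> = (\<Sum>y\<in>Y. Phi ys)"
        unfolding Phi_def sum_constant sum_distrib_left by (intro sum.cong) (auto simp: exp_add exp_minus field_simps)
      finally show ?thesis .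
    qed
    ultimately show False by simp
  qed
  define nxt where "nxt ys = (SOME y. y \<in> Y \<and> Phi (y # ys) \<le> Phi ys)" for ys
  have nxt: "nxt ys \<in> Y" "Phi (nxt ys # ys) \<le> Phi ys" for ys
    using someI_ex[of "\<lambda>y. y \<in> Y \<and> Phi (y # ys) \<le> Phi ys"] step[of ys] unfolding nxt_def by blast+
  define pre where "pre = rec_nat [] (\<lambda>_ ys. nxt ys # ys)"
  have pre: "pre 0 = []" "pre (Suc N) = nxt (pre N) # pre N" for N by (simp_all add: pre_def)
  define s where "s i = nxt (pre i)" for i
  have set_pre: "set (pre N) = s ` {..<N}" for N
    by (induction N) (auto simp: pre s_def lessThan_Suc)
  have len_pre: "length (pre N) = N" for N by (induction N) (auto simp: pre)
  have Phi0: "Phi [] \<le> 1"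
  proof -
    have "Phi [] \<le> sum w I" unfolding Phi_def
      using w(1) by (intro sum_mono) (auto simp: c_def un_def field_simps less_imp_le)
    then show ?thesis using w(2) by simp
  qed
  have PhiN: "Phi (pre N) \<le> 1" for N
    by (induction N) (use Phi0 nxt(2) in \<open>auto simp: pre intro: order_trans\<close>)
  show ?thesis
  proof (rule that[of s])
    show "s i \<in> Y" for i by (simp add: s_def nxt)
    fix N t assume t: "t \<in> I"
    have eq: "{x \<in> X t. \<forall>i<N. \<not> R t x (s i)} = un t (pre N)"
      by (auto simp: un_def set_pre)
    show "real (card {x \<in> X t. \<forall>i<N. \<not> R t x (s i)}) \<le> exp (- p t * real N) / w t * real (card (X t))"
    proof (cases "card (X t) = 0")
      case True
      then have "X t = {}" using X[OF t] by simp
      then show ?thesis by simp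
    next
      case False
      have "c t * exp (p t * real N) * real (card (un t (pre N))) \<le> Phi (pre N)"
        unfolding Phi_def len_pre using t I c0 by (intro member_le_sum) auto
      also have "\<dots> \<le> 1" by (rule PhiN)
      finally show ?thesis unfolding eq using False w(1)[OF t]
        by (simp add: c_def exp_minus field_simps)
    qed
  qed
qed

lemma pigeonhole_fibre:
  assumes A: "finite A" "A \<noteq> {}" and f: "f ` A \<subseteq> C" and C: "finite C" "card C \<le> c"
  obtains y where "y \<in> f ` A" "card A \<le> c * card {x \<in> A. f x = y}"
proof -
  define m where "m = Max ((\<lambda>y. card {x \<in> A. f x = y}) ` f ` A)"
  have "m \<in> (\<lambda>y. card {x \<in> A. f x = y}) ` f ` A" unfolding m_def using A by (intro Max_in) auto
  then obtain y where y: "y \<in> f ` A" "m = card {x \<in> A. f x = y}" by auto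
  have "card A = (\<Sum>y\<in>f ` A. card {x \<in> A. f x = y})"
    using A by (intro sum.image_gen[of A "\<lambda>_. 1::nat" f, simplified])
  also have "\<dots> \<le> (\<Sum>y\<in>f ` A. m)" unfolding m_def using A by (intro sum_mono Max_ge) auto
  also have "\<dots> = card (f ` A) * m" by simp
  also have "\<dots> \<le> c * m" using card_mono[OF C(1) f] C(2) by (intro mult_right_mono) auto
  finally show ?thesis using that y by auto
qed

section \<open>Hamming balls with finitely many replacement letters\<close>

definition hamming :: "nat \<Rightarrow> 'a list \<Rightarrow> 'a list \<Rightarrow> nat" where
  "hamming n x y = card {i. i < n \<and> x ! i \<noteq> y ! i}"

text \<open>The alphabet is infinite, so the ball is finite only if the replacing letters are
  confined to a finite set. In the uses A consists of the letters of a type, at most n of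
  them.\<close>

definition hamming_ball :: "nat \<Rightarrow> 'a list \<Rightarrow> 'a set \<Rightarrow> nat \<Rightarrow> 'a list set" where
  "hamming_ball n y A k =
     {z. length z = n \<and> hamming n z y \<le> k \<and> (\<forall>i<n. z ! i \<noteq> y ! i \<longrightarrow> z ! i \<in> A)}"

text \<open>Every further unit of radius is one overwriting, with n places and at most n letters to
  choose from, plus one for no change. The factor n^2 + 1 is thus the price of fixing one unknown
  letter, about 2 log n bits.\<close>

lemma card_hamming_ball:
  assumes y: "length y = n" and A: "finite A" "card A \<le> n"
  shows "finite (hamming_ball n y A k) \<and> card (hamming_ball n y A k) \<le> (n\<^sup>2 + 1) ^ k"
proof (induction k)
  case 0
  have "hamming_ball n y A 0 \<subseteq> {y}"
    using y by (auto simp: hamming_ball_def hamming_def intro: nth_equalityI)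
  then show ?case using card_mono[of "{y}" "hamming_ball n y A 0"] finite_subset by auto
next
  case (Suc k)
  let ?H = "hamming_ball n y A k"
  let ?U = "(\<lambda>((i, a), z). z[i := a]) ` (({..<n} \<times> A) \<times> ?H)"
  have sub: "hamming_ball n y A (Suc k) \<subseteq> ?H \<union> ?U"
  proof
    fix z assume z: "z \<in> hamming_ball n y A (Suc k)"
    show "z \<in> ?H \<union> ?U"
    proof (cases "hamming n z y \<le> k")
      case True then show ?thesis using z by (auto simp: hamming_ball_def)
    next
      case False
      then have "{i. i < n \<and> z ! i \<noteq> y ! i} \<noteq> {}" unfolding hamming_def by (metis card.empty zero_le)
      then obtain i where i: "i < n" "z ! i \<noteq> y ! i" by auto
      let ?z = "z[i := y ! i]"
      have lz: "length z = n" using z by (simp add: hamming_ball_def)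
      have "{j. j < n \<and> ?z ! j \<noteq> y ! j} = {j. j < n \<and> z ! j \<noteq> y ! j} - {i}"
        using lz i(1) by (auto simp: nth_list_update split: if_splits)
      then have "hamming n ?z y = hamming n z y - 1" using i by (simp add: hamming_def)
      then have "?z \<in> ?H" using z lz i(1) by (auto simp: hamming_ball_def nth_list_update split: if_splits)
      moreover have "z = ?z[i := z ! i]" by simp
      moreover have "z ! i \<in> A" using z i by (auto simp: hamming_ball_def)
      ultimately show ?thesis using i(1)
        by (intro UnI2 image_eqI[of _ _ "((i, z ! i), ?z)"]) auto
    qed
  qed
  have fin: "finite (?H \<union> ?U)" using Suc A by auto
  have "card (hamming_ball n y A (Suc k)) \<le> card ?H + card ?U"
    using card_mono[OF fin sub] card_Un_le[of ?H ?U] by linarith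
  also have "card ?U \<le> (n * card A) * card ?H"
    using card_image_le[of "({..<n} \<times> A) \<times> ?H"] Suc A by (simp add: card_cartesian_product)
  also have "\<dots> \<le> n\<^sup>2 * card ?H" using A by (simp add: power2_eq_square)
  also have "card ?H + n\<^sup>2 * card ?H = (n\<^sup>2 + 1) * card ?H" by simp
  also have "\<dots> \<le> (n\<^sup>2 + 1) * (n\<^sup>2 + 1) ^ k" using Suc by (intro mult_left_mono) auto
  finally show ?case using finite_subset[OF sub fin] by simp
qed

section \<open>Type classes and distortion balls\<close>

definition typecls :: "nat multiset \<Rightarrow> nat list set" where
  "typecls T = {x. mset x = T}"

definition word_types :: "nat \<Rightarrow> nat multiset set" where
  "word_types n = {T. size T = n \<and> set_mset T \<subseteq> alphabet}"

lemma finite_typecls [simp]: "finite (typecls T)"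
  using finite_permutations_of_multiset[of T] by (simp add: typecls_def permutations_of_multiset_def)

lemma typecls_nonempty: "typecls T \<noteq> {}"
  using ex_mset[of T] by (auto simp: typecls_def)

lemma card_typecls_pos: "card (typecls T) > 0"
  using typecls_nonempty by (simp add: card_gt_0_iff)

lemma typecls_length: "T \<in> word_types n \<Longrightarrow> x \<in> typecls T \<Longrightarrow> length x = n"
  by (auto simp: word_types_def typecls_def)

lemma typecls_words: "T \<in> word_types n \<Longrightarrow> typecls T \<subseteq> words n"
  by (auto simp: word_types_def typecls_def words_def)

lemma mset_word_types: "x \<in> words n \<Longrightarrow> mset x \<in> word_types n"
  by (auto simp: word_types_def words_def)

lemma card_set_mset_le_size: "card (set_mset T) \<le> size T"
proof -
  obtain xs where "mset xs = T" using ex_mset by blast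
  then show ?thesis using card_length[of xs] by auto
qed

lemma card_set_word_type: "T \<in> word_types n \<Longrightarrow> card (set_mset T) \<le> n"
  using card_set_mset_le_size[of T] by (simp add: word_types_def)

lemma words_nth: "x \<in> words n \<Longrightarrow> i < n \<Longrightarrow> x ! i \<in> alphabet"
  by (auto simp: words_def)

section \<open>Invariance under permutations of the positions\<close>

lemma inj_on_permute_list:
  assumes "p permutes {..<n}"
  shows "inj_on (permute_list p) {x. length x = n}"
proof (rule inj_onI, clarify)
  fix x y :: "'a list" assume l: "length y = length x" "n = length x" and e: "permute_list p x = permute_list p y"
  show "x = y"
  proof (rule nth_equalityI)
    fix i assume i: "i < length x"
    then obtain j where j: "j < length x" "i = p j"
      using assms l permutes_image[OF assms] by auto
    have "permute_list p x ! j = permute_list p y ! j" using e by simp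
    then show "x ! i = y ! i" using j l assms by (simp add: permute_list_nth)
  qed (use l in simp)
qed

lemma card_Collect_permute:
  assumes "p permutes {..<n}"
  shows "card {i. i < n \<and> P (p i)} = card {i. i < n \<and> P i}"
proof -
  have "{i. i < n \<and> P i} = p ` {i. i < n \<and> P (p i)}"
    using permutes_image[OF assms] permutes_in_image[OF assms] by auto
  moreover have "inj_on p {i. i < n \<and> P (p i)}" using permutes_inj_on[OF assms] .
  ultimately show ?thesis by (simp add: card_image)
qed

lemma hamming_permute:
  assumes "p permutes {..<n}" "length x = n" "length y = n"
  shows "hamming n (permute_list p x) (permute_list p y) = hamming n x y"
proof -
  have "hamming n (permute_list p x) (permute_list p y) = card {i. i < n \<and> x ! p i \<noteq> y ! p i}"
    unfolding hamming_def using assms by (intro arg_cong[of _ _ card]) (auto simp: permute_list_nth)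
  then show ?thesis using card_Collect_permute[OF assms(1), of "\<lambda>i. x ! i \<noteq> y ! i"]
    by (simp add: hamming_def)
qed

lemma hamming_le: "hamming n x y \<le> n"
proof -
  have "hamming n x y \<le> card {..<n}" unfolding hamming_def by (intro card_mono) auto
  then show ?thesis by simp
qed

lemma block_distortion_permute:
  assumes "p permutes {..<n}" "length x = n" "length y = n"
  shows "block_distortion \<rho> n (permute_list p x) (permute_list p y) = block_distortion \<rho> n x y"
proof -
  have "(\<Sum>i<n. \<rho> (permute_list p x ! i) (permute_list p y ! i)) = (\<Sum>i<n. \<rho> (x ! p i) (y ! p i))"
    using assms by (intro sum.cong) (auto simp: permute_list_nth)
  also have "\<dots> = (\<Sum>i<n. \<rho> (x ! i) (y ! i))"
    using sum.permute[OF assms(1), of "\<lambda>i. \<rho> (x ! i) (y ! i)"] by (simp add: o_def)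
  finally show ?thesis by (simp add: block_distortion_def)
qed

lemma same_type_permutation:
  assumes "mset x = mset x'" "length x = n"
  obtains p where "p permutes {..<n}" "permute_list p x = x'"
  using mset_eq_permutation[of x' x] assms by metis

text \<open>A permutation carrying x to x' preserves types and the relation, hence injects one set
  into the other. By symmetry an invariant relation between two type classes is regular, so a single
  word represents its whole class in all counts.\<close>

lemma card_related_typecls_le:
  assumes inv: "\<And>p x y. p permutes {..<n} \<Longrightarrow> length x = n \<Longrightarrow> length y = n \<Longrightarrow> Q x y \<Longrightarrow>
      Q (permute_list p x) (permute_list p y)"
    and xs: "mset x = mset x'" "length x = n" and S: "size S = n"
  shows "card {y \<in> typecls S. Q x y} \<le> card {y \<in> typecls S. Q x' y}"
proof -
  obtain p where p: "p permutes {..<n}" "permute_list p x = x'"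
    using same_type_permutation xs by blast
  have len: "length y = n" if "y \<in> typecls S" for y
    using that S by (auto simp: typecls_def)
  show ?thesis
  proof (rule card_inj_on_le[of "permute_list p"])
    show "inj_on (permute_list p) {y \<in> typecls S. Q x y}"
      using inj_on_permute_list[OF p(1)] by (rule inj_on_subset) (auto simp: len)
    show "permute_list p ` {y \<in> typecls S. Q x y} \<subseteq> {y \<in> typecls S. Q x' y}"
      using p inv[OF p(1) xs(2)] len by (auto simp: typecls_def)
  qed simp
qed

lemma card_related_typecls:
  assumes inv: "\<And>p x y. p permutes {..<n} \<Longrightarrow> length x = n \<Longrightarrow> length y = n \<Longrightarrow> Q x y \<Longrightarrow>
      Q (permute_list p x) (permute_list p y)"
    and xs: "mset x = mset x'" "length x = n" and S: "size S = n"
  shows "card {y \<in> typecls S. Q x y} = card {y \<in> typecls S. Q x' y}"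
proof (rule le_antisym)
  show "card {y \<in> typecls S. Q x y} \<le> card {y \<in> typecls S. Q x' y}"
    by (rule card_related_typecls_le[of n Q, OF _ xs S]) (rule inv)
  have l: "length x' = n" using xs by (metis size_mset)
  show "card {y \<in> typecls S. Q x' y} \<le> card {y \<in> typecls S. Q x y}"
    by (rule card_related_typecls_le[of n Q, OF _ xs(1)[symmetric] l S]) (rule inv)
qed

text \<open>The number of earlier elements is injective on P, so each of the values 0 and 1 is taken
  at most once.\<close>

lemma card_set_bool_le2:
  fixes P :: "nat \<Rightarrow> bool"
  shows "card {i. P i \<and> card {j. j < i \<and> P j} < 2} \<le> 2 \<and> finite {i. P i \<and> card {j. j < i \<and> P j} < 2}"
proof -
  let ?E = "{i. P i \<and> card {j. j < i \<and> P j} < 2}"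
  have inj: "inj_on (\<lambda>i. card {j. j < i \<and> P j}) ?E"
  proof (rule linorder_inj_onI)
    fix i k assume ik: "i < k" "i \<in> ?E" "k \<in> ?E"
    then have "{j. j < i \<and> P j} \<subset> {j. j < k \<and> P j}" by auto
    then have "card {j. j < i \<and> P j} < card {j. j < k \<and> P j}" by (rule psubset_card_mono[rotated]) simp
    then show "card {j. j < i \<and> P j} \<noteq> card {j. j < k \<and> P j}" by linarith
  qed (rule linear)
  have sub: "(\<lambda>i. card {j. j < i \<and> P j}) ` ?E \<subseteq> {..<2}" by auto
  have fin: "finite {..<2::nat}" by simp
  show ?thesis using card_inj_on_le[OF inj sub fin] inj_on_finite[OF inj sub fin] unfolding card_lessThan by blast
qed

text \<open>The first two elements of P serve: they precede i and have at most one element of P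
  before them, so they belong to the places that are kept exact.\<close>

lemma two_early_occurrences:
  fixes P :: "nat \<Rightarrow> bool"
  assumes c: "\<not> card {j. j < i \<and> P j} < 2"
  obtains j k where "j < i" "k < i" "j \<noteq> k" "P j" "P k" "card {l. l < j \<and> P l} < 2" "card {l. l < k \<and> P l} < 2"
proof -
  have "\<exists>j. j < i \<and> P j"
  proof (rule ccontr)
    assume "\<not> ?thesis"
    then have "{j. j < i \<and> P j} = {}" by blast
    then have "card {j. j < i \<and> P j} = 0" by (simp only: card.empty)
    then show False using c by linarith
  qed
  then obtain j0 where j0: "j0 < i" "P j0" by blast
  define j where "j = (LEAST j. P j)"
  have j: "P j" "j \<le> j0" unfolding j_def using j0(2) by (auto intro: LeastI Least_le)
  have jmin: "j \<le> l" if "P l" for l unfolding j_def by (rule Least_le) fact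
  have "\<exists>k. k < i \<and> P k \<and> k \<noteq> j"
  proof (rule ccontr)
    assume "\<not> ?thesis"
    then have "{j. j < i \<and> P j} \<subseteq> {j}" by blast
    then have "card {j. j < i \<and> P j} \<le> card {j}" by (rule card_mono[rotated]) simp
    then show False using c by simp
  qed
  then obtain k0 where k0: "k0 < i" "P k0 \<and> k0 \<noteq> j" by blast
  define k where "k = (LEAST k. P k \<and> k \<noteq> j)"
  have k: "P k \<and> k \<noteq> j" unfolding k_def by (rule LeastI) (rule k0(2))
  have "k \<le> k0" unfolding k_def by (rule Least_le) (rule k0(2))
  have kmin: "k \<le> l" if "P l \<and> l \<noteq> j" for l unfolding k_def by (rule Least_le) fact
  have "{l. l < j \<and> P l} \<subseteq> {j}" using jmin leD by blast
  then have cj: "card {l. l < j \<and> P l} \<le> card {j}" by (rule card_mono[rotated]) simp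
  have "{l. l < k \<and> P l} \<subseteq> {j}" using kmin leD by blast
  then have ck: "card {l. l < k \<and> P l} \<le> card {j}" by (rule card_mono[rotated]) simp
  show ?thesis
    by (rule that[of j k]) (use j k \<open>k \<le> k0\<close> j0 k0 cj ck in auto)
qed

section \<open>Distortion balls and centres with exact places\<close>

locale distortion_block =
  fixes \<rho> :: "nat \<Rightarrow> nat \<Rightarrow> real" and d :: real and n U :: nat
  assumes n1: "n \<ge> 1" and d0: "d \<ge> 0"
    and rho_refl: "\<And>x. x \<in> alphabet \<Longrightarrow> \<rho> x x = 0"
    and rho_nonneg: "\<And>x y. x \<in> alphabet \<Longrightarrow> y \<in> alphabet \<Longrightarrow> \<rho> x y \<ge> 0"
begin

definition close :: "nat list \<Rightarrow> nat list \<Rightarrow> bool" where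
  "close x y \<longleftrightarrow> block_distortion \<rho> n x y \<le> d"

text \<open>The centre may have any type and ranges over infinitely many words; \<open>Max\<close>
  makes sense because the values are bounded by the size of the type class.\<close>

definition max_ball :: "nat multiset \<Rightarrow> nat" where
  "max_ball T = Max ((\<lambda>y. card {x \<in> typecls T. close x y}) ` words n)"

definition big :: "nat multiset \<Rightarrow> nat" where
  "big T = size {#a \<in># T. a > U#}"

text \<open>The second condition makes mismatched positions exchangeable with matched ones
  carrying the same letter of x; this produces many equivalent reproductions.\<close>

definition rel :: "nat \<Rightarrow> nat list \<Rightarrow> nat list \<Rightarrow> bool" where
  "rel h x y \<longleftrightarrow> close x y \<and> hamming n x y = h \<and>
     (\<forall>i<n. x ! i \<noteq> y ! i \<longrightarrow> x ! i \<le> U \<and>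
        (\<exists>j<n. \<exists>k<n. j \<noteq> k \<and> x ! j = x ! i \<and> y ! j = x ! i \<and> x ! k = x ! i \<and> y ! k = x ! i))"

lemma close_refl: "x \<in> words n \<Longrightarrow> close x x"
  using d0 rho_refl words_nth by (simp add: close_def block_distortion_def)

lemma close_iff: "close x y \<longleftrightarrow> (\<Sum>i<n. \<rho> (x ! i) (y ! i)) \<le> n * d"
  using n1 by (simp add: close_def block_distortion_def field_simps)

text \<open>A coordinate copied from x contributes \<open>\<rho>\<close> = 0, so making a centre
  exact at chosen places never increases the distortion. Only the number of different centres
  grows.\<close>

lemma close_overwrite:
  assumes x: "x \<in> words n" and y: "y \<in> words n" and xy: "close x y"
    and z: "\<And>i. i < n \<Longrightarrow> z ! i = x ! i \<or> z ! i = y ! i"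
  shows "close x z"
proof -
  have "(\<Sum>i<n. \<rho> (x ! i) (z ! i)) \<le> (\<Sum>i<n. \<rho> (x ! i) (y ! i))"
  proof (rule sum_mono)
    fix i assume "i \<in> {..<n}"
    then show "\<rho> (x ! i) (z ! i) \<le> \<rho> (x ! i) (y ! i)"
      using z[of i] words_nth[OF x] words_nth[OF y] rho_refl rho_nonneg by fastforce
  qed
  then show ?thesis using xy by (simp add: close_iff)
qed

lemma rel_permute:
  assumes p: "p permutes {..<n}" and l: "length x = n" "length y = n" and r: "rel h x y"
  shows "rel h (permute_list p x) (permute_list p y)"
proof -
  have ex: "\<exists>j<n. p j = i" if "i < n" for i
    using permutes_image[OF p] that by (metis image_iff lessThan_iff)
  have lt: "p i < n" if "i < n" for i using permutes_in_image[OF p, of i] that by simp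
  show ?thesis
    unfolding rel_def
  proof (intro conjI allI impI)
    show "close (permute_list p x) (permute_list p y)"
      using r block_distortion_permute[OF p l] by (simp add: rel_def close_def)
    show "hamming n (permute_list p x) (permute_list p y) = h"
      using r hamming_permute[OF p l] by (simp add: rel_def)
    fix i assume i: "i < n" and ne: "permute_list p x ! i \<noteq> permute_list p y ! i"
    have xi: "permute_list p x ! i = x ! p i" using i p l by (simp add: permute_list_nth)
    have ne': "x ! p i \<noteq> y ! p i" using ne i p l by (simp add: permute_list_nth)
    then show "permute_list p x ! i \<le> U" using r lt[OF i] xi by (simp add: rel_def)
    obtain j k where jk: "j < n" "k < n" "j \<noteq> k" "x ! j = x ! p i" "y ! j = x ! p i"
        "x ! k = x ! p i" "y ! k = x ! p i"
      using r ne' lt[OF i] unfolding rel_def by blast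
    obtain j' k' where "j' < n" "p j' = j" "k' < n" "p k' = k" using ex jk by metis
    then show "\<exists>j<n. \<exists>k<n. j \<noteq> k \<and> permute_list p x ! j = permute_list p x ! i \<and>
        permute_list p y ! j = permute_list p x ! i \<and> permute_list p x ! k = permute_list p x ! i \<and>
        permute_list p y ! k = permute_list p x ! i"
      using jk xi p l by (intro exI[of _ j'] exI[of _ k'] conjI) (auto simp: permute_list_nth)
  qed
qed

lemma card_rel_right:
  assumes "T \<in> word_types n" "S \<in> word_types n" "x \<in> typecls T" "x' \<in> typecls T"
  shows "card {y \<in> typecls S. rel h x y} = card {y \<in> typecls S. rel h x' y}"
  using assms by (intro card_related_typecls[of n] rel_permute)
    (auto simp: typecls_def word_types_def)

lemma card_rel_left:
  assumes "T \<in> word_types n" "S \<in> word_types n" "y \<in> typecls S" "y' \<in> typecls S"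
  shows "card {x \<in> typecls T. rel h x y} = card {x \<in> typecls T. rel h x y'}"
  using assms by (intro card_related_typecls[of n "\<lambda>y x. rel h x y"] rel_permute)
    (auto simp: typecls_def word_types_def)

text \<open>Between two type classes the relation is a biregular bipartite graph. Hence the chance
  that a random centre of type S serves x equals the chance that a random word of type T is served
  by y, which is what compares it with the largest ball.\<close>

lemma rel_double_counting:
  assumes "T \<in> word_types n" "S \<in> word_types n" "x \<in> typecls T" "y \<in> typecls S"
  shows "card (typecls T) * card {y \<in> typecls S. rel h x y} =
    card (typecls S) * card {x \<in> typecls T. rel h x y}"
proof -
  have "(\<Sum>x\<in>typecls T. card {y \<in> typecls S. rel h x y}) =
      (\<Sum>y\<in>typecls S. card {x \<in> typecls T. rel h x y})"
    using sum.swap_restrict[of "typecls T" "typecls S" "\<lambda>_ _. 1::nat" "rel h"] by simp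
  moreover have "(\<Sum>x\<in>typecls T. card {y \<in> typecls S. rel h x y}) =
      (\<Sum>x'\<in>typecls T. card {y \<in> typecls S. rel h x y})"
    by (intro sum.cong card_rel_right[OF assms(1,2)] refl assms)
  moreover have "(\<Sum>y\<in>typecls S. card {x \<in> typecls T. rel h x y}) =
      (\<Sum>y'\<in>typecls S. card {x \<in> typecls T. rel h x y})"
    by (intro sum.cong card_rel_left[OF assms(1,2)] refl assms)
  ultimately show ?thesis by simp
qed

lemma card_ball_le_max_ball: "y \<in> words n \<Longrightarrow> card {x \<in> typecls T. close x y} \<le> max_ball T"
  and max_ball_attained: "\<exists>y\<in>words n. max_ball T = card {x \<in> typecls T. close x y}"
  and max_ball_le: "max_ball T \<le> card (typecls T)"
proof -
  let ?f = "\<lambda>y. card {x \<in> typecls T. close x y}"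
  have "?f ` words n \<subseteq> {..card (typecls T)}" by (auto intro: card_mono)
  then have fin: "finite (?f ` words n)" by (rule finite_subset) simp
  have "replicate n 1 \<in> words n" by (auto simp: words_def alphabet_def)
  then have ne: "?f ` words n \<noteq> {}" by blast
  show "y \<in> words n \<Longrightarrow> ?f y \<le> max_ball T" unfolding max_ball_def using fin by (intro Max_ge) auto
  show "\<exists>y\<in>words n. max_ball T = ?f y" unfolding max_ball_def using Max_in[OF fin ne] by auto
  then show "max_ball T \<le> card (typecls T)" using card_mono[OF finite_typecls] by (metis (no_types, lifting) mem_Collect_eq subsetI)
qed

lemma max_ball_pos: "T \<in> word_types n \<Longrightarrow> max_ball T > 0"
proof -
  assume T: "T \<in> word_types n"
  obtain x where x: "x \<in> typecls T" using typecls_nonempty by blast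
  then have "x \<in> words n" using typecls_words T by blast
  then have "card {x' \<in> typecls T. close x' x} > 0" using x close_refl by (auto simp: card_gt_0_iff)
  also have "\<dots> \<le> max_ball T" by (rule card_ball_le_max_ball) fact
  finally show ?thesis .
qed

lemma big_eq_card: "big (mset x) = card {i. i < length x \<and> x ! i > U}"
proof -
  have "big (mset x) = length (filter (\<lambda>a. a > U) x)"
    unfolding big_def by (metis mset_filter size_mset)
  then show ?thesis by (simp add: length_filter_conv_card)
qed

lemma card_overwritten_positions:
  assumes x: "x \<in> words n"
  shows "card {i. i < n \<and> (x ! i > U \<or> card {j. j < i \<and> x ! j = x ! i} < 2)} \<le> big (mset x) + 2 * U"
proof -
  have l: "length x = n" using x by (simp add: words_def)
  let ?A = "{i. i < n \<and> x ! i > U}"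
  \<comment> \<open>The condition j < n is repeated inside so that both occurrences use one
    predicate, the form required by \<open>card_set_bool_le2\<close>.\<close>
  let ?B = "\<lambda>a. {i. (i < n \<and> x ! i = a) \<and> card {j. j < i \<and> (j < n \<and> x ! j = a)} < 2}"
  have sub: "{i. i < n \<and> (x ! i > U \<or> card {j. j < i \<and> x ! j = x ! i} < 2)} \<subseteq> ?A \<union> (\<Union>a\<in>{1..U}. ?B a)"
  proof
    fix i assume i: "i \<in> {i. i < n \<and> (x ! i > U \<or> card {j. j < i \<and> x ! j = x ! i} < 2)}"
    show "i \<in> ?A \<union> (\<Union>a\<in>{1..U}. ?B a)"
    proof (cases "x ! i > U")
      case False
      have "x ! i \<in> {1..U}" using False words_nth[OF x, of i] i by (auto simp: alphabet_def)
      moreover have "{j. j < i \<and> (j < n \<and> x ! j = x ! i)} = {j. j < i \<and> x ! j = x ! i}" using i by auto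
      ultimately show ?thesis using i False by auto
    qed (use i in auto)
  qed
  have 1: "card {i. i < n \<and> (x ! i > U \<or> card {j. j < i \<and> x ! j = x ! i} < 2)} \<le> card (?A \<union> (\<Union>a\<in>{1..U}. ?B a))"
    by (rule card_mono[OF _ sub]) simp
  have 2: "card (?A \<union> (\<Union>a\<in>{1..U}. ?B a)) \<le> card ?A + card (\<Union>a\<in>{1..U}. ?B a)" by (rule card_Un_le)
  have 3: "card (\<Union>a\<in>{1..U}. ?B a) \<le> (\<Sum>a\<in>{1..U}. card (?B a))" by (rule card_UN_le) simp
  have 4: "(\<Sum>a\<in>{1..U}. card (?B a)) \<le> (\<Sum>a\<in>{1..U}. 2)"
    by (rule sum_mono) (rule conjunct1[OF card_set_bool_le2])
  have 5: "card ?A = big (mset x)" using l by (simp add: big_eq_card)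
  have 6: "(\<Sum>a\<in>{1..U}. 2) = 2 * U" by simp
  show ?thesis using 1 2 3 4 unfolding 5 6 by linarith
qed

text \<open>The modified centre depends on the source word. It differs from the best centre only at
  the exact places and only by letters of T, so few modified centres are possible, and by pigeonhole
  one of them, together with one distance h, keeps a share of the best ball given by the stated
  factor.\<close>

lemma exists_related_type:
  assumes T: "T \<in> word_types n"
  obtains S h x y where "S \<in> word_types n" "h \<le> n" "x \<in> typecls T" "y \<in> typecls S" "rel h x y"
    "max_ball T \<le> (n + 1) * (n\<^sup>2 + 1) ^ (big T + 2 * U) * card {x \<in> typecls T. rel h x y}"
proof -
  obtain y0 where y0: "y0 \<in> words n" "max_ball T = card {x \<in> typecls T. close x y0}"
    using max_ball_attained by blast
  have ly0: "length y0 = n" using y0 by (simp add: words_def)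
  let ?A = "{x \<in> typecls T. close x y0}"
  let ?k = "big T + 2 * U"
  define E where "E x = {i. i < n \<and> (x ! i > U \<or> card {j. j < i \<and> x ! j = x ! i} < 2)}" for x :: "nat list"
  define e where "e x = map (\<lambda>i. if i \<in> E x then x ! i else y0 ! i) [0..<n]" for x
  have e_nth: "e x ! i = (if i \<in> E x then x ! i else y0 ! i)" if "i < n" for x i
    using that by (simp add: e_def)
  have tw: "x \<in> words n" if "x \<in> typecls T" for x by (rule subsetD[OF typecls_words[OF T] that])
  have rel_e: "rel (hamming n x (e x)) x (e x)" if x: "x \<in> ?A" for x
    unfolding rel_def
  proof (intro conjI allI impI)
    show "close x (e x)"
    proof (rule close_overwrite[OF tw y0(1)])
      show "x \<in> typecls T" "close x y0" using x by blast+
      show "e x ! i = x ! i \<or> e x ! i = y0 ! i" if "i < n" for i using e_nth[OF that, of x] by simp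
    qed
    fix i assume i: "i < n" and ne: "x ! i \<noteq> e x ! i"
    then have "i \<notin> E x" using e_nth[OF i, of x] by metis
    then have iE: "\<not> (x ! i > U \<or> card {j. j < i \<and> x ! j = x ! i} < 2)" using i unfolding E_def by blast
    then show "x ! i \<le> U" by linarith
    \<comment> \<open>A mismatch lies outside \<open>E x\<close>, so its letter has two earlier
      occurrences in x. The first two of these are in \<open>E x\<close> and thus exact, as
      \<open>rel\<close> demands.\<close>
    obtain j k where jk: "j < i" "k < i" "j \<noteq> k" "x ! j = x ! i" "x ! k = x ! i"
      "card {l. l < j \<and> x ! l = x ! i} < 2" "card {l. l < k \<and> x ! l = x ! i} < 2"
      by (rule two_early_occurrences[of i "\<lambda>l. x ! l = x ! i"]) (use iE in blast)+
    have lt: "j < n" "k < n" using jk(1,2) i by linarith+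
    have "j \<in> E x" "k \<in> E x" unfolding E_def mem_Collect_eq jk(4,5) using lt jk(6,7) by blast+
    then  have "e x ! j = x ! i" "e x ! k = x ! i" using e_nth[OF lt(1), of x] e_nth[OF lt(2), of x] jk(4,5) by metis+
    then show "\<exists>j<n. \<exists>k<n. j \<noteq> k \<and> x ! j = x ! i \<and> e x ! j = x ! i \<and> x ! k = x ! i \<and> e x ! k = x ! i"
      using jk(3-5) lt by blast
  qed simp
  have card_E: "card (E x) \<le> ?k" if "x \<in> typecls T" for x
    using card_overwritten_positions[OF tw[OF that]] that by (simp add: E_def typecls_def)
  have finE: "finite (E x)" for x unfolding E_def by simp
  have e_ball: "e x \<in> hamming_ball n y0 (set_mset T) ?k" if x: "x \<in> typecls T" for x
  proof -
    have sub: "{i. i < n \<and> e x ! i \<noteq> y0 ! i} \<subseteq> E x"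
    proof
      fix i assume "i \<in> {i. i < n \<and> e x ! i \<noteq> y0 ! i}"
      then show "i \<in> E x" using e_nth[of i x] by (cases "i \<in> E x") simp_all
    qed
    have "hamming n (e x) y0 \<le> card (E x)" unfolding hamming_def by (rule card_mono[OF finE sub])
    then have 1: "hamming n (e x) y0 \<le> ?k" using card_E[OF x] by linarith
    have 2: "e x ! i \<in> set_mset T" if "i < n" "e x ! i \<noteq> y0 ! i" for i
    proof -
      have "e x ! i = x ! i" using e_nth[OF that(1), of x] that(2) by (cases "i \<in> E x") simp_all
      moreover have "x ! i \<in> set x" using typecls_length[OF T] that(1) x by (intro nth_mem) simp
      ultimately show ?thesis using x by (simp add: typecls_def) (metis set_mset_mset)
    qed
    have 3: "length (e x) = n" by (simp add: e_def)
    show ?thesis unfolding hamming_ball_def using 1 2 3 by blast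
  qed
  \<comment> \<open>The distance takes at most n + 1 values; recording it makes h common to the
    whole fibre.\<close>
  have img: "(\<lambda>x. (e x, hamming n x (e x))) ` ?A \<subseteq> hamming_ball n y0 (set_mset T) ?k \<times> {..n}"
    by (rule image_subsetI, rule SigmaI, rule e_ball) (simp_all add: hamming_le)
  have hb: "finite (hamming_ball n y0 (set_mset T) ?k)"
    "card (hamming_ball n y0 (set_mset T) ?k) \<le> (n\<^sup>2 + 1) ^ ?k"
    using card_hamming_ball[OF ly0 _ card_set_word_type[OF T]] by auto
  have ne: "?A \<noteq> {}" using max_ball_pos[OF T] y0(2) by (metis card.empty less_irrefl)
  have fin: "finite (hamming_ball n y0 (set_mset T) ?k \<times> {..n})" using hb(1) by simp
  have cd: "card (hamming_ball n y0 (set_mset T) ?k \<times> {..n}) \<le> (n\<^sup>2 + 1) ^ ?k * (n + 1)"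
    unfolding card_cartesian_product card_atMost using mult_le_mono1[OF hb(2), of "n + 1"] by (simp only: Suc_eq_plus1)
  obtain yh where yh: "yh \<in> (\<lambda>x. (e x, hamming n x (e x))) ` ?A"
    "card ?A \<le> ((n\<^sup>2 + 1) ^ ?k * (n + 1)) * card {x \<in> ?A. (e x, hamming n x (e x)) = yh}"
    by (rule pigeonhole_fibre[OF _ ne img fin cd]) simp
  then obtain x where x: "x \<in> ?A" "yh = (e x, hamming n x (e x))" by blast
  have "e x ! i \<in> alphabet" if "i < n" for i
    using words_nth[OF y0(1) that] words_nth[OF tw[of x] that] x(1) e_nth[OF that, of x] by (metis (no_types, lifting) mem_Collect_eq)
  moreover have "length (e x) = n" by (simp add: e_def)
  ultimately have ew: "e x \<in> words n" unfolding words_def by (metis (mono_tags, lifting) in_set_conv_nth mem_Collect_eq subsetI)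
  have "card {x' \<in> ?A. (e x', hamming n x' (e x')) = yh} \<le>
      card {x' \<in> typecls T. rel (hamming n x (e x)) x' (e x)}"
  proof (intro card_mono)
    show "{x' \<in> ?A. (e x', hamming n x' (e x')) = yh} \<subseteq> {x' \<in> typecls T. rel (hamming n x (e x)) x' (e x)}"
    proof
      fix x' assume "x' \<in> {x' \<in> ?A. (e x', hamming n x' (e x')) = yh}"
      then have a: "x' \<in> ?A" "x' \<in> typecls T" "(e x', hamming n x' (e x')) = yh" by blast+
      have "x' \<in> typecls T \<and> rel (hamming n x' (e x')) x' (e x')" using rel_e[OF a(1)] a(2) by blast
      then show "x' \<in> {x' \<in> typecls T. rel (hamming n x (e x)) x' (e x)}" using a(3) unfolding x(2) prod.inject mem_Collect_eq by metis
    qed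
  qed simp
  then have "((n\<^sup>2 + 1) ^ ?k * (n + 1)) * card {x' \<in> ?A. (e x', hamming n x' (e x')) = yh} \<le>
      ((n\<^sup>2 + 1) ^ ?k * (n + 1)) * card {x' \<in> typecls T. rel (hamming n x (e x)) x' (e x)}"
    by (rule mult_le_mono2)
  then have main: "max_ball T \<le> (n + 1) * (n\<^sup>2 + 1) ^ ?k * card {x' \<in> typecls T. rel (hamming n x (e x)) x' (e x)}"
    unfolding y0(2) mult.commute[of "n + 1" "(n\<^sup>2 + 1) ^ ?k"] by (rule order_trans[OF yh(2)])
  have xT: "x \<in> typecls T" using x(1) by blast
  have "e x \<in> typecls (mset (e x))" by (simp add: typecls_def)
  then show ?thesis
    by (rule that[OF mset_word_types[OF ew] hamming_le xT _ rel_e[OF x(1)] main])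
qed

end

section \<open>Comparison of a type with the type of its centres\<close>

lemma card_le_fibres:
  assumes A: "finite A" and c: "\<And>y. y \<in> f ` A \<Longrightarrow> card {x \<in> A. f x = y} \<le> c"
  shows "card A \<le> c * card (f ` A)"
proof -
  have "card A = (\<Sum>y\<in>f ` A. card {x \<in> A. f x = y})"
    using A by (intro sum.image_gen[of A "\<lambda>_. 1::nat" f, simplified])
  also have "\<dots> \<le> (\<Sum>y\<in>f ` A. c)" by (intro sum_mono c)
  finally show ?thesis by (simp add: mult.commute)
qed

lemma count_mset_conv_card: "count (mset x) a = card {i. i < length x \<and> x ! i = a}"
  by (simp add: count_mset count_list_eq_length_filter length_filter_conv_card eq_commute)

context distortion_block
begin

text \<open>Letters of x above U are never mismatched, so they survive in y. The inequality can be
  strict, since a mismatch may put further letters above U into y.\<close>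

lemma rel_big_le:
  assumes T: "T \<in> word_types n" and S: "S \<in> word_types n"
    and x: "x \<in> typecls T" and y: "y \<in> typecls S" and r: "rel h x y"
  shows "big T \<le> big S"
proof -
  have l: "length x = n" "length y = n" using typecls_length[OF T x] typecls_length[OF S y] by auto
  have "{i. i < n \<and> x ! i > U} \<subseteq> {i. i < n \<and> y ! i > U}"
  proof clarify
    fix i assume i: "i < n" "U < x ! i"
    have "x ! i = y ! i" using r i unfolding rel_def by (metis not_less)
    then show "U < y ! i" using i by simp
  qed
  then have "card {i. i < n \<and> x ! i > U} \<le> card {i. i < n \<and> y ! i > U}" by (rule card_mono[rotated]) simp
  then show ?thesis using big_eq_card[of x] big_eq_card[of y] l x y by (simp add: typecls_def)
qed

lemma card_rel_le:
  assumes T: "T \<in> word_types n" and y: "length y = n"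
  shows "card {x \<in> typecls T. rel h x y} \<le> (n\<^sup>2 + 1) ^ h"
proof -
  have hb: "finite (hamming_ball n y (set_mset T) h)" "card (hamming_ball n y (set_mset T) h) \<le> (n\<^sup>2 + 1) ^ h"
    using card_hamming_ball[OF y _ card_set_word_type[OF T]] by auto
  have "{x \<in> typecls T. rel h x y} \<subseteq> hamming_ball n y (set_mset T) h"
  proof clarify
    fix x assume x: "x \<in> typecls T" "rel h x y"
    have l: "length x = n" by (rule typecls_length[OF T x(1)])
    have "x ! i \<in># T" if "i < n" for i using x(1) that l nth_mem[of i x] by (auto simp: typecls_def)
    then show "x \<in> hamming_ball n y (set_mset T) h"
      using l x(2) by (simp add: hamming_ball_def rel_def)
  qed
  then show ?thesis using card_mono[OF hb(1)] hb(2) order_trans by blast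
qed

text \<open>A used word of type S is charged log M(S), while the construction controls M(T).
  Permuting the pair \<open>x0\<close>, \<open>y0\<close> gives every w of type S a partner
  \<open>X w\<close> of type T at the same distance h. If w is close to z, then \<open>X w\<close>
  is close to z overwritten by \<open>X w\<close> at the h disagreements between \<open>X w\<close>
  and w. Fixing the overwritten centre loses one factor (n^2 + 1)^h; a partner is shared by at most
  (n^2 + 1)^h words, which loses the other.\<close>

lemma max_ball_transfer:
  assumes T: "T \<in> word_types n" and S: "S \<in> word_types n"
    and x0: "x0 \<in> typecls T" and y0: "y0 \<in> typecls S"
  shows "max_ball S \<le> (n\<^sup>2 + 1) ^ (2 * hamming n x0 y0) * max_ball T"
proof -
  let ?h = "hamming n x0 y0"
  have l0: "length x0 = n" "length y0 = n" using typecls_length[OF T x0] typecls_length[OF S y0] by auto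
  obtain z where z: "z \<in> words n" "max_ball S = card {w \<in> typecls S. close w z}"
    using max_ball_attained by blast
  have lz: "length z = n" using z by (simp add: words_def)
  let ?B = "{w \<in> typecls S. close w z}"
  have finB: "finite ?B" by simp
  have neB: "?B \<noteq> {}" using max_ball_pos[OF S] z(2) by (metis card.empty less_irrefl)
  have "\<forall>w\<in>typecls S. \<exists>p. p permutes {..<n} \<and> permute_list p y0 = w"
  proof
    fix w assume "w \<in> typecls S"
    then have "mset y0 = mset w" using y0 by (simp add: typecls_def)
    then show "\<exists>p. p permutes {..<n} \<and> permute_list p y0 = w"
      using same_type_permutation[OF _ l0(2)] by metis
  qed
  then obtain p where p: "\<And>w. w \<in> typecls S \<Longrightarrow> p w permutes {..<n}"
      "\<And>w. w \<in> typecls S \<Longrightarrow> permute_list (p w) y0 = w" by metis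
  define X where "X w = permute_list (p w) x0" for w
  have X: "X w \<in> typecls T" "hamming n (X w) w = ?h" if w: "w \<in> typecls S" for w
  proof -
    show "X w \<in> typecls T" using x0 p(1)[OF w] l0 by (simp add: X_def typecls_def mset_permute_list)
    show "hamming n (X w) w = ?h" using hamming_permute[OF p(1)[OF w] l0] p(2)[OF w] by (simp add: X_def)
  qed
  have wX: "X w \<in> words n" "w \<in> words n" "length w = n" "length (X w) = n" if "w \<in> typecls S" for w
    using X(1)[OF that] typecls_words[OF T] typecls_words[OF S] that typecls_length[OF T] typecls_length[OF S] by auto
  define e where "e w = map (\<lambda>i. if X w ! i \<noteq> w ! i then X w ! i else z ! i) [0..<n]" for w
  have e_nth: "e w ! i = (if X w ! i \<noteq> w ! i then X w ! i else z ! i)" if "i < n" for w i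
    using that by (simp add: e_def)
  have e_words: "e w \<in> words n" if w: "w \<in> typecls S" for w
  proof -
    have "e w ! i \<in> alphabet" if "i < n" for i
      using words_nth[OF wX(1)[OF w] that] words_nth[OF z(1) that] e_nth[OF that] by simp
    moreover have "length (e w) = n" by (simp add: e_def)
    ultimately show ?thesis unfolding words_def by (metis (mono_tags, lifting) in_set_conv_nth mem_Collect_eq subsetI)
  qed
  have e_close: "close (X w) (e w)" if w: "w \<in> ?B" for w
  proof -
    have wS: "w \<in> typecls S" "close w z" using w by auto
    have "(\<Sum>i<n. \<rho> (X w ! i) (e w ! i)) \<le> (\<Sum>i<n. \<rho> (w ! i) (z ! i))"
    proof (rule sum_mono)
      fix i assume "i \<in> {..<n}"
      then have i: "i < n" by simp
      show "\<rho> (X w ! i) (e w ! i) \<le> \<rho> (w ! i) (z ! i)"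
      proof (cases "X w ! i = w ! i")
        case True then show ?thesis using e_nth[OF i] by simp
      next
        case False
        then have "\<rho> (X w ! i) (e w ! i) = 0"
          using e_nth[OF i] rho_refl words_nth[OF wX(1)[OF wS(1)] i] by simp
        then show ?thesis using rho_nonneg words_nth[OF wX(2)[OF wS(1)] i] words_nth[OF z(1) i] by simp
      qed
    qed
    then show ?thesis using wS(2) by (simp add: close_iff)
  qed
  have hbz: "finite (hamming_ball n z (set_mset T) ?h)" "card (hamming_ball n z (set_mset T) ?h) \<le> (n\<^sup>2 + 1) ^ ?h"
    using card_hamming_ball[OF lz _ card_set_word_type[OF T]] by auto
  have "e ` ?B \<subseteq> hamming_ball n z (set_mset T) ?h"
  proof (rule image_subsetI)
    fix w assume "w \<in> ?B"
    then have w: "w \<in> typecls S" by simp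
    have "{i. i < n \<and> e w ! i \<noteq> z ! i} \<subseteq> {i. i < n \<and> X w ! i \<noteq> w ! i}"
      using e_nth by auto
    then have "hamming n (e w) z \<le> hamming n (X w) w" unfolding hamming_def by (rule card_mono[rotated]) simp
    then have 1: "hamming n (e w) z \<le> ?h" using X(2)[OF w] by simp
    have 2: "e w ! i \<in> set_mset T" if "i < n" "e w ! i \<noteq> z ! i" for i
    proof -
      have "e w ! i = X w ! i" using e_nth[OF that(1), of w] that(2) by (simp split: if_splits)
      moreover have "X w ! i \<in> set (X w)" using wX(4)[OF w] that(1) by (intro nth_mem) simp
      ultimately show ?thesis using X(1)[OF w] by (simp add: typecls_def) (metis set_mset_mset)
    qed
    show "e w \<in> hamming_ball n z (set_mset T) ?h"
      unfolding hamming_ball_def using 1 2 by (simp add: e_def)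
  qed
  from pigeonhole_fibre[OF finB neB this hbz] obtain z' where
    z': "z' \<in> e ` ?B" "card ?B \<le> (n\<^sup>2 + 1) ^ ?h * card {w \<in> ?B. e w = z'}" by blast
  let ?F = "{w \<in> ?B. e w = z'}"
  have "card {w \<in> ?F. X w = x} \<le> (n\<^sup>2 + 1) ^ ?h" if "x \<in> X ` ?F" for x
  proof -
    have lx: "length x = n" using that wX(4) by auto
    have hbx: "finite (hamming_ball n x (set_mset S) ?h)" "card (hamming_ball n x (set_mset S) ?h) \<le> (n\<^sup>2 + 1) ^ ?h"
      using card_hamming_ball[OF lx _ card_set_word_type[OF S]] by auto
    have "{w \<in> ?F. X w = x} \<subseteq> hamming_ball n x (set_mset S) ?h"
    proof
      fix w assume "w \<in> {w \<in> ?F. X w = x}"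
      then have w: "w \<in> typecls S" "X w = x" by auto
      have "hamming n w (X w) = hamming n (X w) w" unfolding hamming_def by metis
      then have "hamming n w x = ?h" using X(2)[OF w(1)] w(2) by metis
      moreover have "w ! i \<in># S" if "i < n" for i
        using w(1) nth_mem[of i w] wX(3)[OF w(1)] that by (auto simp: typecls_def)
      ultimately show "w \<in> hamming_ball n x (set_mset S) ?h"
        using wX(3)[OF w(1)] by (simp add: hamming_ball_def)
    qed
    then show ?thesis using card_mono[OF hbx(1)] hbx(2) order_trans by blast
  qed
  then have "card ?F \<le> (n\<^sup>2 + 1) ^ ?h * card (X ` ?F)" by (intro card_le_fibres) simp_all
  also have "card (X ` ?F) \<le> max_ball T"
  proof -
    obtain w' where w': "w' \<in> typecls S" "z' = e w'" using z'(1) by blast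
    have "X ` ?F \<subseteq> {x \<in> typecls T. close x z'}" using X(1) e_close by auto
    then have "card (X ` ?F) \<le> card {x \<in> typecls T. close x z'}" by (rule card_mono[rotated]) simp
    also have "\<dots> \<le> max_ball T" using e_words[OF w'(1)] w'(2) by (intro card_ball_le_max_ball) simp
    finally show ?thesis .
  qed
  finally have "card ?F \<le> (n\<^sup>2 + 1) ^ ?h * max_ball T" by simp
  then have "card ?B \<le> (n\<^sup>2 + 1) ^ ?h * ((n\<^sup>2 + 1) ^ ?h * max_ball T)"
    using z'(2) mult_le_mono2 order_trans by blast
  then show ?thesis unfolding z(2) by (simp add: mult_2 power_add mult.assoc)
qed

text \<open>For a pair of mismatched places, exchange one with the first and the other with the
  second exact occurrence of its letter. The word x is constant on each exchanged pair and does not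
  change, while y becomes exact at precisely this pair among the old mismatches. The pair can
  therefore be read off from the new centre, which gives h choose 2 centres. Two exact occurrences
  are needed because both mismatches may carry the same letter.\<close>

lemma card_rel_lower:
  assumes T: "T \<in> word_types n" and S: "S \<in> word_types n"
    and x: "x \<in> typecls T" and y: "y \<in> typecls S" and r: "rel h x y"
  shows "(h + 1)\<^sup>2 \<le> 9 * card {y' \<in> typecls S. rel h x y'}"
proof -
  have l: "length x = n" "length y = n" using typecls_length[OF T x] typecls_length[OF S y] by auto
  let ?D = "{i. i < n \<and> x ! i \<noteq> y ! i}" and ?R = "{y' \<in> typecls S. rel h x y'}"
  have D: "finite ?D" "card ?D = h" using r by (auto simp: rel_def hamming_def)
  have "\<forall>a\<in>(!) x ` ?D. \<exists>jk. fst jk < n \<and> snd jk < n \<and> fst jk \<noteq> snd jk \<and> x ! fst jk = a \<and> y ! fst jk = a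
      \<and> x ! snd jk = a \<and> y ! snd jk = a"
    using r unfolding rel_def by fastforce
  from bchoice[OF this] obtain ee where ee: "\<And>a. a \<in> (!) x ` ?D \<Longrightarrow> fst (ee a) < n \<and> snd (ee a) < n \<and>
      fst (ee a) \<noteq> snd (ee a) \<and> x ! fst (ee a) = a \<and> y ! fst (ee a) = a \<and> x ! snd (ee a) = a \<and> y ! snd (ee a) = a"
    by blast
  define e1 where "e1 i = fst (ee (x ! i))" for i
  define e2 where "e2 i = snd (ee (x ! i))" for i
  have e1: "e1 i < n" "x ! e1 i = x ! i" "y ! e1 i = x ! i"
   and e2: "e2 i < n" "x ! e2 i = x ! i" "y ! e2 i = x ! i" if "i \<in> ?D" for i
    using ee[OF imageI[OF that]] by (auto simp: e1_def e2_def)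
  \<comment> \<open>Partners belonging to one letter are distinct by choice, those belonging to
    different letters because x differs there. The two transpositions therefore do not
    interfere.\<close>
  have e12: "e1 i \<noteq> e2 k" if "i \<in> ?D" "k \<in> ?D" for i k
  proof (cases "x ! i = x ! k")
    case True
    then show ?thesis using ee[OF imageI[OF that(1)]] by (simp add: e1_def e2_def)
  next
    case False
    then show ?thesis using e1(2)[OF that(1)] e2(2)[OF that(2)] by metis
  qed
  have notD: "e1 i \<notin> ?D" "e2 i \<notin> ?D" if "i \<in> ?D" for i using e1[OF that] e2[OF that] by auto
  define q where "q j k = Transposition.transpose j (e1 j) \<circ> Transposition.transpose k (e2 k)" for j k
  define g where "g B = permute_list (q (Min B) (Max B)) y" for B
  let ?P = "{B. B \<subseteq> ?D \<and> card B = 2}"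
  have B: "Min B \<in> B" "Max B \<in> B" "Min B \<noteq> Max B" "B = {Min B, Max B}" "Min B \<in> ?D" "Max B \<in> ?D" if "B \<in> ?P" for B
  proof -
    have sub: "B \<subseteq> ?D" and c: "card B = 2" using that by auto
    obtain a b where ab: "B = {a, b}" "a \<noteq> b" using c by (meson card_2_iff)
    have "Min B = min a b" "Max B = max a b" using ab by auto
    then show "Min B \<in> B" "Max B \<in> B" "Min B \<noteq> Max B" "B = {Min B, Max B}"
      using ab by (auto simp: min_def max_def)
    then show "Min B \<in> ?D" "Max B \<in> ?D" using sub by blast+
  qed
  have perm: "q j k permutes {..<n}" if "j \<in> ?D" "k \<in> ?D" for j k
    unfolding q_def using that e1(1) e2(1)
    by (intro permutes_compose permutes_swap_id) auto
  have inv: "permute_list (q j k) x = x" if jk: "j \<in> ?D" "k \<in> ?D" for j k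
  proof (rule nth_equalityI)
    fix i assume i: "i < length (permute_list (q j k) x)"
    have "x ! Transposition.transpose j (e1 j) i = x ! i" for i
      using e1(2)[OF jk(1)] by (simp add: Transposition.transpose_def)
    moreover have "x ! Transposition.transpose k (e2 k) i = x ! i" for i
      using e2(2)[OF jk(2)] by (simp add: Transposition.transpose_def)
    ultimately have "x ! q j k i = x ! i" by (simp add: q_def)
    then show "permute_list (q j k) x ! i = x ! i"
      using i perm[OF jk] l by (simp add: permute_list_nth)
  qed simp
  have gR: "g ` ?P \<subseteq> ?R"
  proof (rule image_subsetI)
    fix B assume "B \<in> ?P"
    note b = B(5,6)[OF this]
    have "rel h x (g B)" using rel_permute[OF perm[OF b] l r] inv[OF b] by (simp add: g_def)
    moreover have "g B \<in> typecls S" using y perm[OF b] l by (simp add: g_def typecls_def mset_permute_list)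
    ultimately show "g B \<in> ?R" by blast
  qed
  \<comment> \<open>Decoding of the pair, from which injectivity follows: among the mismatches of y,
    the new centre agrees with x exactly on B.\<close>
  have rec: "B = {i \<in> ?D. g B ! i = x ! i}" if BP: "B \<in> ?P" for B
  proof -
    let ?j = "Min B" and ?k = "Max B"
    note b = B(5,6)[OF BP]
    have gn: "g B ! i = y ! q ?j ?k i" if "i < n" for i
      using that l perm[OF b] by (simp add: g_def permute_list_nth)
    have neq: "u \<noteq> v" if "u \<in> A" "v \<notin> A" for u v :: nat and A using that by blast
    have jn1: "?j \<noteq> e2 ?k" by (rule neq[OF b(1) notD(2)[OF b(2)]])
    have jn2: "?k \<noteq> e2 ?k" by (rule neq[OF b(2) notD(2)[OF b(2)]])
    have jn3: "?k \<noteq> e1 ?j" by (rule neq[OF b(2) notD(1)[OF b(1)]])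
    have jn4: "?j \<noteq> e1 ?j" by (rule neq[OF b(1) notD(1)[OF b(1)]])
    have jn5: "e2 ?k \<noteq> e1 ?j" using e12[OF b] by (rule not_sym)
    note jn = jn1 jn2 jn3 jn4 jn5 B(3)[OF BP]
    have qj: "q ?j ?k ?j = e1 ?j" and qk: "q ?j ?k ?k = e2 ?k"
      using jn by (simp_all add: q_def Transposition.transpose_def)
    have qi: "q ?j ?k i = i" if "i \<in> ?D" "i \<noteq> ?j" "i \<noteq> ?k" for i
    proof -
      have "i \<noteq> e1 ?j" "i \<noteq> e2 ?k"
        by (rule neq[OF that(1) notD(1)[OF b(1)]], rule neq[OF that(1) notD(2)[OF b(2)]])
      then show ?thesis using that by (simp add: q_def Transposition.transpose_def)
    qed
    have jlt: "?j < n" "?k < n" using b by simp_all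
    have gj: "g B ! ?j = x ! ?j" unfolding gn[OF jlt(1)] qj by (rule e1(3)[OF b(1)])
    have gk: "g B ! ?k = x ! ?k" unfolding gn[OF jlt(2)] qk by (rule e2(3)[OF b(2)])
    have gi: "g B ! i \<noteq> x ! i" if i: "i \<in> ?D" "i \<noteq> ?j" "i \<noteq> ?k" for i
    proof -
      have "i < n" "x ! i \<noteq> y ! i" using i(1) by simp_all
      then show ?thesis using gn[of i] qi[OF i] by metis
    qed
    have "i \<in> {i \<in> ?D. g B ! i = x ! i} \<longleftrightarrow> i \<in> {?j, ?k}" for i
    proof
      assume "i \<in> {i \<in> ?D. g B ! i = x ! i}"
      then have "i \<in> ?D" "g B ! i = x ! i" by simp_all
      then show "i \<in> {?j, ?k}" using gi by blast
    next
      assume "i \<in> {?j, ?k}"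
      then consider "i = ?j" | "i = ?k" by blast
      then show "i \<in> {i \<in> ?D. g B ! i = x ! i}"
        by cases (simp_all only: mem_Collect_eq gj gk b[unfolded mem_Collect_eq] simp_thms)
    qed
    then have "{i \<in> ?D. g B ! i = x ! i} = {?j, ?k}" by (rule set_eqI)
    then show ?thesis using B(4)[OF BP] by (simp only:)
  qed
  have "inj_on g ?P"
  proof (rule inj_onI)
    fix B B' assume BB: "B \<in> ?P" "B' \<in> ?P" and e: "g B = g B'"
    show "B = B'" using rec[OF BB(1)] unfolding e rec[OF BB(2), symmetric] .
  qed
  then have "card ?P \<le> card ?R" using gR by (rule card_inj_on_le) simp
  then have m2: "h choose 2 \<le> card ?R" using n_subsets[OF D(1), of 2] D(2) by simp
  have "y \<in> ?R" using y r by simp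
  then have m1: "1 \<le> card ?R" using card_gt_0_iff[of ?R] by fastforce
  \<comment> \<open>The constant 9 comes from h = 2, where a single centre must account for (h +
    1)^2 = 9. From h = 3 on the number of pairs is large enough.\<close>
  show ?thesis
  proof (cases "h \<le> 2")
    case True
    then have "(h + 1)\<^sup>2 \<le> 3\<^sup>2" by (intro power_mono) auto
    then show ?thesis using m1 by simp
  next
    case False
    then obtain k where k: "h = k + 3" by (metis add.commute le_Suc_ex not_less_eq_eq numeral_3_eq_3 numeral_2_eq_2)
    have "even (h * (h - 1))" by (cases "even h") auto
    then have "2 * (h choose 2) = h * (h - 1)" unfolding choose_two by (rule dvd_mult_div_cancel)
    then have "2 * (h choose 2) = (k + 3) * (k + 2)" using k by simp
    moreover have "2 * (h + 1)\<^sup>2 \<le> 9 * ((k + 3) * (k + 2))" using k by (simp add: power2_eq_square algebra_simps)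
    ultimately show ?thesis using m2 by linarith
  qed
qed

text \<open>Since letters above U are never mismatched, T has no such letter besides those of S. So
  T is determined by its counts on at most U + \<open>big S\<close> letters, and h mismatches move
  each count by at most h.\<close>

lemma card_types_related:
  fixes h :: nat
  assumes S: "S \<in> word_types n"
  defines "R \<equiv> {T \<in> word_types n. \<exists>x\<in>typecls T. \<exists>y\<in>typecls S. rel h x y}"
  shows "finite R" "card R \<le> (2 * h + 1) ^ (U + big S)"
proof -
  define A where "A = {1..U} \<union> set_mset {#a \<in># S. a > U#}"
  have finA: "finite A" by (simp add: A_def)
  have "card (set_mset {#a \<in># S. a > U#}) \<le> big S" unfolding big_def by (rule card_set_mset_le_size)
  moreover have "card A \<le> card {1..U} + card (set_mset {#a \<in># S. a > U#})" unfolding A_def by (rule card_Un_le)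
  moreover have "card {1..U} = U" by (rule card_atLeastAtMost[THEN trans]) simp
  ultimately have cA: "card A \<le> U + big S" by linarith
  let ?F = "\<lambda>T. restrict (count T) A"
  let ?Pi = "PiE A (\<lambda>a. {count S a - h..count S a + h})"
  have img: "?F ` R \<subseteq> ?Pi"
  proof (rule image_subsetI, rule restrict_PiE_iff[THEN iffD2], rule ballI)
    fix T a assume "T \<in> R"
    then obtain x y where T: "T \<in> word_types n" and xy: "x \<in> typecls T" "y \<in> typecls S" "rel h x y"
      by (auto simp: R_def)
    have l: "length x = n" "length y = n" using typecls_length[OF T xy(1)] typecls_length[OF S xy(2)] by auto
    let ?D = "{i. i < n \<and> x ! i \<noteq> y ! i}"
    have D: "card ?D = h" using xy(3) by (simp add: rel_def hamming_def)
    have cT: "count T a = card {i. i < n \<and> x ! i = a}" and cS: "count S a = card {i. i < n \<and> y ! i = a}"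
      using xy(1,2) l count_mset_conv_card[of x a] count_mset_conv_card[of y a] by (auto simp: typecls_def)
    have "card {i. i < n \<and> x ! i = a} \<le> card ({i. i < n \<and> y ! i = a} \<union> ?D)" by (intro card_mono) auto
    also have "\<dots> \<le> card {i. i < n \<and> y ! i = a} + card ?D" by (rule card_Un_le)
    finally have 1: "count T a \<le> count S a + h" using cT cS D by simp
    have "card {i. i < n \<and> y ! i = a} \<le> card ({i. i < n \<and> x ! i = a} \<union> ?D)" by (intro card_mono) auto
    also have "\<dots> \<le> card {i. i < n \<and> x ! i = a} + card ?D" by (rule card_Un_le)
    finally have 2: "count S a \<le> count T a + h" using cT cS D by simp
    show "count T a \<in> {count S a - h..count S a + h}" using 1 2 by simp
  qed
  have supp: "a \<in> A" if T: "T \<in> R" and a: "a \<in># T" for T a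
  proof -
    obtain x y where T': "T \<in> word_types n" and xy: "x \<in> typecls T" "y \<in> typecls S" "rel h x y"
      using T by (auto simp: R_def)
    have l: "length x = n" "length y = n" using typecls_length[OF T' xy(1)] typecls_length[OF S xy(2)] by auto
    have "a \<in> set x" using a xy(1) by (auto simp: typecls_def)
    then obtain i where i: "i < n" "x ! i = a" using l by (metis in_set_conv_nth)
    have a1: "a \<ge> 1" using a T' by (auto simp: word_types_def alphabet_def)
    show ?thesis
    proof (cases "a \<le> U")
      case True then show ?thesis using a1 by (simp add: A_def)
    next
      case False
      then have "y ! i = a" using xy(3) i unfolding rel_def by metis
      then have "a \<in># S" using xy(2) i l nth_mem[of i y] by (auto simp: typecls_def)
      then show ?thesis using False by (simp add: A_def)
    qed
  qed
  have inj: "inj_on ?F R"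
  proof (rule inj_onI, rule multiset_eqI)
    fix T T' a assume T: "T \<in> R" "T' \<in> R" and e: "?F T = ?F T'"
    show "count T a = count T' a"
    proof (cases "a \<in> A")
      case True then show ?thesis using fun_cong[OF e, of a] by simp
    next
      case False
      then have "a \<notin># T" "a \<notin># T'" using supp[OF T(1)] supp[OF T(2)] by blast+
      then show ?thesis by (simp only: not_in_iff)
    qed
  qed
  have finPi: "finite ?Pi" using finA by (intro finite_PiE) auto
  show "finite R" using inj_on_finite[OF inj img finPi] .
  have "card R \<le> card ?Pi" by (rule card_inj_on_le[OF inj img finPi])
  also have "\<dots> = (\<Prod>a\<in>A. card {count S a - h..count S a + h})" by (rule card_PiE[OF finA])
  also have "\<dots> \<le> (\<Prod>a\<in>A. 2 * h + 1)" by (rule prod_mono) auto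
  also have "\<dots> = (2 * h + 1) ^ card A" by simp
  also have "\<dots> \<le> (2 * h + 1) ^ (U + big S)" using cA by (intro power_increasing) auto
  finally show "card R \<le> (2 * h + 1) ^ (U + big S)" .
qed

end

section \<open>Simultaneous coverings of type classes\<close>

lemma card_typecls_le:
  assumes "T \<in> word_types n"
  shows "card (typecls T) \<le> n ^ n"
proof -
  have sub: "typecls T \<subseteq> {xs. set xs \<subseteq> set_mset T \<and> length xs = n}"
    using typecls_length[OF assms] by (auto simp: typecls_def)
  have "card (typecls T) \<le> card {xs. set xs \<subseteq> set_mset T \<and> length xs = n}"
    by (rule card_mono[OF finite_lists_length_eq sub]) simp
  also have "\<dots> = card (set_mset T) ^ n" by (rule card_lists_length_eq) simp
  also have "\<dots> \<le> n ^ n" by (rule power_mono[OF card_set_word_type[OF assms]]) simp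
  finally show ?thesis .
qed

lemma sum_inverse_powers_two_le: "(\<Sum>h\<le>n. (1/2) ^ Suc h) \<le> (1::real)"
proof -
  have "(\<Sum>h\<le>n. (1/2) ^ Suc h) = (1::real) - (1/2) ^ Suc n" for n :: nat
    by (induction n) (simp_all add: field_simps)
  then show ?thesis by simp
qed

context distortion_block
begin

text \<open>With n + 1 in place of n the unit of length is at least 1 even for n = 1, so constants
  can be absorbed into it.\<close>

definition lg :: real where "lg = log 2 (real n + 1)"

text \<open>All losses for the type T are measured in units of \<open>kap T * lg\<close>; the
  summand 1 keeps the unit above every constant when U and \<open>big T\<close> vanish.\<close>

definition kap :: "nat multiset \<Rightarrow> real" where "kap T = real U + real (big T) + 1"

lemma lg_ge1: "lg \<ge> 1"
  using n1 by (simp add: lg_def le_log_iff)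

lemma kap_ge1: "kap T \<ge> 1"
  by (simp add: kap_def)

lemma log_V_le: "log 2 (real (n\<^sup>2 + 1)) \<le> 2 * lg"
proof -
  have "real (n\<^sup>2 + 1) \<le> (real n + 1) ^ 2" by (simp add: power2_eq_square algebra_simps)
  then have "log 2 (real (n\<^sup>2 + 1)) \<le> log 2 ((real n + 1) ^ 2)"
    by (subst log_le_cancel_iff) (auto simp: add_pos_nonneg)
  also have "\<dots> = 2 * lg" using n1 by (simp add: lg_def log_nat_power)
  finally show ?thesis .
qed

lemma log_V_power_le: "log 2 (real ((n\<^sup>2 + 1) ^ k)) \<le> real k * (2 * lg)"
proof -
  have "log 2 (real ((n\<^sup>2 + 1) ^ k)) = real k * log 2 (real (n\<^sup>2 + 1))"
    unfolding of_nat_power by (rule log_nat_power) simp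
  also have "\<dots> \<le> real k * (2 * lg)" by (intro mult_left_mono log_V_le) simp
  finally show ?thesis .
qed

end

text \<open>Reproductions of type T are taken from the type class of an associated type S(T).  Every S
  carries a single sequence that serves all T with S(T) = S simultaneously, so that few words
  of S are used up as code words.\<close>

locale related_types = distortion_block +
  fixes S :: "nat multiset \<Rightarrow> nat multiset" and h :: "nat multiset \<Rightarrow> nat"
    and x0 y0 :: "nat multiset \<Rightarrow> nat list"
  assumes related: "T \<in> word_types n \<Longrightarrow> S T \<in> word_types n \<and> h T \<le> n \<and> x0 T \<in> typecls T \<and> y0 T \<in> typecls (S T) \<and>
      rel (h T) (x0 T) (y0 T) \<and>
      max_ball T \<le> (n + 1) * (n\<^sup>2 + 1) ^ (big T + 2 * U) * card {x \<in> typecls T. rel (h T) x (y0 T)}"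
begin

definition fwd_degree where "fwd_degree T = card {y \<in> typecls (S T). rel (h T) (x0 T) y}"
definition bwd_degree where "bwd_degree T = card {x \<in> typecls T. rel (h T) x (y0 T)}"
definition cover_prob where "cover_prob T = real (fwd_degree T) / real (card (typecls (S T)))"
text \<open>Covering exponent of the sequence. Three of the four units (h + 1) kap are spent on the
  union over all types that share S, see \<open>union_weight\<close>; the last one leaves at most a
  fraction 1 / (h + 1) uncovered.\<close>

definition effort where "effort T = 4 * (real (h T) + 1) * kap (S T)"
definition seq_length where "seq_length T = nat \<lceil>effort T / cover_prob T\<rceil>"
lemma card_typecls_real_pos: "real (card (typecls T)) > 0" for T using card_typecls_pos by simp
lemma fwd_degree_lower: "(real (h T) + 1)\<^sup>2 \<le> 9 * real (fwd_degree T)" if T: "T \<in> word_types n" for T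
proof -
  have "(h T + 1)\<^sup>2 \<le> 9 * fwd_degree T" unfolding fwd_degree_def using related[OF T] by (intro card_rel_lower[OF T]) auto
  then have "real ((h T + 1)\<^sup>2) \<le> real (9 * fwd_degree T)" by (simp only: of_nat_le_iff)
  then show ?thesis by (simp add: add.commute)
qed
lemma fwd_degree_pos: "fwd_degree T > 0" if T: "T \<in> word_types n" for T
proof -
  have "0 < (real (h T) + 1)\<^sup>2" by (intro zero_less_power) simp
  then show ?thesis using fwd_degree_lower[OF T] by linarith
qed
lemma cover_prob_pos: "cover_prob T > 0" if T: "T \<in> word_types n" for T using fwd_degree_pos[OF T] card_typecls_real_pos by (simp add: cover_prob_def)
lemma cover_prob_le1: "cover_prob T \<le> 1" for T
proof -
  have "fwd_degree T \<le> card (typecls (S T))" unfolding fwd_degree_def by (rule card_mono) auto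
  then show ?thesis using card_typecls_real_pos[of "S T"] by (simp add: cover_prob_def)
qed
lemma effort_ge4: "effort T \<ge> 4" for T
  using mult_mono[of 1 "real (h T) + 1" 1 "kap (S T)"] kap_ge1[of "S T"] unfolding effort_def by linarith
lemma cover_prob_eq: "cover_prob T = real (bwd_degree T) / real (card (typecls T))" if T: "T \<in> word_types n" for T
proof -
  have "card (typecls T) * fwd_degree T = card (typecls (S T)) * bwd_degree T"
    unfolding fwd_degree_def bwd_degree_def using related[OF T] by (intro rel_double_counting[OF T]) auto
  then have "real (card (typecls T)) * real (fwd_degree T) = real (card (typecls (S T))) * real (bwd_degree T)"
    unfolding of_nat_mult[symmetric] by (simp only:)
  then show ?thesis unfolding cover_prob_def
    using frac_eq_eq[OF less_imp_neq[OF card_typecls_real_pos, symmetric] less_imp_neq[OF card_typecls_real_pos, symmetric]] by (metis mult.commute)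
qed
lemma bwd_degree_pos: "real (bwd_degree T) > 0" if T: "T \<in> word_types n" for T
  using cover_prob_pos[OF T] cover_prob_eq[OF T] card_typecls_real_pos[of T] by (simp add: zero_less_divide_iff)
lemma max_ball_real_pos: "real (max_ball T) > 0" if T: "T \<in> word_types n" for T using max_ball_pos[OF T] by simp
lemma seq_length_ge1: "seq_length T \<ge> 1" and seq_length_ge: "real (seq_length T) \<ge> effort T / cover_prob T" and seq_length_le: "real (seq_length T) \<le> effort T / cover_prob T + 1"
  if T: "T \<in> word_types n" for T
proof -
  have pos: "effort T / cover_prob T > 0" using effort_ge4[of T] cover_prob_pos[OF T] by simp
  then show "seq_length T \<ge> 1" unfolding seq_length_def by linarith
  show "real (seq_length T) \<ge> effort T / cover_prob T" unfolding seq_length_def by (rule real_nat_ceiling_ge)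
  show "real (seq_length T) \<le> effort T / cover_prob T + 1" unfolding seq_length_def using pos by linarith
qed
lemma log_max_ball_le: "log 2 (real (max_ball T)) \<le> lg + (real (big T) + 2 * real U) * (2 * lg) + log 2 (real (bwd_degree T))"
  if T: "T \<in> word_types n" for T
proof -
  have "max_ball T \<le> (n + 1) * (n\<^sup>2 + 1) ^ (big T + 2 * U) * bwd_degree T" using related[OF T] by (simp add: bwd_degree_def)
  then have "real (max_ball T) \<le> real ((n + 1) * (n\<^sup>2 + 1) ^ (big T + 2 * U) * bwd_degree T)" by (simp only: of_nat_le_iff)
  also have "\<dots> = (real n + 1) * real ((n\<^sup>2 + 1) ^ (big T + 2 * U)) * real (bwd_degree T)" by (simp only: of_nat_mult of_nat_add of_nat_1)
  finally have "log 2 (real (max_ball T)) \<le> log 2 ((real n + 1) * real ((n\<^sup>2 + 1) ^ (big T + 2 * U)) * real (bwd_degree T))"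
    using max_ball_real_pos[OF T] bwd_degree_pos[OF T] by (subst log_le_cancel_iff) (auto intro!: mult_pos_pos)
  also have "\<dots> = lg + log 2 (real ((n\<^sup>2 + 1) ^ (big T + 2 * U))) + log 2 (real (bwd_degree T))"
    using bwd_degree_pos[OF T] by (simp add: log_mult lg_def del: of_nat_power)
  finally show ?thesis using log_V_power_le[of "big T + 2 * U"] by simp
qed
lemma log_bwd_degree_le: "log 2 (real (bwd_degree T)) \<le> real (h T) * (2 * lg)" if T: "T \<in> word_types n" for T
proof -
  have "length (y0 T) = n" using related[OF T] typecls_length by blast
  then have "bwd_degree T \<le> (n\<^sup>2 + 1) ^ h T" unfolding bwd_degree_def by (rule card_rel_le[OF T])
  then have "real (bwd_degree T) \<le> real ((n\<^sup>2 + 1) ^ h T)" by (simp only: of_nat_le_iff)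
  then have "log 2 (real (bwd_degree T)) \<le> log 2 (real ((n\<^sup>2 + 1) ^ h T))" using bwd_degree_pos[OF T] by (subst log_le_cancel_iff) auto
  then show ?thesis using log_V_power_le[of "h T"] by linarith
qed
text \<open>The sequence has about \<open>effort T\<close> |T| / \<open>bwd_degree T\<close> terms.
  The degree falls short of M(T) only by the pigeonhole factor of
  \<open>exists_related_type\<close>, and the logarithm of the effort is small because the effort is
  polynomial in n and U.\<close>

lemma log_seq_length_le: "log 2 (real (seq_length T)) \<le> log 2 (real (card (typecls T)) / real (max_ball T)) + 8 * kap T * lg"
  if T: "T \<in> word_types n" for T
proof -
  have tp: "effort T / cover_prob T \<ge> 1" using effort_ge4[of T] cover_prob_pos[OF T] cover_prob_le1[of T] by (simp add: divide_simps)
  have tpos: "effort T > 0" using effort_ge4[of T] by linarith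
  have "log 2 (real (seq_length T)) \<le> log 2 (2 * (effort T / cover_prob T))"
    using seq_length_le[OF T] seq_length_ge1[OF T] tp by (subst log_le_cancel_iff) auto
  also have "\<dots> = 1 + log 2 (effort T) + log 2 (real (card (typecls T))) - log 2 (real (bwd_degree T))"
    using tpos bwd_degree_pos[OF T] card_typecls_real_pos[of T] unfolding cover_prob_eq[OF T] by (simp add: log_mult log_divide typecls_nonempty)
  also have "\<dots> \<le> 1 + log 2 (effort T) + log 2 (real (card (typecls T))) - log 2 (real (max_ball T))
      + lg + (real (big T) + 2 * real U) * (2 * lg)" using log_max_ball_le[OF T] by linarith
  \<comment> \<open>Here \<open>kap (S T)\<close> is at most (n + 1) (U + 1), since S T has at most
    n large letters. Replacing log (U + 1) by U + 1 is crude but fits the budget, which contains U *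
    lg.\<close>
  also have "log 2 (effort T) \<le> 3 + 2 * lg + real U"
  proof -
    have "big (S T) \<le> n" using related[OF T] size_filter_mset_lesseq[of _ "S T"] by (auto simp: big_def word_types_def)
    moreover have "(real n + 1) * (real U + 1) = real U + real n + 1 + real U * real n" by (simp add: algebra_simps)
    moreover have "0 \<le> real U * real n" by simp
    ultimately have "kap (S T) \<le> (real n + 1) * (real U + 1)" unfolding kap_def by linarith
    moreover have "real (h T) + 1 \<le> real n + 1" using related[OF T] by simp
    ultimately have "(real (h T) + 1) * kap (S T) \<le> (real n + 1) * ((real n + 1) * (real U + 1))"
      using kap_ge1[of "S T"] by (intro mult_mono) auto
    then have "effort T \<le> 2 ^ 2 * ((real n + 1) ^ 2 * (real U + 1))" unfolding effort_def by (simp only: power2_eq_square mult.assoc)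
    then have "log 2 (effort T) \<le> log 2 (2 ^ 2 * ((real n + 1) ^ 2 * (real U + 1)))"
      using tpos by (subst log_le_cancel_iff) (auto intro!: mult_pos_pos add_pos_pos)
    also have "\<dots> = log 2 (2 ^ 2) + (log 2 ((real n + 1) ^ 2) + log 2 (real U + 1))"
      by (simp add: log_mult)
    also have "\<dots> = 2 + (2 * lg + log 2 (real U + 1))"
    proof -
      have "log 2 ((2::real) ^ 2) = 2" by (subst log_nat_power) simp_all
      moreover have "log 2 ((real n + 1) ^ 2) = 2 * lg" by (subst log_nat_power) (simp_all add: lg_def)
      ultimately show ?thesis by (simp only:)
    qed
    finally show ?thesis using log2_le_self[of "real U + 1"] by simp
  qed
  finally have "log 2 (real (seq_length T)) \<le> log 2 (real (card (typecls T)) / real (max_ball T)) +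
      (4 + 3 * lg + real U + (real (big T) + 2 * real U) * (2 * lg))"
    using max_ball_real_pos[OF T] card_typecls_real_pos[of T] by (simp add: log_divide typecls_nonempty)
  moreover have "4 + 3 * lg + real U + (real (big T) + 2 * real U) * (2 * lg) \<le> 8 * kap T * lg"
  proof -
    have "real U * 1 \<le> real U * lg" using lg_ge1 by (intro mult_left_mono) auto
    moreover have "0 \<le> real U * lg" "0 \<le> real (big T) * lg" using lg_ge1 by auto
    moreover have "8 * kap T * lg - (3 * lg + (real (big T) + 2 * real U) * (2 * lg)) =
        4 * (real U * lg) + 6 * (real (big T) * lg) + 5 * lg" unfolding kap_def by (simp add: algebra_simps)
      ultimately show ?thesis using lg_ge1 by linarith
  qed
  ultimately show ?thesis by linarith
qed

section \<open>One sequence for all types with the same S\<close>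

definition sources where "sources S' = {T \<in> word_types n. S T = S'}"
text \<open>Two of the three units absorb the number of types at distance h, and the third leaves
  exp (- (h + 1)), whose sum over h is at most 1.\<close>

definition union_weight where "union_weight T = exp (- 3 * (real (h T) + 1) * kap (S T))"
lemma sources_subset: "{T \<in> sources S'. h T = k} \<subseteq> {T \<in> word_types n. \<exists>x\<in>typecls T. \<exists>y\<in>typecls S'. rel k x y}" for S' k
  using related by (fastforce simp: sources_def)
lemma finite_sources: "finite (sources S')" if S': "S' \<in> word_types n" for S'
proof -
  have "sources S' \<subseteq> (\<Union>k\<le>n. {T \<in> sources S'. h T = k})" using related by (auto simp: sources_def)
  moreover have "finite (\<Union>k\<le>n. {T \<in> sources S'. h T = k})"
    by (intro finite_UN_I finite_atMost finite_subset[OF sources_subset card_types_related(1)[OF S']])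
  ultimately show ?thesis by (rule finite_subset)
qed
lemma union_weight_sum: "sum union_weight (sources S') \<le> 1" if S': "S' \<in> word_types n" for S'
proof -
  have per: "(\<Sum>T\<in>{T \<in> sources S'. h T = k}. union_weight T) \<le> (1/2) ^ Suc k" for k
  proof -
    let ?J = "{T \<in> sources S'. h T = k}"
    let ?e = "exp (- 3 * (real k + 1) * kap S')"
    have "card ?J \<le> (2 * k + 1) ^ (U + big S')"
      using card_mono[OF card_types_related(1)[OF S'] sources_subset] card_types_related(2)[OF S'] order_trans by blast
    then have "real (card ?J) \<le> real ((2 * k + 1) ^ (U + big S'))" by (simp only: of_nat_le_iff)
    also have "\<dots> = (2 * real k + 1) ^ (U + big S')" by (simp add: add.commute)
    \<comment> \<open>From 1 + 2k \<le> exp (2k): the logarithm of the number of types is bounded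
      linearly in k, matching the form of the weights.\<close>
    also have "\<dots> \<le> exp (2 * real k) ^ (U + big S')"
      using exp_ge_add_one_self[of "2 * real k"] by (intro power_mono) linarith+
    also have "\<dots> = exp (real (U + big S') * (2 * real k))" by (rule exp_of_nat_mult[symmetric])
    also have "\<dots> \<le> exp (2 * (real k + 1) * kap S')"
      unfolding exp_le_cancel_iff kap_def by (simp add: algebra_simps)
    finally have c: "real (card ?J) \<le> exp (2 * (real k + 1) * kap S')" .
    have "(\<Sum>T\<in>?J. union_weight T) = (\<Sum>T\<in>?J. ?e)" by (intro sum.cong) (auto simp: union_weight_def sources_def)
    also have "\<dots> = real (card ?J) * ?e" by simp
    also have "\<dots> \<le> exp (2 * (real k + 1) * kap S') * ?e" using c by (intro mult_right_mono) auto
    also have "\<dots> = exp (- ((real k + 1) * kap S'))" by (simp add: exp_add[symmetric] algebra_simps)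
    also have "\<dots> \<le> exp (- (real k + 1))"
      using mult_left_mono[OF kap_ge1[of S'], of "real k + 1", OF add_nonneg_nonneg[OF of_nat_0_le_iff zero_le_one]]
        by (simp only: exp_le_cancel_iff mult_1_right neg_le_iff_le)
    also have "\<dots> = exp (- 1) ^ Suc k" by (subst exp_of_nat_mult[symmetric]) simp
    also have "\<dots> \<le> (1/2) ^ Suc k"
    proof (rule power_mono)
      have "(2::real) \<le> exp 1" using exp_ge_add_one_self[of "1::real"] by simp
      then show "exp (- 1 :: real) \<le> 1/2" by (simp add: exp_minus divide_simps)
    qed simp
    finally show ?thesis .
  qed
  have "sum union_weight (sources S') = (\<Sum>k\<in>{..n}. \<Sum>T\<in>{T \<in> sources S'. h T = k}. union_weight T)"
    using related by (intro sum.group[symmetric] finite_sources[OF S']) (auto simp: sources_def)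
  also have "\<dots> \<le> (\<Sum>k\<in>{..n}. (1/2) ^ Suc k)" by (intro sum_mono per)
  also have "\<dots> \<le> 1" by (rule sum_inverse_powers_two_le)
  finally show ?thesis .
qed
definition covering_seq :: "nat multiset \<Rightarrow> (nat \<Rightarrow> nat list) \<Rightarrow> bool" where
  "covering_seq S' s \<longleftrightarrow> (\<forall>i. s i \<in> typecls S') \<and>
     (\<forall>N' T. T \<in> sources S' \<longrightarrow> real (card {x \<in> typecls T. \<forall>i<N'. \<not> rel (h T) x (s i)})
       \<le> exp (- cover_prob T * real N') / union_weight T * real (card (typecls T)))"

lemma covering_seq_exists: "\<exists>s. covering_seq S' s" if S': "S' \<in> word_types n" for S'
proof -
  have reg: "cover_prob T * real (card (typecls S')) \<le> real (card {y \<in> typecls S'. rel (h T) x y})"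
    if T: "T \<in> sources S'" and x: "x \<in> typecls T" for T x
  proof -
    have T': "T \<in> word_types n" "S T = S'" using T by (auto simp: sources_def)
    have "fwd_degree T = card {y \<in> typecls (S T). rel (h T) x y}"
      unfolding fwd_degree_def using related[OF T'(1)] x by (intro card_rel_right[OF T'(1)]) auto
    then show ?thesis using T'(2) card_typecls_real_pos[of S'] by (simp add: cover_prob_def)
  qed
  obtain s where "\<And>i. s i \<in> typecls S'" "\<And>N' T. T \<in> sources S' \<Longrightarrow> real (card {x \<in> typecls T. \<forall>i<N'. \<not> rel (h T) x (s i)})
    \<le> exp (- cover_prob T * real N') / union_weight T * real (card (typecls T))"
    by (rule simultaneous_covering_sequence[OF finite_typecls typecls_nonempty finite_sources[OF S'],
          where X = typecls and w = union_weight and p = cover_prob and R = "\<lambda>T. rel (h T)"])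
       (use reg union_weight_sum[OF S'] in \<open>auto simp: union_weight_def\<close>)
  then show ?thesis unfolding covering_seq_def by blast
qed

definition cover_seq where "cover_seq S' = (SOME s. covering_seq S' s)"

lemma covering_seq: "S' \<in> word_types n \<Longrightarrow> covering_seq S' (cover_seq S')"
  unfolding cover_seq_def by (metis covering_seq_exists someI_ex)

lemma cover_seq: "S' \<in> word_types n \<Longrightarrow> cover_seq S' i \<in> typecls S'"
  "S' \<in> word_types n \<Longrightarrow> T \<in> sources S' \<Longrightarrow> real (card {x \<in> typecls T. \<forall>i<N'. \<not> rel (h T) x (cover_seq S' i)})
      \<le> exp (- cover_prob T * real N') / union_weight T * real (card (typecls T))"
  using covering_seq[of S'] by (simp_all add: covering_seq_def)

section \<open>The surcharge of words that represent themselves\<close>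

definition codeword where "codeword T = cover_seq (S T)"
definition codewords where "codewords  = {codeword T i | T i. T \<in> word_types n \<and> i < seq_length T}"
text \<open>These words must be their own reproductions. Membership is tested with
  \<open>close\<close>, which is weaker than the \<open>rel\<close> of the counting argument, so the
  set is at most as large as the bound obtained there.\<close>

definition uncovered where "uncovered  = {x \<in> words n. \<forall>i<seq_length (mset x). \<not> close x (codeword (mset x) i)}"
text \<open>The spare unit of the effort bounds the uncovered fraction by 1 / (h + 1), while log
  M(T) is at most (h + 1) times 6 kap lg because a fibre of \<open>rel\<close> lies in a Hamming
  ball of radius h. The product no longer contains h.\<close>

lemma uncovered_cost: "real (card (typecls T \<inter> uncovered)) * log 2 (real (max_ball T)) \<le> real (card (typecls T)) * (6 * kap T * lg)"
  if T: "T \<in> word_types n" for T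
proof -
  note SHT = related[OF T]
  have "typecls T \<inter> uncovered \<subseteq> {x \<in> typecls T. \<forall>i<seq_length T. \<not> rel (h T) x (cover_seq (S T) i)}"
    by (auto simp: uncovered_def codeword_def rel_def typecls_def)
  then have "card (typecls T \<inter> uncovered) \<le> card {x \<in> typecls T. \<forall>i<seq_length T. \<not> rel (h T) x (cover_seq (S T) i)}"
    by (rule card_mono[rotated]) simp
  then have "real (card (typecls T \<inter> uncovered)) \<le> exp (- cover_prob T * real (seq_length T)) / union_weight T * real (card (typecls T))"
    using cover_seq(2)[of "S T" T "seq_length T"] SHT T by (simp add: sources_def)
  also have "exp (- cover_prob T * real (seq_length T)) / union_weight T \<le> 1 / (real (h T) + 1)"
  proof -
    have "effort T \<le> cover_prob T * real (seq_length T)" using seq_length_ge[OF T] cover_prob_pos[OF T] by (simp add: divide_simps mult.commute)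
    then have "exp (- cover_prob T * real (seq_length T)) \<le> exp (- effort T)" by simp
    then have "exp (- cover_prob T * real (seq_length T)) / union_weight T \<le> exp (- effort T) / union_weight T"
      by (intro divide_right_mono) (auto simp: union_weight_def)
    also have "\<dots> = exp (- ((real (h T) + 1) * kap (S T)))"
      by (simp add: union_weight_def effort_def exp_diff[symmetric] algebra_simps)
    also have "\<dots> \<le> exp (- (real (h T) + 1))"
      using mult_left_mono[OF kap_ge1[of "S T"], of "real (h T) + 1", OF add_nonneg_nonneg[OF of_nat_0_le_iff zero_le_one]]
        by (simp only: exp_le_cancel_iff mult_1_right neg_le_iff_le)
    also have "\<dots> = 1 / exp (real (h T) + 1)" by (simp add: exp_minus divide_simps exp_add[symmetric])
    also have "\<dots> \<le> 1 / (real (h T) + 1)"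
      using exp_ge_add_one_self[of "real (h T) + 1"] by (intro divide_left_mono) (auto intro!: mult_pos_pos)
    finally show ?thesis .
  qed
  finally have c: "real (card (typecls T \<inter> uncovered)) \<le> 1 / (real (h T) + 1) * real (card (typecls T))"
    by (simp add: mult_right_mono)
  have M1: "0 \<le> log 2 (real (max_ball T))" using max_ball_pos[OF T] by simp
  have "log 2 (real (max_ball T)) \<le> lg + (real (big T) + 2 * real U) * (2 * lg) + real (h T) * (2 * lg)"
    using log_max_ball_le[OF T] log_bwd_degree_le[OF T] by linarith
  also have "\<dots> \<le> (real (h T) + 1) * (6 * kap T * lg)"
  proof -
    have "(real (big T) + 2 * real U) * (2 * lg) + lg \<le> 4 * kap T * lg"
      using lg_ge1 unfolding kap_def by (simp add: algebra_simps)
    also have "\<dots> \<le> (real (h T) + 1) * (4 * kap T * lg)"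
      using lg_ge1 kap_ge1[of T] mult_right_mono[of 1 "real (h T) + 1" "4 * kap T * lg"] by simp
    finally have 1: "(real (big T) + 2 * real U) * (2 * lg) + lg \<le> (real (h T) + 1) * (4 * kap T * lg)" .
    have "1 * lg \<le> kap T * lg" using lg_ge1 kap_ge1[of T] by (intro mult_right_mono) auto
    then have "real (h T) * (2 * lg) \<le> real (h T) * (2 * (kap T * lg))" by (intro mult_left_mono) auto
    also have "\<dots> \<le> (real (h T) + 1) * (2 * (kap T * lg))"
      using lg_ge1 kap_ge1[of T] by (intro mult_right_mono) auto
    finally show ?thesis using 1 by (simp add: algebra_simps)
  qed
  finally have "real (card (typecls T \<inter> uncovered)) * log 2 (real (max_ball T)) \<le>
      (1 / (real (h T) + 1) * real (card (typecls T))) * ((real (h T) + 1) * (6 * kap T * lg))"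
    using c M1 by (intro mult_mono) auto
  also have "\<dots> = real (card (typecls T)) * (6 * kap T * lg)" by (simp add: field_simps)
  finally show ?thesis .
qed
text \<open>All types with the same S use initial segments of one sequence, so only the longest
  segment counts, and the type T that needs it supplies h. The used fraction is
  \<open>effort T\<close> over the number of equivalent centres, of order kap / (h + 1), and the
  transfer lemma bounds log M(S) in terms of the same h.\<close>

lemma codewords_cost: "real (card (typecls S' \<inter> codewords)) * log 2 (real (max_ball S')) \<le> real (card (typecls S')) * (222 * kap S' * lg)"
  if S': "S' \<in> word_types n" for S'
proof (cases "sources S' = {}")
  case True
  have "typecls S' \<inter> codewords = {}"
  proof (rule equals0I)
    fix x assume "x \<in> typecls S' \<inter> codewords"
    then obtain T i where T: "T \<in> word_types n" "x = codeword T i" "x \<in> typecls S'" by (auto simp: codewords_def)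
    have "x \<in> typecls (S T)" using cover_seq(1)[of "S T" i] related[OF T(1)] T(2) by (simp add: codeword_def)
    then have "S T = S'" using T(3) by (simp add: typecls_def)
    then show False using True T(1) by (auto simp: sources_def)
  qed
  then show ?thesis using card_typecls_real_pos[of S'] kap_ge1[of S'] lg_ge1 by simp
next
  case False
  define Nm where "Nm = Max (seq_length ` sources S')"
  have "Nm \<in> seq_length ` sources S'" unfolding Nm_def using finite_sources[OF S'] False by (intro Max_in) auto
  then obtain T where T: "T \<in> sources S'" "Nm = seq_length T" by blast
  have Tt: "T \<in> word_types n" "S T = S'" using T by (auto simp: sources_def)
  note SHT = related[OF Tt(1)]
  have "typecls S' \<inter> codewords \<subseteq> cover_seq S' ` {..<Nm}"
  proof
    fix x assume "x \<in> typecls S' \<inter> codewords"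
    then obtain T' i where T': "T' \<in> word_types n" "x = codeword T' i" "x \<in> typecls S'" "i < seq_length T'" by (auto simp: codewords_def)
    have "x \<in> typecls (S T')" using cover_seq(1)[of "S T'" i] related[OF T'(1)] T'(2) by (simp add: codeword_def)
    then have e: "S T' = S'" using T'(3) by (simp add: typecls_def)
    then have "seq_length T' \<le> Nm" unfolding Nm_def using finite_sources[OF S'] T'(1) by (intro Max_ge) (auto simp: sources_def)
    then show "x \<in> cover_seq S' ` {..<Nm}" using T'(2,4) e by (auto simp: codeword_def)
  qed
  then have "card (typecls S' \<inter> codewords) \<le> card (cover_seq S' ` {..<Nm})" by (rule card_mono[rotated]) simp
  also have "\<dots> \<le> Nm" using card_image_le[of "{..<Nm}" "cover_seq S'"] by simp
  finally have cN: "card (typecls S' \<inter> codewords) \<le> Nm" .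
  let ?c = "real (card (typecls S'))" and ?b = "real (card (typecls S' \<inter> codewords))" and ?L = "log 2 (real (max_ball S'))"
  define \<tau> where "\<tau> = effort T / real (fwd_degree T)"
  have \<tau>0: "\<tau> \<ge> 0" using effort_ge4[of T] by (simp add: \<tau>_def)
  have bc: "?b \<le> ?c" by (simp add: card_mono)
  have b\<tau>: "?b \<le> \<tau> * ?c + 1"
  proof -
    have "effort T / cover_prob T = \<tau> * ?c" using Tt(2) by (simp add: cover_prob_def \<tau>_def)
    then show ?thesis using cN seq_length_le[OF Tt(1)] T(2) by simp
  qed
  have kTS: "kap T \<le> kap S'" using rel_big_le[OF Tt(1), of "S T" "x0 T" "y0 T" "h T"] SHT Tt(2) by (simp add: kap_def)
  \<comment> \<open>X collects the part of log M(S) that grows with h: 4 h lg from the transfer to T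
    and 2 h lg from the Hamming ball. It needs the small fraction \<open>\<tau>\<close>. For Y it
    suffices that at most all words of S are used.\<close>
  define X where "X = 6 * real (h T) * lg"
  define Y where "Y = 4 * kap S' * lg"
  have XY0: "X \<ge> 0" "Y \<ge> 0" using lg_ge1 kap_ge1[of S'] by (auto simp: X_def Y_def)
  have L0: "0 \<le> ?L" using max_ball_pos[OF S'] by simp
  have LXY: "?L \<le> X + Y"
  proof -
    have hh: "hamming n (x0 T) (y0 T) = h T" using SHT by (simp add: rel_def)
    have "max_ball S' \<le> (n\<^sup>2 + 1) ^ (2 * h T) * max_ball T"
      using max_ball_transfer[OF Tt(1), of S' "x0 T" "y0 T"] SHT Tt(2) hh by simp
    then have "real (max_ball S') \<le> real ((n\<^sup>2 + 1) ^ (2 * h T)) * real (max_ball T)"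
      unfolding of_nat_mult[symmetric] by (simp only: of_nat_le_iff)
    then have "?L \<le> log 2 (real ((n\<^sup>2 + 1) ^ (2 * h T)) * real (max_ball T))"
      using max_ball_real_pos[OF S'] max_ball_real_pos[OF Tt(1)] by (subst log_le_cancel_iff) (auto intro!: mult_pos_pos)
    also have "\<dots> = log 2 (real ((n\<^sup>2 + 1) ^ (2 * h T))) + log 2 (real (max_ball T))"
      using max_ball_real_pos[OF Tt(1)] by (simp add: log_mult del: of_nat_power)
    also have "\<dots> \<le> real (2 * h T) * (2 * lg) + (lg + (real (big T) + 2 * real U) * (2 * lg) + real (h T) * (2 * lg))"
      using log_V_power_le[of "2 * h T"] log_max_ball_le[OF Tt(1)] log_bwd_degree_le[OF Tt(1)] by linarith
    also have "\<dots> \<le> X + 4 * kap T * lg" using lg_ge1 unfolding kap_def X_def by (simp add: algebra_simps)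
    also have "\<dots> \<le> X + Y" unfolding Y_def using kTS lg_ge1 by (simp add: mult_right_mono)
    finally show ?thesis .
  qed
  have Lc: "?L \<le> ?c"
  proof -
    have "?L \<le> log 2 ?c" using max_ball_le[of S'] max_ball_real_pos[OF S'] by (subst log_le_cancel_iff) (auto simp: card_typecls_real_pos)
    also have "\<dots> \<le> ?c" by (rule log2_le_self[OF card_typecls_real_pos])
    finally show ?thesis .
  qed
  have "?b * ?L \<le> ?c * (\<tau> * X) + ?c * Y + ?c"
  \<comment> \<open>For \<open>\<tau>\<close> < 1 the rounding of the length adds one word and thus
    \<open>?L\<close> once, absorbed by \<open>?L\<close> \<le> \<open>?c\<close>. For
    \<open>\<tau>\<close> at least 1 the whole class may be charged.\<close>
  proof (cases "\<tau> \<ge> 1")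
    case True
    have "?b * ?L \<le> ?c * (X + Y)" using bc LXY L0 by (intro mult_mono) auto
    also have "\<dots> = ?c * (1 * X) + ?c * Y" by (simp add: algebra_simps)
    also have "\<dots> \<le> ?c * (\<tau> * X) + ?c * Y" using True XY0
      by (intro add_right_mono mult_left_mono mult_right_mono) auto
    finally show ?thesis using card_typecls_real_pos[of S'] by linarith
  next
    case False
    have "?b * ?L \<le> (\<tau> * ?c + 1) * ?L" using b\<tau> L0 by (intro mult_right_mono) auto
    also have "\<dots> = (\<tau> * ?c) * ?L + ?L" by (simp add: algebra_simps)
    also have "\<dots> \<le> (\<tau> * ?c) * (X + Y) + ?c" using LXY Lc \<tau>0 by (intro add_mono mult_left_mono) auto
    also have "\<dots> = ?c * (\<tau> * X) + \<tau> * (?c * Y) + ?c" by (simp add: algebra_simps)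
    also have "\<tau> * (?c * Y) \<le> 1 * (?c * Y)" using False XY0 by (intro mult_right_mono) auto
    finally show ?thesis by simp
  qed
  \<comment> \<open>216 = 4 * 9 * 6: the constants of the effort, of the number of equivalent
    centres and of X. The factor (h + 1) h cancels against (h + 1)^2.\<close>
  also have "\<tau> * X \<le> 216 * kap S' * lg"
  proof -
    have mT: "real (fwd_degree T) > 0" using fwd_degree_pos[OF Tt(1)] by simp
    have "(real (h T) + 1) * real (h T) \<le> (real (h T) + 1)\<^sup>2" by (simp add: power2_eq_square algebra_simps)
    then have "(real (h T) + 1) * real (h T) \<le> 9 * real (fwd_degree T)" using fwd_degree_lower[OF Tt(1)] by linarith
    then have "(real (h T) + 1) * real (h T) * (24 * (kap S' * lg)) \<le> 9 * real (fwd_degree T) * (24 * (kap S' * lg))"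
      using lg_ge1 kap_ge1[of S'] by (intro mult_right_mono) auto
    then have "effort T * X \<le> 216 * kap S' * lg * real (fwd_degree T)"
      unfolding effort_def X_def Tt(2) by (simp add: algebra_simps)
    then show ?thesis using mT by (simp add: \<tau>_def divide_simps)
  qed
  finally have "?b * ?L \<le> ?c * (216 * kap S' * lg) + ?c * Y + ?c" using card_typecls_real_pos[of S'] by (simp add: mult_left_mono)
  also have "\<dots> \<le> ?c * (222 * kap S' * lg)"
  proof -
    have "1 * 1 \<le> kap S' * lg" using lg_ge1 kap_ge1[of S'] by (intro mult_mono) auto
    then have "216 * kap S' * lg + Y + 1 \<le> 222 * kap S' * lg" unfolding Y_def by linarith
    then have "?c * (216 * kap S' * lg + Y + 1) \<le> ?c * (222 * kap S' * lg)" by (intro mult_left_mono) auto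
    then show ?thesis by (simp add: algebra_simps)
  qed
  finally show ?thesis .
qed
lemma codeword_words: "codeword T i \<in> words n" if "T \<in> word_types n" for T i
  using cover_seq(1)[of "S T" i] related[OF that] typecls_words[of "S T" n] by (auto simp: codeword_def)

lemma used_words_cost: "real (card (typecls T \<inter> (codewords \<union> uncovered))) * log 2 (real (max_ball T)) \<le> real (card (typecls T)) * (228 * kap T * lg)"
  if T: "T \<in> word_types n" for T
proof -
  have "card (typecls T \<inter> (codewords \<union> uncovered)) \<le> card (typecls T \<inter> codewords) + card (typecls T \<inter> uncovered)"
    unfolding Int_Un_distrib by (rule card_Un_le)
  then have "real (card (typecls T \<inter> (codewords \<union> uncovered))) \<le> real (card (typecls T \<inter> codewords)) + real (card (typecls T \<inter> uncovered))"
    by linarith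
  moreover have "0 \<le> log 2 (real (max_ball T))" using max_ball_pos[OF T] by simp
  ultimately have "real (card (typecls T \<inter> (codewords \<union> uncovered))) * log 2 (real (max_ball T)) \<le>
      (real (card (typecls T \<inter> codewords)) + real (card (typecls T \<inter> uncovered))) * log 2 (real (max_ball T))"
    by (rule mult_right_mono)
  then show ?thesis using codewords_cost[OF T] uncovered_cost[OF T] by (simp add: algebra_simps)
qed

end

context distortion_block
begin

text \<open>What the coding step needs: the lengths of the sequences, and the fraction of each class
  that B occupies, because every word of B is coded as itself.\<close>

lemma exists_covering_sequences:
  obtains C :: "nat multiset \<Rightarrow> nat \<Rightarrow> nat list" and N :: "nat multiset \<Rightarrow> nat" and B :: "nat list set"
  where "\<And>T i. T \<in> word_types n \<Longrightarrow> C T i \<in> words n"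
    and "B = {C T i | T i. T \<in> word_types n \<and> i < N T} \<union>
             {x \<in> words n. \<forall>i<N (mset x). \<not> close x (C (mset x) i)}"
    and "\<And>T. T \<in> word_types n \<Longrightarrow> N T \<ge> 1"
    and "\<And>T. T \<in> word_types n \<Longrightarrow>
           log 2 (real (N T)) \<le> log 2 (real (card (typecls T)) / real (max_ball T)) + 8 * kap T * lg"
    and "\<And>T. T \<in> word_types n \<Longrightarrow>
           real (card (typecls T \<inter> B)) * log 2 (real (max_ball T)) \<le> real (card (typecls T)) * (228 * kap T * lg)"
proof -
  let ?V = "n\<^sup>2 + 1"
  define good where "good T q \<longleftrightarrow> fst q \<in> word_types n \<and> fst (snd q) \<le> n \<and> fst (snd (snd q)) \<in> typecls T \<and>
      snd (snd (snd q)) \<in> typecls (fst q) \<and> rel (fst (snd q)) (fst (snd (snd q))) (snd (snd (snd q))) \<and>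
      max_ball T \<le> (n + 1) * ?V ^ (big T + 2 * U) * card {x \<in> typecls T. rel (fst (snd q)) x (snd (snd (snd q)))}"
    for T and q :: "nat multiset \<times> nat \<times> nat list \<times> nat list"
  have "\<forall>T\<in>word_types n. \<exists>q. good T q"
  proof
    fix T assume "T \<in> word_types n"
    then obtain S h x y where "S \<in> word_types n" "h \<le> n" "x \<in> typecls T" "y \<in> typecls S" "rel h x y"
        "max_ball T \<le> (n + 1) * ?V ^ (big T + 2 * U) * card {x \<in> typecls T. rel h x y}"
      by (rule exists_related_type)
    then have "good T (S, h, x, y)" unfolding good_def fst_conv snd_conv by blast
    then show "\<exists>q. good T q" by blast
  qed
  from bchoice[OF this] obtain q where q: "\<forall>T\<in>word_types n. good T (q T)" by blast
  define S where "S T = fst (q T)" for T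
  define h where "h T = fst (snd (q T))" for T
  define x0 where "x0 T = fst (snd (snd (q T)))" for T
  define y0 where "y0 T = snd (snd (snd (q T)))" for T
  have SH: "S T \<in> word_types n \<and> h T \<le> n \<and> x0 T \<in> typecls T \<and> y0 T \<in> typecls (S T) \<and>
      rel (h T) (x0 T) (y0 T) \<and>
      max_ball T \<le> (n + 1) * ?V ^ (big T + 2 * U) * card {x \<in> typecls T. rel (h T) x (y0 T)}"
    if "T \<in> word_types n" for T
    using bspec[OF q that] unfolding good_def S_def[symmetric] h_def[symmetric] x0_def[symmetric] y0_def[symmetric] .
  interpret R: related_types \<rho> d n U S h x0 y0
    by unfold_locales (rule SH)
  show ?thesis
  proof (rule that[of R.codeword "R.codewords \<union> R.uncovered" R.seq_length])
    show "R.codewords \<union> R.uncovered = {R.codeword T i | T i. T \<in> word_types n \<and> i < R.seq_length T} \<union>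
             {x \<in> words n. \<forall>i<R.seq_length (mset x). \<not> close x (R.codeword (mset x) i)}"
      by (simp add: R.codewords_def R.uncovered_def)
  qed (rule R.codeword_words R.seq_length_ge1 R.log_seq_length_le R.used_words_cost, assumption)+
qed

end

section \<open>The universal code\<close>

text \<open>Types are infinite in number, so total mass is expressed through finite subsets; a
  positive lower bound on the weights then forces finiteness.\<close>

lemma finite_card_le_if_weights:
  fixes g :: "'a \<Rightarrow> real"
  assumes "\<And>F. finite F \<Longrightarrow> F \<subseteq> A \<Longrightarrow> sum g F \<le> c" and "\<And>x. x \<in> A \<Longrightarrow> g x \<ge> b" and b: "b > 0"
  shows "finite A" "real (card A) * b \<le> c"
proof -
  have le: "real (card F) * b \<le> c" if F: "finite F" "F \<subseteq> A" for F
  proof -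
    have "real (card F) * b = (\<Sum>x\<in>F. b)" by simp
    also have "\<dots> \<le> sum g F" using assms(2) F by (intro sum_mono) auto
    finally show ?thesis using assms(1)[OF F] by linarith
  qed
  have "card F \<le> nat \<lfloor>c / b\<rfloor>" if "finite F" "F \<subseteq> A" for F
    using le[OF that] b by (simp add: le_nat_floor pos_le_divide_eq)
  then show fin: "finite A" using finite_if_finite_subsets_card_bdd[of A "nat \<lfloor>c / b\<rfloor>"] by blast
  show "real (card A) * b \<le> c" using le[OF fin] by simp
qed

lemma two_powr_nat_ceiling:
  fixes a :: real
  assumes "a \<ge> 1"
  shows "(1/2) ^ nat \<lceil>log 2 a\<rceil> \<le> 1 / a" "real (nat \<lceil>log 2 a\<rceil>) \<le> log 2 a + 1"
proof -
  have l0: "log 2 a \<ge> 0" using assms by simp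
  have "a = 2 powr (log 2 a)" using assms by simp
  also have "\<dots> \<le> 2 powr (real (nat \<lceil>log 2 a\<rceil>))" by (intro powr_mono real_nat_ceiling_ge) simp
  also have "\<dots> = 2 ^ nat \<lceil>log 2 a\<rceil>" by (simp add: powr_realpow)
  finally have "1 / 2 ^ nat \<lceil>log 2 a\<rceil> \<le> 1 / a" using assms by (intro divide_left_mono) auto
  then show "(1/2) ^ nat \<lceil>log 2 a\<rceil> \<le> 1 / a" by (simp add: power_one_over)
  show "real (nat \<lceil>log 2 a\<rceil>) \<le> log 2 a + 1" using l0 by linarith
qed

lemma semifaithful_codeI:
  assumes B: "\<And>x. x \<in> words n \<Longrightarrow> q x \<in> B" "B \<subseteq> words n" "\<And>y. y \<in> B \<Longrightarrow> q y = y"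
    and dist: "\<And>x. x \<in> words n \<Longrightarrow> block_distortion \<rho> n x (q x) \<le> d"
    and L: "\<And>k. finite {y \<in> B. L y = k}" "\<And>k. card {y \<in> B. L y = k} \<le> 2 ^ k"
  obtains enc dec where "semifaithful_code \<rho> d n (q, enc, dec)"
    "\<And>x. x \<in> words n \<Longrightarrow> real (length (enc (q x))) \<le> real (L (q x)) + 2 * log 2 (1 + real (L (q x))) + 3"
proof (rule prefix_code_exists[OF L])
  fix enc :: "nat list \<Rightarrow> bool list"
  assume enc: "\<And>y z. y \<in> B \<Longrightarrow> z \<in> B \<Longrightarrow> prefix (enc y) (enc z) \<Longrightarrow> y = z"
    "\<And>y. y \<in> B \<Longrightarrow> enc y \<noteq> []"
    "\<And>y. y \<in> B \<Longrightarrow> real (length (enc y)) \<le> real (L y) + 2 * log 2 (1 + real (L y)) + 3"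
  have "replicate n 1 \<in> words n" by (auto simp: words_def alphabet_def)
  then have b0: "q (replicate n 1) \<in> B" by (rule B(1))
  \<comment> \<open>Strings that encode nothing are sent to an arbitrary code word, as the decoder
    must map every nonempty string into B.\<close>
  define dec where "dec s = (if \<exists>y\<in>B. enc y = s then (SOME y. y \<in> B \<and> enc y = s) else q (replicate n 1))" for s
  have dec_some: "dec s \<in> B \<and> enc (dec s) = s" if "\<exists>y\<in>B. enc y = s" for s
  proof -
    have e: "dec s = (SOME y. y \<in> B \<and> enc y = s)" unfolding dec_def using that by (rule if_P)
    have "\<exists>y. y \<in> B \<and> enc y = s" using that by blast
    then show ?thesis unfolding e by (rule someI_ex)
  qed
  have dec: "dec (enc y) = y" if y: "y \<in> B" for y
  proof -
    have d: "dec (enc y) \<in> B \<and> enc (dec (enc y)) = enc y" by (rule dec_some) (use y in blast)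
    show ?thesis by (rule enc(1)) (use d y in simp_all)
  qed
  have decB: "dec s \<in> B" for s
  proof (cases "\<exists>y\<in>B. enc y = s")
    case True then show ?thesis using dec_some by blast
  next
    case False
    have "dec s = q (replicate n 1)" unfolding dec_def using False by (rule if_not_P)
    then show ?thesis using b0 by simp
  qed
  have range: "q ` words n = B"
  proof
    show "q ` words n \<subseteq> B" using B(1) by blast
    show "B \<subseteq> q ` words n"
    proof
      fix y assume "y \<in> B"
      then have "y \<in> words n" "y = q y" using B(2) B(3)[of y] by auto
      then show "y \<in> q ` words n" by (rule image_eqI[rotated])
    qed
  qed
  have "semifaithful_code \<rho> d n (q, enc, dec)"
    unfolding semifaithful_code_def Let_def prod.case range
  proof (intro conjI ballI allI impI)
    show "prefix_free_on B enc" unfolding prefix_free_on_def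
    proof (intro ballI impI)
      fix y z assume "y \<in> B" "z \<in> B" "prefix (enc y) (enc z)"
      then show "y = z" by (rule enc(1))
    qed
  qed (rule B(2) | rule dist, assumption | rule B(3), assumption | rule enc(2), assumption | rule decB | rule dec, assumption)+
  moreover have "real (length (enc (q x))) \<le> real (L (q x)) + 2 * log 2 (1 + real (L (q x))) + 3" if "x \<in> words n" for x
    by (rule enc(3)[OF B(1)[OF that]])
  ultimately show thesis by (rule that)
qed

context distortion_block
begin

text \<open>A code word has two possible descriptions, as an element of its type class or as a term
  of the sequence of some type, and is given the shorter one. Words outside B profit from the
  second; words of B may have to pay log |T|, that is log M(T) more, and their share of the class
  makes this affordable on average. The factor 2 in front of log (1 / w) pays for making the lengths
  self-delimiting.\<close>

theorem exists_universal_code: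
  fixes w :: "nat multiset \<Rightarrow> real"
  assumes w_pos: "\<And>T. T \<in> word_types n \<Longrightarrow> w T > 0"
    and w_sum: "\<And>F. finite F \<Longrightarrow> F \<subseteq> word_types n \<Longrightarrow> sum w F \<le> 1"
  obtains q enc dec where "semifaithful_code \<rho> d n (q, enc, dec)"
    "\<And>T. T \<in> word_types n \<Longrightarrow> (\<Sum>x\<in>typecls T. real (length (enc (q x)))) \<le>
       real (card (typecls T)) * (log 2 (real (card (typecls T)) / real (max_ball T))
         + 2 * log 2 (1 / w T) + 400 * kap T * lg)"
proof (rule exists_covering_sequences)
  fix C :: "nat multiset \<Rightarrow> nat \<Rightarrow> nat list" and N :: "nat multiset \<Rightarrow> nat" and B :: "nat list set"
  assume C_words: "\<And>T i. T \<in> word_types n \<Longrightarrow> C T i \<in> words n"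
    and B_def: "B = {C T i | T i. T \<in> word_types n \<and> i < N T} \<union>
             {x \<in> words n. \<forall>i<N (mset x). \<not> close x (C (mset x) i)}"
    and N1: "\<And>T. T \<in> word_types n \<Longrightarrow> N T \<ge> 1"
    and logN: "\<And>T. T \<in> word_types n \<Longrightarrow>
           log 2 (real (N T)) \<le> log 2 (real (card (typecls T)) / real (max_ball T)) + 8 * kap T * lg"
    and hits: "\<And>T. T \<in> word_types n \<Longrightarrow>
           real (card (typecls T \<inter> B)) * log 2 (real (max_ball T)) \<le> real (card (typecls T)) * (228 * kap T * lg)"
  have BW: "B \<subseteq> words n" using C_words by (auto simp: B_def)
  \<comment> \<open>Terms of the sequences of other types are fixed as well: the quantizer must be
    the identity on its whole range.\<close>
  define q where "q x = (if x \<in> B then x else C (mset x) (SOME i. i < N (mset x) \<and> close x (C (mset x) i)))" for x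
  have qC: "\<exists>i<N (mset x). q x = C (mset x) i \<and> close x (q x)" if x: "x \<in> words n" "x \<notin> B" for x
  proof -
    have "\<exists>i. i < N (mset x) \<and> close x (C (mset x) i)" using x by (auto simp: B_def)
    from someI_ex[OF this] show ?thesis using x(2) by (auto simp: q_def)
  qed
  have qB: "q x \<in> B" if x: "x \<in> words n" for x
  proof (cases "x \<in> B")
    case True then show ?thesis by (simp add: q_def)
  next
    case False
    from qC[OF x False] show ?thesis using mset_word_types[OF x] by (auto simp: B_def)
  qed
  have qclose: "block_distortion \<rho> n x (q x) \<le> d" if x: "x \<in> words n" for x
    using close_refl[OF x] qC[OF x] by (cases "x \<in> B") (auto simp: q_def close_def)
  have qid: "q y = y" if "y \<in> B" for y using that by (simp add: q_def)
  have w_le1: "w T \<le> 1" if "T \<in> word_types n" for T using w_sum[of "{T}"] that by simp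
  \<comment> \<open>Each kind of description receives half of the total mass; this is the 2 in the
    denominators of \<open>g0\<close> and \<open>g1\<close>.\<close>
  define g0 where "g0 y = w (mset y) / (2 * real (card (typecls (mset y))))" for y
  define g1 where "g1 Ti = w (fst Ti) / (2 * real (N (fst Ti)))" for Ti :: "nat multiset \<times> nat"
  define A0 where "A0 k = {y \<in> words n. (1/2) ^ k \<le> g0 y}" for k
  define A1 where "A1 k = {Ti. fst Ti \<in> word_types n \<and> snd Ti < N (fst Ti) \<and> (1/2) ^ k \<le> g1 Ti}" for k
  \<comment> \<open>Least level at which one of the descriptions has weight 2^-k. Each kind fills at
    most half of the 2^k places of a level.\<close>
  define L where "L y = (LEAST k. y \<in> A0 k \<or> y \<in> (\<lambda>Ti. C (fst Ti) (snd Ti)) ` A1 k)" for y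
  have A0: "2 * card (A0 k) \<le> 2 ^ k" "finite (A0 k)" for k
  proof -
    have sum: "sum g0 F \<le> 1/2" if F: "finite F" "F \<subseteq> A0 k" for F
    proof -
      have Fw: "y \<in> words n" if "y \<in> F" for y using F(2) that by (auto simp: A0_def)
      have "sum g0 F = (\<Sum>T\<in>mset ` F. \<Sum>y\<in>{y \<in> F. mset y = T}. g0 y)"
        by (rule sum.image_gen[OF F(1)])
      also have "\<dots> \<le> (\<Sum>T\<in>mset ` F. w T / 2)"
      proof (rule sum_mono)
        fix T assume "T \<in> mset ` F"
        then have T: "T \<in> word_types n" using Fw mset_word_types by auto
        have "(\<Sum>y\<in>{y \<in> F. mset y = T}. g0 y) = real (card {y \<in> F. mset y = T}) * (w T / (2 * real (card (typecls T))))"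
          by (simp add: g0_def)
        also have "\<dots> \<le> real (card (typecls T)) * (w T / (2 * real (card (typecls T))))"
        proof (rule mult_right_mono)
          have "card {y \<in> F. mset y = T} \<le> card (typecls T)"
            by (rule card_mono) (auto simp: typecls_def[symmetric], auto simp: typecls_def)
          then show "real (card {y \<in> F. mset y = T}) \<le> real (card (typecls T))" by simp
          show "0 \<le> w T / (2 * real (card (typecls T)))" using w_pos[OF T] by simp
        qed
        also have "\<dots> = w T / 2" using card_typecls_pos[of T] by (simp add: typecls_nonempty)
        finally show "(\<Sum>y\<in>{y \<in> F. mset y = T}. g0 y) \<le> w T / 2" .
      qed
      also have "\<dots> = sum w (mset ` F) / 2" by (simp add: sum_divide_distrib)
      also have "\<dots> \<le> 1 / 2"
        using w_sum[OF finite_imageI[OF F(1)], of mset] image_subsetI[of F mset, OF mset_word_types[OF Fw]]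
        by (intro divide_right_mono) auto
      finally show ?thesis .
    qed
    have g: "(1/2) ^ k \<le> g0 y" if "y \<in> A0 k" for y using that by (simp add: A0_def)
    have b: "0 < (1/2 :: real) ^ k" by simp
    note bounds = finite_card_le_if_weights[of "A0 k" g0, OF sum g b]
    have fin: "finite (A0 k)" by (rule bounds)
    have "real (card (A0 k)) * (1/2) ^ k \<le> 1/2" by (rule bounds)
    then have "real (2 * card (A0 k)) \<le> real (2 ^ k)" by (simp add: power_one_over divide_simps)
    then show "2 * card (A0 k) \<le> 2 ^ k" by (simp only: of_nat_le_iff)
    show "finite (A0 k)" by (rule fin)
  qed
  have A1: "2 * card (A1 k) \<le> 2 ^ k" "finite (A1 k)" for k
  proof -
    have sum: "sum g1 F \<le> 1/2" if F: "finite F" "F \<subseteq> A1 k" for F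
    proof -
      have Fw: "fst Ti \<in> word_types n" "snd Ti < N (fst Ti)" if "Ti \<in> F" for Ti using F(2) that by (auto simp: A1_def)
      have "sum g1 F = (\<Sum>T\<in>fst ` F. \<Sum>Ti\<in>{Ti \<in> F. fst Ti = T}. g1 Ti)"
        by (rule sum.image_gen[OF F(1)])
      also have "\<dots> \<le> (\<Sum>T\<in>fst ` F. w T / 2)"
      proof (rule sum_mono)
        fix T assume "T \<in> fst ` F"
        then have T: "T \<in> word_types n" using Fw by auto
        have "(\<Sum>Ti\<in>{Ti \<in> F. fst Ti = T}. g1 Ti) = real (card {Ti \<in> F. fst Ti = T}) * (w T / (2 * real (N T)))"
          by (simp add: g1_def)
        also have "\<dots> \<le> real (N T) * (w T / (2 * real (N T)))"
        proof (rule mult_right_mono)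
          have "card {Ti \<in> F. fst Ti = T} \<le> card ({T} \<times> {..<N T})"
            using Fw by (intro card_mono) auto
          then show "real (card {Ti \<in> F. fst Ti = T}) \<le> real (N T)" by (simp add: card_cartesian_product)
          show "0 \<le> w T / (2 * real (N T))" using w_pos[OF T] by simp
        qed
        also have "\<dots> = w T / 2" using N1[OF T] by simp
        finally show "(\<Sum>Ti\<in>{Ti \<in> F. fst Ti = T}. g1 Ti) \<le> w T / 2" .
      qed
      also have "\<dots> = sum w (fst ` F) / 2" by (simp add: sum_divide_distrib)
      also have "\<dots> \<le> 1 / 2"
        using w_sum[OF finite_imageI[OF F(1)], of fst] image_subsetI[of F fst, OF Fw(1)]
        by (intro divide_right_mono) auto
      finally show ?thesis .
    qed
    have g: "(1/2) ^ k \<le> g1 y" if "y \<in> A1 k" for y using that by (simp add: A1_def)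
    have b: "0 < (1/2 :: real) ^ k" by simp
    note bounds = finite_card_le_if_weights[of "A1 k" g1, OF sum g b]
    have fin: "finite (A1 k)" by (rule bounds)
    have "real (card (A1 k)) * (1/2) ^ k \<le> 1/2" by (rule bounds)
    then have "real (2 * card (A1 k)) \<le> real (2 ^ k)" by (simp add: power_one_over divide_simps)
    then show "2 * card (A1 k) \<le> 2 ^ k" by (simp only: of_nat_le_iff)
    show "finite (A1 k)" by (rule fin)
  qed
  have L0: "real (L y) \<le> log 2 (1 / w (mset y)) + log 2 (real (card (typecls (mset y)))) + 2"
    and L_ex: "\<exists>k. y \<in> A0 k" if y: "y \<in> words n" for y
  proof -
    let ?T = "mset y"
    have T: "?T \<in> word_types n" by (rule mset_word_types[OF y])
    define a where "a = 2 * real (card (typecls ?T)) / w ?T"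
    have c1: "real (card (typecls ?T)) \<ge> 1" using card_typecls_pos[of ?T] by linarith
    have "w ?T * 1 \<le> 1 * (2 * real (card (typecls ?T)))"
      using w_le1[OF T] c1 w_pos[OF T] by (intro mult_mono) auto
    then have a1: "a \<ge> 1" using w_pos[OF T] by (simp add: a_def)
    have g: "g0 y = 1 / a" by (simp add: g0_def a_def)
    have m: "y \<in> A0 (nat \<lceil>log 2 a\<rceil>)" using y two_powr_nat_ceiling(1)[OF a1] g by (simp add: A0_def)
    then show "\<exists>k. y \<in> A0 k" by blast
    have "L y \<le> nat \<lceil>log 2 a\<rceil>" unfolding L_def by (rule Least_le) (use m in blast)
    then have "real (L y) \<le> log 2 a + 1" using two_powr_nat_ceiling(2)[OF a1] by linarith
    also have "log 2 a = 1 + log 2 (real (card (typecls ?T))) + log 2 (1 / w ?T)"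
      using w_pos[OF T] c1 by (simp add: a_def log_divide log_mult typecls_nonempty)
    finally show "real (L y) \<le> log 2 (1 / w (mset y)) + log 2 (real (card (typecls (mset y)))) + 2" by simp
  qed
  have L1: "real (L (C T i)) \<le> log 2 (1 / w T) + log 2 (real (N T)) + 2" if T: "T \<in> word_types n" and i: "i < N T" for T i
  proof -
    define a where "a = 2 * real (N T) / w T"
    have c1: "real (N T) \<ge> 1" using N1[OF T] by linarith
    have "w T * 1 \<le> 1 * (2 * real (N T))"
      using w_le1[OF T] c1 w_pos[OF T] by (intro mult_mono) auto
    then have a1: "a \<ge> 1" using w_pos[OF T] by (simp add: a_def)
    have g: "g1 (T, i) = 1 / a" by (simp add: g1_def a_def)
    have m: "(T, i) \<in> A1 (nat \<lceil>log 2 a\<rceil>)" using T i two_powr_nat_ceiling(1)[OF a1] g by (simp add: A1_def)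
    have "L (C T i) \<le> nat \<lceil>log 2 a\<rceil>" unfolding L_def by (rule Least_le) (use m in force)
    then have "real (L (C T i)) \<le> log 2 a + 1" using two_powr_nat_ceiling(2)[OF a1] by linarith
    also have "log 2 a = 1 + log 2 (real (N T)) + log 2 (1 / w T)"
      using w_pos[OF T] c1 by (simp add: a_def log_divide log_mult)
    finally show ?thesis by simp
  qed
  have Lsub: "{y \<in> B. L y = k} \<subseteq> A0 k \<union> (\<lambda>Ti. C (fst Ti) (snd Ti)) ` A1 k" for k
  proof
    fix y assume y: "y \<in> {y \<in> B. L y = k}"
    then obtain k' where "y \<in> A0 k'" using L_ex BW by blast
    then have "y \<in> A0 k' \<or> y \<in> (\<lambda>Ti. C (fst Ti) (snd Ti)) ` A1 k'" by blast
    then have "y \<in> A0 (L y) \<or> y \<in> (\<lambda>Ti. C (fst Ti) (snd Ti)) ` A1 (L y)" unfolding L_def by (rule LeastI)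
    then show "y \<in> A0 k \<union> (\<lambda>Ti. C (fst Ti) (snd Ti)) ` A1 k" using y by auto
  qed
  have fin_sup: "finite (A0 k \<union> (\<lambda>Ti. C (fst Ti) (snd Ti)) ` A1 k)" for k using A0(2) A1(2) by simp
  have Lfin: "finite {y \<in> B. L y = k}" for k by (rule finite_subset[OF Lsub fin_sup])
  have Lcard: "card {y \<in> B. L y = k} \<le> 2 ^ k" for k
  proof -
    have "card {y \<in> B. L y = k} \<le> card (A0 k \<union> (\<lambda>Ti. C (fst Ti) (snd Ti)) ` A1 k)" by (rule card_mono[OF fin_sup Lsub])
    also have "\<dots> \<le> card (A0 k) + card ((\<lambda>Ti. C (fst Ti) (snd Ti)) ` A1 k)" by (rule card_Un_le)
    \<comment> \<open>Several pairs (T, i) may name the same word, which only lowers the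
      count.\<close>
    also have "\<dots> \<le> card (A0 k) + card (A1 k)" by (intro add_left_mono card_image_le A1(2))
    also have "\<dots> \<le> 2 ^ k" using A0(1)[of k] A1(1)[of k] by linarith
    finally show ?thesis .
  qed
  show thesis
  proof (rule semifaithful_codeI[OF qB BW qid qclose Lfin Lcard])
    fix enc dec assume code: "semifaithful_code \<rho> d n (q, enc, dec)"
      and len: "\<And>x. x \<in> words n \<Longrightarrow> real (length (enc (q x))) \<le> real (L (q x)) + 2 * log 2 (1 + real (L (q x))) + 3"
  show thesis
  proof (rule that[OF code])
    fix T assume T: "T \<in> word_types n"
    let ?c = "real (card (typecls T))"
    define I where "I = log 2 (?c / real (max_ball T))"
    define lw where "lw = log 2 (1 / w T)"
    define lM where "lM = log 2 (real (max_ball T))"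
    have c1: "?c \<ge> 1" using card_typecls_pos[of T] by linarith
    have Mp: "real (max_ball T) > 0" using max_ball_pos[OF T] by simp
    have lM0: "lM \<ge> 0" using max_ball_pos[OF T] by (simp add: lM_def)
    have lc: "log 2 ?c = I + lM" using Mp c1 by (simp add: I_def lM_def log_divide typecls_nonempty)
    have lw0: "lw \<ge> 0" using w_pos[OF T] w_le1[OF T] by (simp add: lw_def log_divide)
    have I_le: "I \<le> real n * lg"
    proof -
      have "log 2 ?c \<le> log 2 (real (n ^ n))" using card_typecls_le[OF T] c1 by (subst log_le_cancel_iff) (auto simp: n1)
      also have "\<dots> = real n * log 2 (real n)" using n1 by (simp add: log_nat_power)
      also have "\<dots> \<le> real n * lg" using n1 unfolding lg_def by (intro mult_left_mono) auto
      finally show ?thesis using lc lM0 by linarith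
    qed
    have kl: "kap T * lg \<ge> lg" using mult_right_mono[OF kap_ge1[of T], of lg] lg_ge1 by simp
    define Q where "Q = lw + 2 + I + 8 * kap T * lg"
    have Lx: "real (L (q x)) \<le> Q + indicator B x * lM" if x: "x \<in> typecls T" for x
    proof -
      have xw: "x \<in> words n" "mset x = T" using x typecls_words[OF T] by (auto simp: typecls_def)
      show ?thesis
      proof (cases "x \<in> B")
        case True
        have "indicator B x * lM = lM" using True by simp
        moreover have "real (L x) \<le> lw + (I + lM) + 2" using L0[OF xw(1)] unfolding xw(2) lc lw_def .
        ultimately show ?thesis using kl lg_ge1 unfolding qid[OF True] Q_def by linarith
      next
        case False
        obtain i where "i < N T" "q x = C T i" using qC[OF xw(1) False] xw(2) by auto
        then have "real (L (q x)) \<le> lw + (I + 8 * kap T * lg) + 2"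
          using L1[OF T, of i] logN[OF T] unfolding lw_def I_def by simp
        then show ?thesis using False unfolding Q_def by simp
      qed
    qed
    have "(\<Sum>x\<in>typecls T. real (L (q x))) \<le> (\<Sum>x\<in>typecls T. Q + indicator B x * lM)" by (rule sum_mono) (rule Lx)
    also have "\<dots> = ?c * Q + (\<Sum>x\<in>typecls T. indicator B x * lM)" by (simp add: sum.distrib)
    also have "(\<Sum>x\<in>typecls T. indicator B x * lM) = (\<Sum>x\<in>typecls T \<inter> B. lM)"
      unfolding sum.inter_restrict[OF finite_typecls] by (intro sum.cong) (auto simp: indicator_def)
    also have "\<dots> = real (card (typecls T \<inter> B)) * lM" by simp
    also have "?c * Q + real (card (typecls T \<inter> B)) * lM \<le> ?c * Q + ?c * (228 * kap T * lg)" using hits[OF T] by (simp add: lM_def)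
    finally have SL: "(\<Sum>x\<in>typecls T. real (L (q x))) \<le> ?c * (Q + 228 * kap T * lg)" by (simp add: distrib_left)
    define R where "R = Q + 228 * kap T * lg"
    \<comment> \<open>The overhead log (1 + L) is made linear in L so that it can be averaged over
      the class: splitting off log N = 2 lg leaves at most (1 + L) / N.\<close>
    let ?N = "(real n + 1)\<^sup>2"
    have N4: "?N \<ge> 4"
    proof -
      have "(2::real)\<^sup>2 \<le> ?N" using n1 by (intro power_mono) auto
      then show ?thesis by simp
    qed
    have lenx: "real (length (enc (q x))) \<le> real (L (q x)) * (1 + 2 / ?N) + (4 * lg + 2 / ?N + 3)" if x: "x \<in> typecls T" for x
    proof -
      have xw: "x \<in> words n" using x typecls_words[OF T] by auto
      let ?l = "real (L (q x))"
      have pos: "(1 + ?l) / ?N > 0" using N4 by (intro divide_pos_pos) auto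
      have "log 2 (1 + ?l) = log 2 (?N * ((1 + ?l) / ?N))" using N4 by simp
      also have "\<dots> = log 2 ?N + log 2 ((1 + ?l) / ?N)" using pos N4 by (subst log_mult) auto
      also have "log 2 ?N = 2 * lg" by (subst log_nat_power) (simp_all add: lg_def)
      also have "log 2 ((1 + ?l) / ?N) \<le> (1 + ?l) / ?N" by (rule log2_le_self[OF pos])
      finally have "log 2 (1 + ?l) \<le> 2 * lg + (1 + ?l) / ?N" by simp
      then have "2 * log 2 (1 + ?l) \<le> 2 * (2 * lg + (1 + ?l) / ?N)" by (rule mult_left_mono) simp
      then have "real (length (enc (q x))) \<le> ?l + 2 * (2 * lg + (1 + ?l) / ?N) + 3"
        by (intro order_trans[OF len[OF xw]] add_right_mono add_left_mono)
      also have "\<dots> = ?l * (1 + 2 / ?N) + (4 * lg + 2 / ?N + 3)" by (simp add: algebra_simps add_divide_distrib)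
      finally show ?thesis .
    qed
    have "(\<Sum>x\<in>typecls T. real (length (enc (q x)))) \<le>
        (\<Sum>x\<in>typecls T. real (L (q x)) * (1 + 2 / ?N) + (4 * lg + 2 / ?N + 3))" by (rule sum_mono) (rule lenx)
    also have "\<dots> = (\<Sum>x\<in>typecls T. real (L (q x))) * (1 + 2 / ?N) + ?c * (4 * lg + 2 / ?N + 3)"
      by (simp add: sum.distrib sum_distrib_right)
    also have "\<dots> \<le> (?c * R) * (1 + 2 / ?N) + ?c * (4 * lg + 2 / ?N + 3)"
      using SL N4 unfolding R_def by (intro add_right_mono mult_right_mono) auto
    also have "\<dots> = ?c * (R * (1 + 2 / ?N) + (4 * lg + 2 / ?N + 3))" by (simp add: algebra_simps)
    also have "\<dots> \<le> ?c * (I + 2 * lw + 400 * kap T * lg)"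
    proof (rule mult_left_mono)
      have half: "2 / ?N \<le> 1 / 2" using N4 by (simp add: divide_simps)
      \<comment> \<open>The main term I must keep coefficient 1. Since I \<le> n lg and 2n \<le> N,
        the perturbation costs at most lg. All other terms of R may be multiplied by 3/2; 236 is 8 +
        228.\<close>
      have "I * (2 / ?N) \<le> (real n * lg) * (2 / ?N)" using I_le N4 by (intro mult_right_mono) auto
      also have "\<dots> \<le> lg"
      proof -
        have "2 * real n \<le> ?N" by (simp add: power2_eq_square algebra_simps)
        then have "real n * (2 / ?N) \<le> 1" using N4 by (simp add: divide_simps)
        then have "(real n * (2 / ?N)) * lg \<le> 1 * lg" using lg_ge1 by (intro mult_right_mono) auto
        then show ?thesis by (simp add: algebra_simps)
      qed
      finally have 1: "I * (2 / ?N) \<le> lg" .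
      have "(lw + 2 + 236 * (kap T * lg)) * (2 / ?N) \<le> (lw + 2 + 236 * (kap T * lg)) * (1 / 2)"
        using half lw0 kl lg_ge1 by (intro mult_left_mono) auto
      then have 2: "(lw + 2 + 236 * (kap T * lg)) * (2 / ?N) \<le> lw / 2 + 1 + 118 * (kap T * lg)" by (simp add: algebra_simps)
      have R: "R = I + (lw + 2 + 236 * (kap T * lg))" by (simp add: R_def Q_def)
      have "R * (1 + 2 / ?N) = R + I * (2 / ?N) + (lw + 2 + 236 * (kap T * lg)) * (2 / ?N)"
        unfolding R by (simp only: distrib_left distrib_right mult_1_right)
      then have 3: "R * (1 + 2 / ?N) = R + I * (2 / ?N) + (lw + 2 + 236 * (kap T * lg)) * (2 / ?N)" .
      define X where "X = kap T * lg"
      define v where "v = 2 / ?N"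
      define Z where "Z = R * (1 + 2 / ?N)"
      have "Z \<le> R + lg + (lw / 2 + 1 + 118 * X)"
        using 1 2 3 unfolding Z_def[symmetric] X_def[symmetric] by linarith
      moreover have "R = I + (lw + 2 + 236 * X)" using R unfolding X_def .
      moreover have "v \<le> 1 / 2" using half unfolding v_def .
      moreover have "X \<ge> lg" using kl unfolding X_def .
      ultimately have "Z + (4 * lg + v + 3) \<le> I + 2 * lw + 400 * X" using lw0 lg_ge1 by linarith
      then show "R * (1 + 2 / ?N) + (4 * lg + 2 / ?N + 3) \<le> I + 2 * lw + 400 * kap T * lg"
        unfolding Z_def v_def X_def by (simp only: mult.assoc)
    qed (use c1 in linarith)
    finally show "(\<Sum>x\<in>typecls T. real (length (enc (q x)))) \<le>
       ?c * (log 2 (?c / real (max_ball T)) + 2 * log 2 (1 / w T) + 400 * kap T * lg)" by (simp only: I_def lw_def)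
  qed
  qed
qed

end

section \<open>Exchangeable sources and the entropy bound\<close>

lemma pmf_replicate_pmf:
  "length xs = n \<Longrightarrow> pmf (replicate_pmf n p) xs = prod_list (map (pmf p) xs)"
proof (induction n arbitrary: xs)
  case (Suc n)
  then obtain y ys where xs: "xs = y # ys" "length ys = n" by (auto simp: length_Suc_conv)
  have "replicate_pmf (Suc n) p = map_pmf (\<lambda>(x, xs). x # xs) (pair_pmf p (replicate_pmf n p))"
    by (simp add: pair_pmf_def map_bind_pmf map_return_pmf bind_assoc_pmf bind_return_pmf)
  moreover have "pmf (map_pmf (\<lambda>(x, xs). x # xs) (pair_pmf p (replicate_pmf n p))) ((\<lambda>(x, xs). x # xs) (y, ys)) =
      pmf (pair_pmf p (replicate_pmf n p)) (y, ys)"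
    by (rule pmf_map_inj') (auto simp: inj_def)
  ultimately show ?case using Suc.IH[OF xs(2)] by (simp add: xs pmf_pair)
qed simp

lemma pmf_replicate_pmf_mset_cong:
  assumes "mset x = mset y"
  shows "pmf (replicate_pmf n p) x = pmf (replicate_pmf n p) y"
proof (cases "length x = n")
  case True
  have l: "length y = n" using True assms mset_eq_length by metis
  have "prod_mset (image_mset (pmf p) (mset x)) = prod_mset (image_mset (pmf p) (mset y))" using assms by simp
  then show ?thesis using True l by (simp add: pmf_replicate_pmf prod_mset_prod_list[symmetric] mset_map[symmetric] del: mset_map)
next
  case False
  then have "length y \<noteq> n" using assms mset_eq_length by metis
  then have "x \<notin> set_pmf (replicate_pmf n p)" "y \<notin> set_pmf (replicate_pmf n p)" using False by (auto simp: set_replicate_pmf)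
  then show ?thesis by (simp add: set_pmf_iff)
qed

lemma nn_integral_sum_list_replicate_pmf:
  fixes \<phi> :: "'a \<Rightarrow> ennreal"
  shows "(\<integral>\<^sup>+xs. sum_list (map \<phi> xs) \<partial>replicate_pmf n p) = of_nat n * (\<integral>\<^sup>+x. \<phi> x \<partial>p)"
proof (induction n)
  case (Suc n)
  have "(\<integral>\<^sup>+xs. sum_list (map \<phi> xs) \<partial>replicate_pmf (Suc n) p) =
      (\<integral>\<^sup>+x. (\<integral>\<^sup>+xs. \<phi> x + sum_list (map \<phi> xs) \<partial>replicate_pmf n p) \<partial>p)"
    by (simp add: nn_integral_return)
  also have "\<dots> = (\<integral>\<^sup>+x. \<phi> x + of_nat n * (\<integral>\<^sup>+x. \<phi> x \<partial>p) \<partial>p)"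
    by (simp add: nn_integral_add Suc.IH measure_pmf.emeasure_space_1)
  also have "\<dots> = of_nat (Suc n) * (\<integral>\<^sup>+x. \<phi> x \<partial>p)"
    by (simp add: nn_integral_add measure_pmf.emeasure_space_1 distrib_right)
  finally show ?case .
qed simp

lemma nn_integral_count_space_le:
  fixes f :: "'a \<Rightarrow> ennreal"
  assumes A: "countable A" and c: "\<And>F. finite F \<Longrightarrow> F \<subseteq> A \<Longrightarrow> sum f F \<le> c"
  shows "(\<integral>\<^sup>+x. f x \<partial>count_space A) \<le> c"
proof (cases "finite A")
  case True then show ?thesis using c[of A] by (simp add: nn_integral_count_space_finite)
next
  case False
  have bij: "bij_betw (from_nat_into A) UNIV A" by (rule bij_betw_from_nat_into[OF A False])
  have "(\<integral>\<^sup>+x. f x \<partial>count_space A) = (\<integral>\<^sup>+i. f (from_nat_into A i) \<partial>count_space UNIV)"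
    by (rule nn_integral_bij_count_space[OF bij, symmetric])
  also have "\<dots> = (\<Sum>i. f (from_nat_into A i))" by (rule nn_integral_count_space_nat)
  also have "\<dots> = (SUP k. \<Sum>i<k. f (from_nat_into A i))" by (rule suminf_eq_SUP)
  also have "\<dots> \<le> c"
  proof (rule SUP_least)
    fix k
    have inj: "inj_on (from_nat_into A) {..<k}" using bij by (meson bij_betw_def inj_on_subset subset_UNIV)
    have "(\<Sum>i<k. f (from_nat_into A i)) = sum f (from_nat_into A ` {..<k})"
      by (simp add: sum.reindex[OF inj])
    also have "\<dots> \<le> c" using bij by (intro c) (auto simp: bij_betw_def)
    finally show "(\<Sum>i<k. f (from_nat_into A i)) \<le> c" .
  qed
  finally show ?thesis .
qed

text \<open>An exchangeable source is uniform on every type class.\<close>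

lemma nn_integral_type_average:
  fixes P :: "nat list pmf" and F :: "nat list \<Rightarrow> ennreal"
  assumes inv: "\<And>x y. mset x = mset y \<Longrightarrow> pmf P x = pmf P y"
  shows "(\<integral>\<^sup>+x. F x \<partial>P) = (\<integral>\<^sup>+x. sum F (typecls (mset x)) / of_nat (card (typecls (mset x))) \<partial>P)"
proof -
  have "P = bind_pmf P (\<lambda>x. pmf_of_set (typecls (mset x)))"
  proof (rule pmf_eqI)
    fix y
    let ?K = "typecls (mset y)"
    have c: "real (card ?K) > 0" using card_typecls_pos by simp
    have "pmf (pmf_of_set (typecls (mset x))) y = indicator ?K x / real (card ?K)" for x
    proof -
      have "pmf (pmf_of_set (typecls (mset x))) y = indicator (typecls (mset x)) y / real (card (typecls (mset x)))"
        by (rule pmf_of_set[OF typecls_nonempty finite_typecls])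
      also have "\<dots> = indicator ?K x / real (card ?K)"
        by (cases "mset x = mset y") (simp_all add: indicator_def typecls_def)
      finally show ?thesis .
    qed
    then have "pmf (bind_pmf P (\<lambda>x. pmf_of_set (typecls (mset x)))) y = (\<integral>x. indicator ?K x / real (card ?K) \<partial>P)"
      by (simp add: pmf_bind)
    also have "\<dots> = measure P ?K / real (card ?K)" by simp
    also have "measure P ?K = (\<Sum>x\<in>?K. pmf P x)" by (rule measure_measure_pmf_finite) simp
    also have "\<dots> = (\<Sum>x\<in>?K. pmf P y)" by (intro sum.cong inv) (auto simp: typecls_def)
    also have "\<dots> / real (card ?K) = pmf P y" by (simp add: typecls_nonempty)
    finally show "pmf P y = pmf (bind_pmf P (\<lambda>x. pmf_of_set (typecls (mset x)))) y" by simp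
  qed
  then have "(\<integral>\<^sup>+x. F x \<partial>P) = (\<integral>\<^sup>+x. F x \<partial>bind_pmf P (\<lambda>x. pmf_of_set (typecls (mset x))))" by simp
  also have "\<dots> = (\<integral>\<^sup>+x. (\<integral>\<^sup>+y. F y \<partial>pmf_of_set (typecls (mset x))) \<partial>P)" by simp
  also have "\<dots> = (\<integral>\<^sup>+x. sum F (typecls (mset x)) / of_nat (card (typecls (mset x))) \<partial>P)"
    by (intro nn_integral_cong) (simp add: nn_integral_pmf_of_set typecls_nonempty ennreal_of_nat_eq_real_of_nat)
  finally show ?thesis .
qed

section \<open>The common term of the code and of the converse\<close>

context distortion_block
begin

definition base_rate :: "nat multiset \<Rightarrow> real" where
  "base_rate T = log 2 (real (card (typecls T)) / real (max_ball T))"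

lemma base_rate_nonneg: "T \<in> word_types n \<Longrightarrow> base_rate T \<ge> 0"
  using max_ball_pos[of T] max_ball_le[of T] by (simp add: base_rate_def)

text \<open>Crude, but it makes the expected base rate finite, so that it cancels in a difference of
  extended reals.\<close>

lemma base_rate_le: "T \<in> word_types n \<Longrightarrow> base_rate T \<le> real n * real n"
proof -
  assume T: "T \<in> word_types n"
  have M: "real (max_ball T) \<ge> 1" using max_ball_pos[OF T] by linarith
  have c: "real (card (typecls T)) > 0" using card_typecls_pos by simp
  have "real (card (typecls T)) / real (max_ball T) \<le> real (card (typecls T)) / 1"
    using M by (intro divide_left_mono) auto
  also have "\<dots> \<le> real (n ^ n)" using card_typecls_le[OF T] by simp
  finally have "base_rate T \<le> log 2 (real (n ^ n))"
    unfolding base_rate_def using M c n1 by (subst log_le_cancel_iff) (auto intro!: divide_pos_pos)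
  also have "\<dots> = real n * log 2 (real n)" using n1 by (simp add: log_nat_power)
  also have "\<dots> \<le> real n * real n" using n1 by (intro mult_left_mono log2_le_self) auto
  finally show ?thesis .
qed

text \<open>Entropy dominates conditional entropy given the type; the conditional entropy is bounded
  through the largest cell, which is contained in a distortion ball.\<close>

lemma partition_entropy_lower:
  fixes P :: "nat list pmf"
  assumes supp: "set_pmf P \<subseteq> words n" and inv: "\<And>x y. mset x = mset y \<Longrightarrow> pmf P x = pmf P y"
    and \<pi>: "\<pi> \<in> distortion_partitions \<rho> n d"
  shows "enn2ereal (\<integral>\<^sup>+x. ennreal (base_rate (mset x)) \<partial>P) \<le> partition_entropy \<pi> P"
proof -
  have part: "partition_on (words n) \<pi>" and centre: "\<And>A. A \<in> \<pi> \<Longrightarrow> \<exists>ys\<in>A. (SUP xs\<in>A. ereal (block_distortion \<rho> n xs ys)) \<le> ereal d"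
    using \<pi> by (auto simp: distortion_partitions_def)
  define cell where "cell x = (SOME A. A \<in> \<pi> \<and> x \<in> A)" for x
  have cell: "cell x \<in> \<pi> \<and> x \<in> cell x" if "x \<in> words n" for x
  proof -
    have "\<exists>A. A \<in> \<pi> \<and> x \<in> A" using partition_onD1[OF part] that by auto
    then show ?thesis unfolding cell_def by (rule someI_ex)
  qed
  have disj: "A = B" if "A \<in> \<pi>" "B \<in> \<pi>" "x \<in> A" "x \<in> B" for A B x
    using partition_onD2[OF part] that by (auto simp: disjoint_def)
  have cell_eq: "cell x = A" if "A \<in> \<pi>" "x \<in> A" for A x
  proof -
    have "x \<in> words n" using that partition_onD1[OF part] by auto
    then show ?thesis using disj[of "cell x" A x] cell[of x] that by blast
  qed
  let ?p = "\<lambda>x. measure_pmf.prob P (cell x)"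
  \<comment> \<open>Conditional probability, given the type of x, of the cell containing x.\<close>
  define q where "q x = real (card (typecls (mset x) \<inter> cell x)) / real (card (typecls (mset x)))" for x
  have cpos: "real (card (typecls T)) > 0" for T using card_typecls_pos by simp
  have facts: "?p x > 0" "q x > 0" "base_rate (mset x) \<le> log 2 (1 / q x)" "x \<in> words n" if x: "x \<in> set_pmf P" for x
  proof -
    show xw: "x \<in> words n" using x supp by auto
    have T: "mset x \<in> word_types n" by (rule mset_word_types[OF xw])
    have "0 < pmf P x" using x by (simp add: pmf_positive_iff)
    also have "\<dots> = measure P {x}" by (simp add: pmf.rep_eq)
    also have "\<dots> \<le> ?p x" using cell[OF xw] by (intro measure_pmf.finite_measure_mono) auto
    finally show "?p x > 0" .
    have "x \<in> typecls (mset x) \<inter> cell x" using cell[OF xw] by (auto simp: typecls_def)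
    then have k0: "card (typecls (mset x) \<inter> cell x) > 0" by (auto simp: card_gt_0_iff)
    then show "q x > 0" using cpos[of "mset x"] by (simp add: q_def)
    obtain ys where ys: "ys \<in> cell x" "(SUP xs\<in>cell x. ereal (block_distortion \<rho> n xs ys)) \<le> ereal d"
      using centre cell[OF xw] by blast
    have "close z ys" if "z \<in> cell x" for z
      using ys(2) that by (auto simp: SUP_le_iff close_def)
    then have "typecls (mset x) \<inter> cell x \<subseteq> {z \<in> typecls (mset x). close z ys}" by auto
    then have "card (typecls (mset x) \<inter> cell x) \<le> card {z \<in> typecls (mset x). close z ys}"
      by (rule card_mono[rotated]) simp
    also have "\<dots> \<le> max_ball (mset x)"
      using ys(1) cell[OF xw] partition_onD1[OF part] by (intro card_ball_le_max_ball) auto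
    finally have le: "real (card (typecls (mset x) \<inter> cell x)) \<le> real (max_ball (mset x))" by simp
    have "real (card (typecls (mset x))) / real (max_ball (mset x)) \<le>
        real (card (typecls (mset x))) / real (card (typecls (mset x) \<inter> cell x))"
      using le k0 by (intro divide_left_mono) auto
    also have "\<dots> = 1 / q x" by (simp add: q_def)
    finally show "base_rate (mset x) \<le> log 2 (1 / q x)"
      unfolding base_rate_def using cpos[of "mset x"] max_ball_pos[OF T] \<open>q x > 0\<close>
      by (subst log_le_cancel_iff) (auto intro!: divide_pos_pos)
  qed
  define c where "c = 1 / ln (2::real)"
  have c0: "c > 0" by (simp add: c_def)
  \<comment> \<open>Pointwise form of the nonnegativity of relative entropy, from ln t \<le> t - 1.
    The constant c = 1 / ln 2 is added on the left instead of subtracted on the right, because the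
    integrals take values in [0, \<infinity>]; being finite, it can be cancelled afterwards.\<close>
  have point: "ennreal (base_rate (mset x)) + ennreal c \<le> ennreal (log 2 (1 / ?p x)) + ennreal (c * (?p x / q x))"
    if x: "x \<in> set_pmf P" for x
  proof -
    note f = facts[OF x]
    have T: "mset x \<in> word_types n" by (rule mset_word_types[OF f(4)])
    have "ln (?p x / q x) \<le> ?p x / q x - 1" using f(1,2) by (intro ln_le_minus_one) auto
    then have "c * ln (?p x / q x) \<le> c * (?p x / q x - 1)" using c0 by (intro mult_left_mono) auto
    moreover have "c * ln (?p x / q x) = log 2 (1 / q x) - log 2 (1 / ?p x)"
      using f(1,2) by (simp add: c_def log_def ln_div diff_divide_distrib)
    ultimately have "base_rate (mset x) + c \<le> log 2 (1 / ?p x) + c * (?p x / q x)"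
      using f(3) by (simp add: algebra_simps)
    then have "ennreal (base_rate (mset x) + c) \<le> ennreal (log 2 (1 / ?p x) + c * (?p x / q x))" by (rule ennreal_leI)
    moreover have "log 2 (1 / ?p x) \<ge> 0" using f(1) by simp
    ultimately show ?thesis
      using base_rate_nonneg[OF T] c0 f(1,2) by (simp add: ennreal_plus[symmetric] del: ennreal_plus)
  qed
  have "(\<integral>\<^sup>+x. ennreal (base_rate (mset x)) \<partial>P) + ennreal c = (\<integral>\<^sup>+x. ennreal (base_rate (mset x)) + ennreal c \<partial>P)"
    by (simp add: nn_integral_add measure_pmf.emeasure_space_1)
  also have "\<dots> \<le> (\<integral>\<^sup>+x. ennreal (log 2 (1 / ?p x)) + ennreal (c * (?p x / q x)) \<partial>P)"
    by (intro nn_integral_mono_AE) (use point in \<open>auto simp: AE_measure_pmf_iff\<close>)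
  also have "\<dots> = (\<integral>\<^sup>+x. ennreal (log 2 (1 / ?p x)) \<partial>P) + (\<integral>\<^sup>+x. ennreal (c * (?p x / q x)) \<partial>P)"
    by (rule nn_integral_add) auto
  also have "(\<integral>\<^sup>+x. ennreal (c * (?p x / q x)) \<partial>P) \<le> ennreal c"
  proof -
    have avg: "sum (\<lambda>x. ennreal (c * (?p x / q x))) (typecls (mset x)) / of_nat (card (typecls (mset x))) \<le> ennreal c"
      if x: "x \<in> set_pmf P" for x
    proof -
      let ?K = "typecls (mset x)"
      have xw: "x \<in> words n" using x supp by auto
      have Kw: "?K \<subseteq> words n" using typecls_words[OF mset_word_types[OF xw]] .
      \<comment> \<open>Grouping the class by cells: a cell A that meets K contributes its
        probability exactly once, and the cells are disjoint. So the average of p / q over every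
        type class is at most 1.\<close>
      have "sum (\<lambda>y. ?p y / real (card (?K \<inter> cell y))) ?K =
          (\<Sum>A\<in>cell ` ?K. \<Sum>y\<in>{y \<in> ?K. cell y = A}. ?p y / real (card (?K \<inter> cell y)))"
        by (rule sum.image_gen) simp
      also have "\<dots> = (\<Sum>A\<in>cell ` ?K. measure_pmf.prob P A)"
      proof (rule sum.cong)
        fix A assume "A \<in> cell ` ?K"
        then obtain z where z: "z \<in> ?K" "A = cell z" by auto
        have A: "A \<in> \<pi>" "z \<in> A" using cell z Kw by auto
        have e: "{y \<in> ?K. cell y = A} = ?K \<inter> A" using cell_eq[OF A(1)] cell Kw by auto
        have "(\<Sum>y\<in>{y \<in> ?K. cell y = A}. ?p y / real (card (?K \<inter> cell y))) =
           (\<Sum>y\<in>{y \<in> ?K. cell y = A}. measure_pmf.prob P A / real (card (?K \<inter> A)))" by (rule sum.cong) auto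
        also have "\<dots> = measure_pmf.prob P A" using z A unfolding e by (auto simp: card_gt_0_iff)
        finally show "(\<Sum>y\<in>{y \<in> ?K. cell y = A}. ?p y / real (card (?K \<inter> cell y))) = measure_pmf.prob P A" .
      qed simp
      also have "\<dots> = measure_pmf.prob P (\<Union>A\<in>cell ` ?K. A)"
      proof (rule measure_pmf.finite_measure_finite_Union[symmetric])
        have "cell ` ?K \<subseteq> \<pi>" using cell Kw by auto
        then show "disjoint_family_on (\<lambda>A. A) (cell ` ?K)"
          unfolding disjoint_family_on_def using disj by (metis (no_types, opaque_lifting) disjoint_iff subsetD)
      qed auto
      also have "\<dots> \<le> 1" by simp
      finally have s1: "sum (\<lambda>y. ?p y / real (card (?K \<inter> cell y))) ?K \<le> 1" .
      have qy: "q y = real (card (?K \<inter> cell y)) / real (card ?K)" if "y \<in> ?K" for y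
        using that by (simp add: q_def typecls_def)
      have "sum (\<lambda>y. c * (?p y / q y)) ?K = sum (\<lambda>y. c * real (card ?K) * (?p y / real (card (?K \<inter> cell y)))) ?K"
        by (rule sum.cong) (auto simp: qy)
      also have "\<dots> = c * real (card ?K) * sum (\<lambda>y. ?p y / real (card (?K \<inter> cell y))) ?K"
        by (simp add: sum_distrib_left)
      also have "\<dots> \<le> c * real (card ?K) * 1" using s1 c0 by (intro mult_left_mono) auto
      finally have s2: "sum (\<lambda>y. c * (?p y / q y)) ?K \<le> c * real (card ?K)" by simp
      have q0: "q y \<ge> 0" for y by (simp add: q_def)
      have "sum (\<lambda>y. ennreal (c * (?p y / q y))) ?K = ennreal (sum (\<lambda>y. c * (?p y / q y)) ?K)"
        using c0 q0 by (intro sum_ennreal) auto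
      also have "\<dots> / of_nat (card ?K) = ennreal (sum (\<lambda>y. c * (?p y / q y)) ?K / real (card ?K))"
        unfolding ennreal_of_nat_eq_real_of_nat using c0 q0 cpos[of "mset x"] by (intro divide_ennreal sum_nonneg) auto
      also have "\<dots> \<le> ennreal c" using s2 cpos[of "mset x"] by (intro ennreal_leI) (simp add: divide_simps)
      finally show ?thesis .
    qed
    have "(\<integral>\<^sup>+x. ennreal (c * (?p x / q x)) \<partial>P) =
        (\<integral>\<^sup>+x. sum (\<lambda>x. ennreal (c * (?p x / q x))) (typecls (mset x)) / of_nat (card (typecls (mset x))) \<partial>P)"
      by (rule nn_integral_type_average) (rule inv)
    also have "\<dots> \<le> (\<integral>\<^sup>+x. ennreal c \<partial>P)"
      by (rule nn_integral_mono_AE, unfold AE_measure_pmf_iff, rule ballI, rule avg)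
    finally have "(\<integral>\<^sup>+x. ennreal (c * (?p x / q x)) \<partial>P) \<le> (\<integral>\<^sup>+x. ennreal c \<partial>P)" .
    then show ?thesis by (simp add: measure_pmf.emeasure_space_1)
  qed
  finally have "(\<integral>\<^sup>+x. ennreal (base_rate (mset x)) \<partial>P) + ennreal c \<le> (\<integral>\<^sup>+x. ennreal (log 2 (1 / ?p x)) \<partial>P) + ennreal c"
    by (simp add: add_left_mono)
  then have main: "(\<integral>\<^sup>+x. ennreal (base_rate (mset x)) \<partial>P) \<le> (\<integral>\<^sup>+x. ennreal (log 2 (1 / ?p x)) \<partial>P)"
    by (simp add: add.commute[of _ "ennreal c"] ennreal_add_left_cancel_le)
  let ?\<eta> = "\<lambda>A. - (measure_pmf.prob P A * log 2 (measure_pmf.prob P A))"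
  have \<eta>0: "?\<eta> A \<ge> 0" for A
    by (simp add: mult_nonneg_nonpos log_le_zero_cancel_iff zero_less_measure_iff)
       (cases "measure_pmf.prob P A = 0"; auto simp: mult_nonneg_nonpos zero_less_measure_iff)
  have "(\<integral>\<^sup>+x. ennreal (log 2 (1 / ?p x)) \<partial>P) = (\<integral>\<^sup>+A. ennreal (log 2 (1 / measure_pmf.prob P A)) \<partial>map_pmf cell P)"
    by simp
  also have "\<dots> = (\<integral>\<^sup>+A. ennreal (pmf (map_pmf cell P) A) * ennreal (log 2 (1 / measure_pmf.prob P A)) \<partial>count_space UNIV)"
    by (rule nn_integral_measure_pmf)
  also have "\<dots> \<le> (\<integral>\<^sup>+A. ennreal (?\<eta> A) * indicator \<pi> A \<partial>count_space UNIV)"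
  proof (rule nn_integral_mono)
    fix A
    show "ennreal (pmf (map_pmf cell P) A) * ennreal (log 2 (1 / measure_pmf.prob P A)) \<le> ennreal (?\<eta> A) * indicator \<pi> A"
    proof (cases "A \<in> set_pmf (map_pmf cell P)")
      case False
      then have "pmf (map_pmf cell P) A = 0" by (simp only: set_pmf_iff not_not)
      then show ?thesis by simp
    next
      case True
      then obtain x where x: "x \<in> set_pmf P" "A = cell x" by auto
      have A: "A \<in> \<pi>" using cell facts(4)[OF x(1)] x(2) by auto
      have p0: "measure_pmf.prob P A > 0" using facts(1)[OF x(1)] x(2) by simp
      have "pmf (map_pmf cell P) A = measure P (cell -` {A})" by (rule pmf_map)
      \<comment> \<open>Outside the words of length n the value of \<open>cell\<close> is arbitrary,
        so the preimage of A is first intersected with the support of P.\<close>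
      also have "\<dots> \<le> measure P A"
      proof -
        have "measure P (cell -` {A}) = measure P (cell -` {A} \<inter> set_pmf P)" by (rule measure_Int_set_pmf[symmetric])
        also have "\<dots> \<le> measure P A" using cell facts(4) by (intro measure_pmf.finite_measure_mono) auto
        finally show ?thesis .
      qed
      finally have "pmf (map_pmf cell P) A * log 2 (1 / measure_pmf.prob P A) \<le> measure_pmf.prob P A * log 2 (1 / measure_pmf.prob P A)"
        using p0 by (intro mult_right_mono) auto
      also have "\<dots> = ?\<eta> A" using p0 by (simp add: log_divide)
      finally have "ennreal (pmf (map_pmf cell P) A * log 2 (1 / measure_pmf.prob P A)) \<le> ennreal (?\<eta> A)" by (rule ennreal_leI)
      then show ?thesis using A by (simp add: ennreal_mult')
    qed
  qed
  also have "\<dots> = (\<integral>\<^sup>+A. ennreal (?\<eta> A) \<partial>count_space \<pi>)"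
    by (simp add: nn_integral_count_space_indicator[symmetric])
  also have "\<dots> \<le> e2ennreal (partition_entropy \<pi> P)"
  proof (rule nn_integral_count_space_le)
    have "cell ` words n = \<pi>"
    proof
      show "cell ` words n \<subseteq> \<pi>" using cell by auto
      show "\<pi> \<subseteq> cell ` words n"
      proof
        fix A assume A: "A \<in> \<pi>"
        then obtain x where x: "x \<in> A" using partition_onD3[OF part] by fastforce
        then have "x \<in> words n" using A partition_onD1[OF part] by auto
        then show "A \<in> cell ` words n" using cell_eq[OF A x] by blast
      qed
    qed
    then show "countable \<pi>" by (metis countable_image uncountable_def countableI_type)
    fix F assume F: "finite F" "F \<subseteq> \<pi>"
    have "ereal (sum ?\<eta> F) = (\<Sum>A\<in>F. ereal (?\<eta> A))" by simp
    also have "\<dots> \<le> partition_entropy \<pi> P"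
      unfolding partition_entropy_def by (subst nonneg_infsum_complete) (use F \<eta>0 in \<open>auto intro!: SUP_upper\<close>)
    finally have "e2ennreal (ereal (sum ?\<eta> F)) \<le> e2ennreal (partition_entropy \<pi> P)" by (rule e2ennreal_mono)
    moreover have "e2ennreal (ereal (sum ?\<eta> F)) = (\<Sum>A\<in>F. ennreal (?\<eta> A))"
      using \<eta>0 by (simp only: e2ennreal_ereal sum_ennreal)
    ultimately show "(\<Sum>A\<in>F. ennreal (?\<eta> A)) \<le> e2ennreal (partition_entropy \<pi> P)" by simp
  qed
  finally have "(\<integral>\<^sup>+x. ennreal (base_rate (mset x)) \<partial>P) \<le> e2ennreal (partition_entropy \<pi> P)"
    using main by (rule order_trans[rotated])
  moreover have "partition_entropy \<pi> P \<ge> 0" unfolding partition_entropy_def using \<eta>0 by (intro infsum_nonneg) auto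
  ultimately show ?thesis by (metis enn2ereal_e2ennreal less_eq_ennreal.rep_eq)
qed

end

section \<open>The rate for product sources\<close>

definition clip :: "nat \<Rightarrow> nat \<Rightarrow> nat" where
  "clip U a = (if a > U then a else 0)"

definition escape_pmf :: "nat \<Rightarrow> nat pmf \<Rightarrow> nat pmf" where
  "escape_pmf n g = bind_pmf (bernoulli_pmf (1 / (real n + 1))) (\<lambda>b. if b then g else return_pmf 0)"

text \<open>Weight of a type: uniform on the counts of the letters up to U, times the probability of
  the remaining letters under a source that emits a letter of g with probability
  1/(n+1) only and otherwise the symbol 0, which stands for any letter up to U.\<close>

definition type_weight :: "nat \<Rightarrow> nat \<Rightarrow> nat pmf \<Rightarrow> nat multiset \<Rightarrow> real" where
  "type_weight n U g T =
     pmf (replicate_pmf n (escape_pmf n g)) (map (clip U) (sorted_list_of_multiset T)) / (real n + 1) ^ U"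

lemma pmf_escape_pmf:
  "pmf (escape_pmf n g) a = pmf g a / (real n + 1) + indicator {0} a * (real n / (real n + 1))"
proof -
  have "1 - 1 / (real n + 1) = real n / (real n + 1)" by (simp add: field_simps)
  then show ?thesis by (auto simp add: escape_pmf_def pmf_bind indicator_def field_simps)
qed

lemma escape_pmf_pos:
  assumes n: "n \<ge> 1" and g: "\<And>a. a \<in> alphabet \<Longrightarrow> pmf g a > 0" and a: "a \<in> alphabet"
  shows "pmf (escape_pmf n g) (clip U a) > 0"
proof (cases "a > U")
  case True
  then show ?thesis using g[OF a] by (auto simp: clip_def pmf_escape_pmf intro!: add_pos_nonneg divide_pos_pos)
next
  case False
  then show ?thesis using n by (auto simp: clip_def pmf_escape_pmf intro!: add_nonneg_pos divide_pos_pos)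
qed

text \<open>The escape probability 1 / (n + 1) balances two costs: a letter up to U costs log (1 +
  1/n) \<le> 2/n, hence at most 2 bits in the whole block, and a letter above U pays an extra log (n
  + 1), which is affordable when at most one such letter is expected.\<close>

lemma log_inverse_escape_pmf_le:
  assumes n: "n \<ge> 1" and g: "\<And>a. a \<in> alphabet \<Longrightarrow> pmf g a > 0" and a: "a \<in> alphabet"
  shows "log 2 (1 / pmf (escape_pmf n g) (clip U a)) \<le>
     (if a > U then log 2 (real n + 1) + log 2 (1 / pmf g a) else 0) + 2 / real n"
proof (cases "a > U")
  case True
  have "pmf g a / (real n + 1) \<le> pmf (escape_pmf n g) (clip U a)" using True by (simp add: clip_def pmf_escape_pmf)
  moreover have p: "pmf g a / (real n + 1) > 0" using g[OF a] by simp
  ultimately have "1 / pmf (escape_pmf n g) (clip U a) \<le> 1 / (pmf g a / (real n + 1))"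
    using escape_pmf_pos[OF n g a, of U] by (intro divide_left_mono mult_pos_pos) auto
  then have "log 2 (1 / pmf (escape_pmf n g) (clip U a)) \<le> log 2 (1 / (pmf g a / (real n + 1)))"
    using escape_pmf_pos[OF n g a] p g[OF a] by (subst log_le_cancel_iff) auto
  also have "\<dots> = log 2 (real n + 1) + log 2 (1 / pmf g a)" using g[OF a] by (simp add: log_divide)
  finally have "log 2 (1 / pmf (escape_pmf n g) (clip U a)) \<le> log 2 (real n + 1) + log 2 (1 / pmf g a)" .
  moreover have "0 \<le> 2 / real n" by simp
  ultimately show ?thesis using True by (simp only: if_True)
next
  case False
  have "real n / (real n + 1) \<le> pmf (escape_pmf n g) (clip U a)" using False by (simp add: clip_def pmf_escape_pmf)
  moreover have p: "real n / (real n + 1) > 0" using n by simp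
  ultimately have "1 / pmf (escape_pmf n g) (clip U a) \<le> 1 / (real n / (real n + 1))"
    using escape_pmf_pos[OF n g a, of U] by (intro divide_left_mono mult_pos_pos) auto
  then have "log 2 (1 / pmf (escape_pmf n g) (clip U a)) \<le> log 2 (1 / (real n / (real n + 1)))"
    using escape_pmf_pos[OF n g a] p n by (subst log_le_cancel_iff) auto
  also have "1 / (real n / (real n + 1)) = 1 + 1 / real n" using n by (simp add: field_simps)
  also have "log 2 (1 + 1 / real n) \<le> 2 / real n"
  proof -
    have "ln (1 + 1 / real n) \<le> 1 / real n" by (rule ln_add_one_self_le_self) simp
    then have "ln (1 + 1 / real n) / ln 2 \<le> (1 / real n) / (1/2)" using ln_2_ge_half by (intro frac_le) auto
    then show ?thesis by (simp add: log_def)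
  qed
  finally show ?thesis using False by simp
qed

lemma prod_list_pos: "(\<And>y. y \<in> set ys \<Longrightarrow> y > 0) \<Longrightarrow> prod_list ys > (0::real)"
  by (induction ys) auto

lemma log_inverse_prod_list:
  "(\<And>y. y \<in> set ys \<Longrightarrow> y > (0::real)) \<Longrightarrow> log 2 (1 / prod_list ys) = sum_list (map (\<lambda>y. log 2 (1 / y)) ys)"
proof (induction ys)
  case (Cons y ys)
  have p: "prod_list ys > 0" using Cons.prems by (intro prod_list_pos) auto
  have y: "y > 0" using Cons.prems by simp
  have "log 2 (1 / prod_list (y # ys)) = log 2 ((1 / y) * (1 / prod_list ys))" by simp
  also have "\<dots> = log 2 (1 / y) + log 2 (1 / prod_list ys)" using p y by (intro log_mult_pos) auto
  also have "log 2 (1 / prod_list ys) = sum_list (map (\<lambda>y. log 2 (1 / y)) ys)" using Cons by simp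
  finally show ?case by simp
qed simp

lemma sorted_list_word_type:
  assumes "T \<in> word_types n"
  shows "length (sorted_list_of_multiset T) = n" "set (sorted_list_of_multiset T) \<subseteq> alphabet"
  using assms by (simp_all add: word_types_def size_mset[symmetric] del: size_mset)

lemma type_weight_pos:
  assumes n: "n \<ge> 1" and g: "\<And>a. a \<in> alphabet \<Longrightarrow> pmf g a > 0" and T: "T \<in> word_types n"
  shows "type_weight n U g T > 0"
proof -
  have "prod_list (map (pmf (escape_pmf n g)) (map (clip U) (sorted_list_of_multiset T))) > 0"
    using sorted_list_word_type(2)[OF T] escape_pmf_pos[OF n g] by (intro prod_list_pos) auto
  then show ?thesis using sorted_list_word_type(1)[OF T] by (simp add: type_weight_def pmf_replicate_pmf)
qed

lemma log_inverse_type_weight_le: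
  assumes n: "n \<ge> 1" and g: "\<And>a. a \<in> alphabet \<Longrightarrow> pmf g a > 0" and T: "T \<in> word_types n" and x: "mset x = T"
  shows "log 2 (1 / type_weight n U g T) \<le> real U * log 2 (real n + 1) + 2 +
    sum_list (map (\<lambda>a. if a > U then log 2 (real n + 1) + log 2 (1 / pmf g a) else 0) x)"
proof -
  let ?s = "sorted_list_of_multiset T" and ?\<nu> = "pmf (escape_pmf n g)"
  let ?\<phi> = "\<lambda>a. if a > U then log 2 (real n + 1) + log 2 (1 / pmf g a) else 0"
  note s = sorted_list_word_type[OF T]
  have pos: "y > 0" if "y \<in> set (map ?\<nu> (map (clip U) ?s))" for y
    using that s(2) escape_pmf_pos[OF n g] by auto
  have "log 2 (1 / type_weight n U g T) = log 2 ((real n + 1) ^ U * (1 / prod_list (map ?\<nu> (map (clip U) ?s))))"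
    using s(1) by (simp add: type_weight_def pmf_replicate_pmf)
  also have "\<dots> = log 2 ((real n + 1) ^ U) + log 2 (1 / prod_list (map ?\<nu> (map (clip U) ?s)))"
    using prod_list_pos[of "map ?\<nu> (map (clip U) ?s)"] pos by (intro log_mult_pos) fastforce+
  also have "log 2 ((real n + 1) ^ U) = real U * log 2 (real n + 1)" by (rule log_nat_power) simp
  also have "log 2 (1 / prod_list (map ?\<nu> (map (clip U) ?s))) = sum_list (map (\<lambda>a. log 2 (1 / ?\<nu> (clip U a))) ?s)"
    using log_inverse_prod_list[of "map ?\<nu> (map (clip U) ?s)"] pos by (simp add: o_def)
  also have "\<dots> \<le> sum_list (map (\<lambda>a. ?\<phi> a + 2 / real n) ?s)"
    using s(2) by (intro sum_list_mono log_inverse_escape_pmf_le[OF n g]) auto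
  also have "\<dots> = sum_list (map ?\<phi> ?s) + 2" using s(1) n by (simp add: sum_list_addf sum_list_triv)
  also have "sum_list (map ?\<phi> ?s) = sum_list (map ?\<phi> x)"
  proof -
    have "sum_mset (image_mset ?\<phi> (mset ?s)) = sum_mset (image_mset ?\<phi> (mset x))" using x by simp
    then show ?thesis unfolding mset_map[symmetric] sum_mset_sum_list .
  qed
  finally show ?thesis by simp
qed

text \<open>A type is recovered from its counts up to U and its clipped sorted word. The weights are
  therefore part of a product of the uniform distribution on (n + 1)^U count vectors and the block
  distribution of the escape source. Each type claims only one arrangement of its letters.\<close>

lemma type_weight_sum:
  assumes F: "finite F" "F \<subseteq> word_types n"
  shows "sum (type_weight n U g) F \<le> 1"
proof -
  let ?z = "\<lambda>T. map (clip U) (sorted_list_of_multiset T)"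
  let ?\<Phi> = "\<lambda>T. (restrict (count T) {1..U}, ?z T)"
  let ?h = "\<lambda>(c :: nat \<Rightarrow> nat, z). pmf (replicate_pmf n (escape_pmf n g)) z / (real n + 1) ^ U"
  let ?X = "PiE {1..U} (\<lambda>_. {..n})"
  \<comment> \<open>Clipping sends letters up to U to 0, which is never above U, so the large
    letters can still be read off.\<close>
  have filt: "filter_mset (\<lambda>a. a > U) (image_mset (clip U) M) = filter_mset (\<lambda>a. a > U) M" for M
    by (induction M) (auto simp: clip_def)
  have inj: "inj_on ?\<Phi> F"
  proof (rule inj_onI, rule multiset_eqI)
    fix T T' a assume T: "T \<in> F" "T' \<in> F" and e: "?\<Phi> T = ?\<Phi> T'"
    have e1: "restrict (count T) {1..U} = restrict (count T') {1..U}" and e2: "?z T = ?z T'" using e by auto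
    have "mset (?z T) = mset (?z T')" using e2 by (rule arg_cong)
    then have "image_mset (clip U) T = image_mset (clip U) T'" by simp
    then have e3: "filter_mset (\<lambda>a. a > U) T = filter_mset (\<lambda>a. a > U) T'" using filt by metis
    consider "a = 0" | "a \<in> {1..U}" | "a > U" by fastforce
    then show "count T a = count T' a"
    proof cases
      case 1
      then have "a \<notin># T" "a \<notin># T'" using T F(2) by (auto simp: word_types_def alphabet_def)
      then show ?thesis by (simp add: not_in_iff)
    next
      case 2 then show ?thesis using fun_cong[OF e1, of a] by simp
    next
      case 3
      have "count (filter_mset (\<lambda>a. a > U) T) a = count (filter_mset (\<lambda>a. a > U) T') a" using e3 by simp
      then show ?thesis using 3 by simp
    qed
  qed
  have img: "?\<Phi> ` F \<subseteq> ?X \<times> ?z ` F"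
  proof
    fix w assume "w \<in> ?\<Phi> ` F"
    then obtain T where T: "T \<in> F" "w = ?\<Phi> T" by auto
    have "count T a \<le> n" for a using count_le_size[of T a] T(1) F(2) by (auto simp: word_types_def)
    then show "w \<in> ?X \<times> ?z ` F" using T by auto
  qed
  have "sum (type_weight n U g) F = sum ?h (?\<Phi> ` F)"
    unfolding sum.reindex[OF inj] by (simp add: type_weight_def o_def)
  also have "\<dots> \<le> sum ?h (?X \<times> ?z ` F)"
    using F(1) by (intro sum_mono2 img finite_cartesian_product finite_PiE finite_imageI) auto
  also have "\<dots> = (\<Sum>c\<in>?X. \<Sum>z\<in>?z ` F. pmf (replicate_pmf n (escape_pmf n g)) z / (real n + 1) ^ U)"
    by (rule sum.cartesian_product[symmetric])
  also have "\<dots> = real (card ?X) * ((\<Sum>z\<in>?z ` F. pmf (replicate_pmf n (escape_pmf n g)) z) / (real n + 1) ^ U)"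
    by (simp add: sum_divide_distrib)
  also have "(\<Sum>z\<in>?z ` F. pmf (replicate_pmf n (escape_pmf n g)) z) = measure (replicate_pmf n (escape_pmf n g)) (?z ` F)"
    using F(1) by (simp add: measure_measure_pmf_finite)
  also have "real (card ?X) = (real n + 1) ^ U" by (simp add: card_PiE add.commute)
  also have "(real n + 1) ^ U * (measure (replicate_pmf n (escape_pmf n g)) (?z ` F) / (real n + 1) ^ U) =
      measure (replicate_pmf n (escape_pmf n g)) (?z ` F)" by simp
  also have "\<dots> \<le> 1" by simp
  finally show ?thesis .
qed

context distortion_block
begin

lemma optimal_rate_lower:
  assumes supp: "set_pmf P \<subseteq> words n" and inv: "\<And>x y. mset x = mset y \<Longrightarrow> pmf P x = pmf P y"
  shows "ereal (1 / real n) * enn2ereal (\<integral>\<^sup>+x. ennreal (base_rate (mset x)) \<partial>P) \<le> optimal_rate \<rho> n d P"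
  unfolding optimal_rate_def
  by (intro INF_greatest ereal_mult_left_mono partition_entropy_lower[OF supp inv]) auto

text \<open>The code is chosen before the source: a source enters only through the expected number
  of its letters above U and through their expected code length under g, bounded by 1 and E.
  Uniformity over the envelope family rests on this order of quantifiers.\<close>

lemma universal_code_rate:
  fixes g :: "nat pmf"
  assumes g: "\<And>a. a \<in> alphabet \<Longrightarrow> pmf g a > 0"
  obtains \<xi> where "semifaithful_code \<rho> d n \<xi>"
    and "\<And>\<mu> E. set_pmf \<mu> \<subseteq> alphabet \<Longrightarrow> E \<ge> 0 \<Longrightarrow>
      of_nat n * (\<integral>\<^sup>+a. indicator {U<..} a \<partial>measure_pmf \<mu>) \<le> 1 \<Longrightarrow>
      of_nat n * (\<integral>\<^sup>+a. ennreal (if a > U then log 2 (1 / pmf g a) else 0) \<partial>measure_pmf \<mu>) \<le> ennreal E \<Longrightarrow>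
      code_rate n \<xi> (replicate_pmf n \<mu>) - optimal_rate \<rho> n d (replicate_pmf n \<mu>) \<le>
        ereal ((1 / real n) * (802 * (real U + 1) * lg + 4 + 2 * E))"
proof (rule exists_universal_code[of "type_weight n U g"])
  show "type_weight n U g T > 0" if "T \<in> word_types n" for T by (rule type_weight_pos[OF n1 g that])
  show "sum (type_weight n U g) F \<le> 1" if "finite F" "F \<subseteq> word_types n" for F by (rule type_weight_sum[OF that])
next
  fix q enc dec
  assume code: "semifaithful_code \<rho> d n (q, enc, dec)"
    and len: "\<And>T. T \<in> word_types n \<Longrightarrow> (\<Sum>x\<in>typecls T. real (length (enc (q x)))) \<le>
       real (card (typecls T)) * (log 2 (real (card (typecls T)) / real (max_ball T))
         + 2 * log 2 (1 / type_weight n U g T) + 400 * kap T * lg)"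
  show thesis
  proof (rule that[OF code])
    fix \<mu> E
    assume \<mu>: "set_pmf \<mu> \<subseteq> alphabet" and E: "E \<ge> 0"
      and b: "of_nat n * (\<integral>\<^sup>+a. indicator {U<..} a \<partial>measure_pmf \<mu>) \<le> 1"
      and e: "of_nat n * (\<integral>\<^sup>+a. ennreal (if a > U then log 2 (1 / pmf g a) else 0) \<partial>measure_pmf \<mu>) \<le> ennreal E"
    let ?P = "replicate_pmf n \<mu>"
    have supp: "set_pmf ?P \<subseteq> words n" using \<mu> by (auto simp: set_replicate_pmf words_def)
    have inv: "pmf ?P x = pmf ?P y" if "mset x = mset y" for x y by (rule pmf_replicate_pmf_mset_cong[OF that])
    let ?l = "\<lambda>a. log 2 (1 / pmf g a)"
    \<comment> \<open>A letter above U costs 2 (lg + log (1 / g)) for naming the type and 400 lg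
      through \<open>kap\<close>. The constant c below collects what does not depend on the large
      letters.\<close>
    define \<phi> where "\<phi> a = (if a > U then 402 * lg + 2 * ?l a else 0)" for a
    define c where "c = 4 + (402 * real U + 400) * lg"
    have lg0: "lg \<ge> 0" using lg_ge1 by simp
    have c0: "c \<ge> 0" using lg0 by (simp add: c_def)
    have l0: "?l a \<ge> 0" if "a \<in> alphabet" for a using g[OF that] by (simp add: pmf_le_1)
    have avg: "sum (\<lambda>y. of_nat (length (enc (q y)))) (typecls (mset x)) / of_nat (card (typecls (mset x))) \<le>
        ennreal (base_rate (mset x)) + (ennreal c + sum_list (map (\<lambda>a. ennreal (\<phi> a)) x))" if x: "x \<in> words n" for x
    proof -
      let ?T = "mset x" and ?K = "typecls (mset x)"
      have T: "?T \<in> word_types n" by (rule mset_word_types[OF x])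
      have cpos: "real (card ?K) > 0" using card_typecls_pos by simp
      have xa: "a \<in> alphabet" if "a \<in> set x" for a using x that by (auto simp: words_def)
      have bigx: "real (big ?T) = sum_list (map (\<lambda>a. if a > U then 1 else 0) x)"
        unfolding big_def by (induction x) auto
      have "2 * log 2 (1 / type_weight n U g ?T) + 400 * kap ?T * lg \<le>
          2 * (real U * lg + 2 + sum_list (map (\<lambda>a. if a > U then lg + ?l a else 0) x)) + 400 * kap ?T * lg"
        using log_inverse_type_weight_le[OF n1 g T refl, of U] unfolding lg_def by simp
      also have "\<dots> = c + (2 * sum_list (map (\<lambda>a. if a > U then lg + ?l a else 0) x) + 400 * lg * real (big ?T))"
        unfolding kap_def c_def by (simp add: algebra_simps)
      also have "2 * sum_list (map (\<lambda>a. if a > U then lg + ?l a else 0) x) + 400 * lg * real (big ?T) = sum_list (map \<phi> x)"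
        unfolding bigx sum_list_const_mult[symmetric] sum_list_addf[symmetric]
        by (intro arg_cong[of _ _ sum_list] map_cong refl) (auto simp: \<phi>_def)
      finally have w: "2 * log 2 (1 / type_weight n U g ?T) + 400 * kap ?T * lg \<le> c + sum_list (map \<phi> x)" .
      have "(\<Sum>y\<in>?K. real (length (enc (q y)))) \<le> real (card ?K) * (base_rate ?T + (c + sum_list (map \<phi> x)))"
      proof (rule order_trans[OF len[OF T]], rule mult_left_mono)
        show "log 2 (real (card ?K) / real (max_ball ?T)) + 2 * log 2 (1 / type_weight n U g ?T) + 400 * kap ?T * lg
          \<le> base_rate ?T + (c + sum_list (map \<phi> x))" using w unfolding base_rate_def by linarith
      qed simp
      then have s: "(\<Sum>y\<in>?K. real (length (enc (q y)))) / real (card ?K) \<le> base_rate ?T + (c + sum_list (map \<phi> x))"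
        using cpos by (simp add: divide_le_eq mult.commute)
      have \<phi>0: "\<phi> a \<ge> 0" if "a \<in> set x" for a using l0[OF xa[OF that]] lg0 by (simp add: \<phi>_def)
      have sl: "ennreal (sum_list (map \<phi> x)) = sum_list (map (\<lambda>a. ennreal (\<phi> a)) x)" and sl0: "sum_list (map \<phi> x) \<ge> 0"
        using \<phi>0 by (induction x) (auto simp: ennreal_plus[symmetric] simp del: ennreal_plus)
      have "sum (\<lambda>y. of_nat (length (enc (q y)))) ?K / of_nat (card ?K) =
          ennreal ((\<Sum>y\<in>?K. real (length (enc (q y)))) / real (card ?K))"
        unfolding ennreal_of_nat_eq_real_of_nat using cpos
        by (simp add: sum_ennreal divide_ennreal sum_nonneg)
      also have "\<dots> \<le> ennreal (base_rate ?T + (c + sum_list (map \<phi> x)))" by (rule ennreal_leI[OF s])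
      also have "\<dots> = ennreal (base_rate ?T) + (ennreal c + sum_list (map (\<lambda>a. ennreal (\<phi> a)) x))"
        using base_rate_nonneg[OF T] c0 sl0 by (simp add: ennreal_plus sl)
      finally show ?thesis .
    qed
    let ?B = "\<integral>\<^sup>+x. ennreal (base_rate (mset x)) \<partial>?P"
    have "(\<integral>\<^sup>+x. of_nat (length (enc (q x))) \<partial>?P) =
        (\<integral>\<^sup>+x. sum (\<lambda>x. of_nat (length (enc (q x)))) (typecls (mset x)) / of_nat (card (typecls (mset x))) \<partial>?P)"
      by (rule nn_integral_type_average) (rule inv)
    also have "\<dots> \<le> (\<integral>\<^sup>+x. ennreal (base_rate (mset x)) + (ennreal c + sum_list (map (\<lambda>a. ennreal (\<phi> a)) x)) \<partial>?P)"
      by (rule nn_integral_mono_AE, unfold AE_measure_pmf_iff, rule ballI, rule avg) (use supp in blast)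
    also have "\<dots> = ?B + (ennreal c + of_nat n * (\<integral>\<^sup>+a. ennreal (\<phi> a) \<partial>\<mu>))"
      by (simp add: nn_integral_add nn_integral_sum_list_replicate_pmf measure_pmf.emeasure_space_1)
    also have "of_nat n * (\<integral>\<^sup>+a. ennreal (\<phi> a) \<partial>\<mu>) \<le> ennreal (402 * lg + 2 * E)"
    proof -
      have "(\<integral>\<^sup>+a. ennreal (\<phi> a) \<partial>\<mu>) = (\<integral>\<^sup>+a. ennreal (402 * lg) * indicator {U<..} a + 2 * ennreal (if a > U then ?l a else 0) \<partial>\<mu>)"
      proof (rule nn_integral_cong_AE, unfold AE_measure_pmf_iff, rule ballI)
        fix a assume "a \<in> set_pmf \<mu>"
        then have "?l a \<ge> 0" using \<mu> l0 by auto
        then show "ennreal (\<phi> a) = ennreal (402 * lg) * indicator {U<..} a + 2 * ennreal (if a > U then ?l a else 0)"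
          using lg0 by (simp add: \<phi>_def ennreal_plus ennreal_mult' indicator_def)
      qed
      also have "\<dots> = ennreal (402 * lg) * (\<integral>\<^sup>+a. indicator {U<..} a \<partial>\<mu>) + 2 * (\<integral>\<^sup>+a. ennreal (if a > U then ?l a else 0) \<partial>\<mu>)"
        by (subst nn_integral_add) (simp_all add: nn_integral_cmult del: nn_integral_indicator)
      finally have "of_nat n * (\<integral>\<^sup>+a. ennreal (\<phi> a) \<partial>\<mu>) =
          ennreal (402 * lg) * (of_nat n * (\<integral>\<^sup>+a. indicator {U<..} a \<partial>\<mu>)) + 2 * (of_nat n * (\<integral>\<^sup>+a. ennreal (if a > U then ?l a else 0) \<partial>\<mu>))"
        by (simp add: distrib_left mult.left_commute del: nn_integral_indicator)
      also have "\<dots> \<le> ennreal (402 * lg) * 1 + 2 * ennreal E"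
        by (intro add_mono mult_left_mono b e) auto
      also have "\<dots> = ennreal (402 * lg + 2 * E)" using lg0 E by (simp add: ennreal_plus ennreal_mult')
      finally show ?thesis .
    qed
    finally have "(\<integral>\<^sup>+x. of_nat (length (enc (q x))) \<partial>?P) \<le> ?B + (ennreal c + ennreal (402 * lg + 2 * E))"
      by (simp add: add_left_mono)
    also have "ennreal c + ennreal (402 * lg + 2 * E) = ennreal (c + (402 * lg + 2 * E))"
      using c0 lg0 E by (simp add: ennreal_plus)
    also have "c + (402 * lg + 2 * E) \<le> 802 * (real U + 1) * lg + 4 + 2 * E"
      using lg0 mult_nonneg_nonneg[of "real U" lg] unfolding c_def by (simp add: algebra_simps)
    finally have main: "(\<integral>\<^sup>+x. of_nat (length (enc (q x))) \<partial>?P) \<le> ?B + ennreal (802 * (real U + 1) * lg + 4 + 2 * E)"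
      by (simp add: add_left_mono ennreal_leI)
    define R where "R = 802 * (real U + 1) * lg + 4 + 2 * E"
    have R0: "R \<ge> 0" using lg0 E by (simp add: R_def)
    \<comment> \<open>Finiteness of the expected base rate is needed before it is
      subtracted.\<close>
    have "?B \<le> (\<integral>\<^sup>+x. ennreal (real n * real n) \<partial>?P)"
      by (intro nn_integral_mono_AE) (use supp mset_word_types base_rate_le in \<open>auto simp: AE_measure_pmf_iff intro!: ennreal_leI\<close>)
    then have "?B \<le> ennreal (real n * real n)" by (simp add: measure_pmf.emeasure_space_1)
    then obtain Br where Br: "?B = ennreal Br" "Br \<ge> 0" by (metis ennreal_cases ennreal_less_top infinity_ennreal_def leD)
    have "code_rate n (q, enc, dec) ?P \<le> ereal (1 / real n) * enn2ereal (ennreal (Br + R))"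
      unfolding code_rate_def prod.case
    proof (rule ereal_mult_left_mono)
      show "enn2ereal (\<integral>\<^sup>+x. of_nat (length (enc (q x))) \<partial>?P) \<le> enn2ereal (ennreal (Br + R))"
        using main Br R0 unfolding R_def[symmetric] by (simp add: ennreal_plus less_eq_ennreal.rep_eq[symmetric])
    qed simp
    also have "enn2ereal (ennreal (Br + R)) = ereal (Br + R)" using Br R0 by (intro enn2ereal_ennreal) simp
    also have "ereal (1 / real n) * ereal (Br + R) = ereal ((1 / real n) * Br + (1 / real n) * R)"
      by (simp add: add_divide_distrib)
    finally have up: "code_rate n (q, enc, dec) ?P \<le> ereal ((1 / real n) * Br + (1 / real n) * R)" .
    have lo: "ereal ((1 / real n) * Br) \<le> optimal_rate \<rho> n d ?P"
      using optimal_rate_lower[OF supp inv] Br by simp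
    have "code_rate n (q, enc, dec) ?P - optimal_rate \<rho> n d ?P \<le>
        ereal ((1 / real n) * Br + (1 / real n) * R) - ereal ((1 / real n) * Br)"
      by (rule ereal_minus_mono[OF up lo])
    also have "\<dots> = ereal ((1 / real n) * R)" by simp
    finally show "code_rate n (q, enc, dec) ?P - optimal_rate \<rho> n d ?P \<le>
        ereal ((1 / real n) * (802 * (real U + 1) * lg + 4 + 2 * E))" unfolding R_def .
  qed
qed

end

section \<open>Envelope families\<close>

lemma pmf_bind_ge: "pmf p j * pmf (Q j) x \<le> pmf (bind_pmf p Q) x"
proof -
  have "pmf p j * pmf (Q j) x = (\<integral>i. indicator {j} i * pmf (Q j) x \<partial>p)"
    by (simp add: pmf.rep_eq)
  also have "\<dots> \<le> (\<integral>i. pmf (Q i) x \<partial>p)"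
  proof (rule integral_mono)
    show "integrable p (\<lambda>i. indicator {j} i * pmf (Q j) x)"
      by (rule measure_pmf.integrable_const_bound[where B = 1]) (auto simp: indicator_def pmf_le_1)
    show "integrable p (\<lambda>i. pmf (Q i) x)"
      by (rule measure_pmf.integrable_const_bound[where B = 1]) (auto simp: pmf_le_1)
  qed (auto simp: indicator_def)
  finally show ?thesis by (simp add: pmf_bind)
qed

lemma pmf_bind_le:
  assumes "\<And>i. pmf (Q i) x \<le> c"
  shows "pmf (bind_pmf p Q) x \<le> c"
proof -
  have "(\<integral>i. pmf (Q i) x \<partial>p) \<le> (\<integral>i. c \<partial>p)"
  proof (rule integral_mono)
    show "integrable p (\<lambda>i. pmf (Q i) x)"
      by (rule measure_pmf.integrable_const_bound[where B = 1]) (auto simp: pmf_le_1)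
  qed (use assms in auto)
  then show ?thesis by (simp add: pmf_bind)
qed

lemma not_summable_tail:
  fixes g :: "nat \<Rightarrow> real"
  assumes ns: "\<not> g summable_on {1..}" and g0: "\<And>x. x \<ge> 1 \<Longrightarrow> g x \<ge> 0" and m: "m \<ge> 1"
  shows "\<exists>m'>m. B \<le> sum g {m..<m'}"
proof (rule ccontr)
  assume "\<not> ?thesis"
  then have bd: "sum g {m..<m'} < B" if "m' > m" for m' using that by force
  have "g summable_on {1..}"
  proof (rule nonneg_bdd_above_summable_on)
    show "bdd_above (sum g ` {F. F \<subseteq> {1..} \<and> finite F})"
    proof (rule bdd_aboveI2)
      fix F :: "nat set" assume F: "F \<in> {F. F \<subseteq> {1..} \<and> finite F}"
      define M where "M = Suc (Max (insert m F))"
      have mM: "x < M" if "x \<in> insert m F" for x using F that by (simp add: M_def less_Suc_eq_le)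
      have "sum g F \<le> sum g {1..<M}"
        using F mM g0 by (intro sum_mono2) (auto simp: subset_iff)
      also have "\<dots> = sum g {1..<m} + sum g {m..<M}"
        using m mM[of m] by (intro sum.atLeastLessThan_concat[symmetric]) auto
      also have "\<dots> \<le> sum g {1..<m} + B" using bd[of M] mM[of m] by simp
      finally show "sum g F \<le> sum g {1..<m} + B" .
    qed
  qed (use g0 in auto)
  then show False using ns by simp
qed

text \<open>If f were not summable, cut the alphabet into blocks of mass at least 2^(2^j) and give the
  j-th block probability 2^-(j+1), spread proportionally to f: every block contributes at least 1/2
  to the entropy.\<close>

lemma envelope_summable:
  fixes f :: "nat \<Rightarrow> real"
  assumes f0: "\<And>x. x \<in> alphabet \<Longrightarrow> f x \<ge> 0" and fin: "envelope_family f \<subseteq> finite_entropy"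
  shows "f summable_on {1..}"
proof (rule ccontr)
  assume nsf: "\<not> f summable_on {1..}"
  \<comment> \<open>Truncation at 1 bounds the probability of a single letter by the inverse block
    mass. It preserves divergence: were g summable, f could exceed 1 only finitely often and would
    be summable too.\<close>
  define g where "g x = min (f x) 1" for x
  have g0: "g x \<ge> 0" if "x \<ge> 1" for x using f0[of x] that by (simp add: g_def alphabet_def)
  have ns: "\<not> g summable_on {1..}"
  proof
    assume sg: "g summable_on {1..}"
    have "finite {x \<in> {1..}. f x \<ge> 1}"
    proof (rule ccontr)
      assume inf: "infinite {x \<in> {1..}. f x \<ge> 1}"
      obtain k :: nat where k: "infsum g {1..} < real k" using reals_Archimedean2 by blast
      obtain B where B: "finite B" "card B = k" "B \<subseteq> {x \<in> {1..}. f x \<ge> 1}"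
        using infinite_arbitrarily_large[OF inf] by blast
      have "real k = sum g B" using B by (subst sum.cong[of B B g "\<lambda>_. 1"]) (auto simp: g_def)
      also have "\<dots> \<le> infsum g {1..}" using B g0 by (intro finite_sum_le_infsum[OF sg]) auto
      finally show False using k by simp
    qed
    moreover have "g summable_on ({1..} - {x \<in> {1..}. f x \<ge> 1})" by (rule summable_on_subset_banach[OF sg]) auto
    then have "f summable_on ({1..} - {x \<in> {1..}. f x \<ge> 1})"
      by (rule summable_on_cong[THEN iffD1, rotated]) (auto simp: g_def)
    ultimately have "f summable_on (({1..} - {x \<in> {1..}. f x \<ge> 1}) \<union> {x \<in> {1..}. f x \<ge> 1})"
      by (intro summable_on_Un_disjoint) (simp_all add: summable_on_finite Int_commute)
    moreover have "({1..} - {x \<in> {1..}. f x \<ge> 1}) \<union> {x \<in> {1..}. f x \<ge> 1} = {1..}" by auto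
    ultimately have "f summable_on {1..}" by (simp only:)
    then show False using nsf by simp
  qed
  have step: "\<exists>m'. m' \<ge> 1 \<and> (m < m' \<and> 2 ^ (2 ^ j) \<le> sum g {m..<m'})" if m: "m \<ge> 1" for m j :: nat
  proof -
    obtain m' where "m < m'" "2 ^ (2 ^ j) \<le> sum g {m..<m'}"
      using not_summable_tail[OF ns g0 m, of "2 ^ (2 ^ j)"] by blast
    then show ?thesis using m by (intro exI[of _ m']) simp
  qed
  have "\<exists>N :: nat \<Rightarrow> nat. \<forall>j. N j \<ge> 1 \<and> (N j < N (Suc j) \<and> 2 ^ (2 ^ j) \<le> sum g {N j..<N (Suc j)})"
    by (rule dependent_nat_choice[of "\<lambda>_ m. m \<ge> 1" "\<lambda>j m m'. m < m' \<and> 2 ^ (2 ^ j) \<le> sum g {m..<m'}"])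
       (blast, rule step)
  then obtain N :: "nat \<Rightarrow> nat" where NN: "\<forall>j. N j \<ge> 1 \<and> (N j < N (Suc j) \<and> 2 ^ (2 ^ j) \<le> sum g {N j..<N (Suc j)})"
    by blast
  have N: "N j \<ge> 1" "N j < N (Suc j) \<and> 2 ^ (2 ^ j) \<le> sum g {N j..<N (Suc j)}" for j
    using NN[rule_format, of j] by (rule conjunct1, rule conjunct2)
  define blk where "blk j = {N j..<N (Suc j)}" for j
  define c where "c j = sum g (blk j)" for j
  have c1: "c j \<ge> 2 ^ (2 ^ j)" for j using N(2) by (simp add: c_def blk_def)
  have cpos: "c j > 0" for j using c1[of j] by (rule less_le_trans[rotated]) simp
  \<comment> \<open>Normalising by at least 1 keeps each block distribution below g and hence below
    f, so the mixture stays in the envelope family.\<close>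
  have c_ge1: "c j \<ge> 1" for j using c1[of j] one_le_power[of "2::real" "2 ^ j"] by linarith
  have blk1: "x \<ge> 1" if "x \<in> blk j" for x j using N(1)[of j] that by (auto simp: blk_def)
  have Nmono: "N i \<le> N j" if "i \<le> j" for i j
    by (rule lift_Suc_mono_le[of N, OF _ that]) (use N(2) in \<open>simp add: less_imp_le\<close>)
  have blk_disj: "i = j" if "x \<in> blk i" "x \<in> blk j" for x i j
  proof (rule ccontr)
    assume "i \<noteq> j"
    then consider "Suc i \<le> j" | "Suc j \<le> i" by linarith
    then show False using that Nmono[of "Suc i" j] Nmono[of "Suc j" i] by cases (auto simp: blk_def)
  qed
  have blk_fin: "finite (blk j)" for j by (simp add: blk_def)
  define Qf where "Qf j x = (if x \<in> blk j then g x / c j else 0)" for j x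
  have Qf0: "Qf j x \<ge> 0" for j x using g0 blk1 cpos[of j] by (auto simp: Qf_def less_imp_le)
  have Qf1: "(\<integral>\<^sup>+x. ennreal (Qf j x) \<partial>count_space UNIV) = 1" for j
  proof -
    have "(\<integral>\<^sup>+x. ennreal (Qf j x) \<partial>count_space UNIV) = (\<Sum>x\<in>blk j. ennreal (Qf j x))"
      by (rule nn_integral_count_space'[OF blk_fin]) (auto simp: Qf_def)
    also have "\<dots> = ennreal (\<Sum>x\<in>blk j. Qf j x)" using Qf0 by (simp add: sum_ennreal)
    also have "(\<Sum>x\<in>blk j. Qf j x) = (\<Sum>x\<in>blk j. g x) / c j" by (simp add: Qf_def sum_divide_distrib)
    also have "\<dots> = 1" using cpos[of j] by (simp add: c_def)
    finally show ?thesis by simp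
  qed
  define Q where "Q j = embed_pmf (Qf j)" for j
  have Q: "pmf (Q j) x = Qf j x" for j x unfolding Q_def by (rule pmf_embed_pmf[OF Qf0 Qf1])
  define \<mu> where "\<mu> = bind_pmf (geometric_pmf (1/2)) Q"
  have geo: "pmf (geometric_pmf (1/2)) j = (1/2) ^ Suc j" for j by (subst pmf_geometric) auto
  have lower: "(1/2) ^ Suc j * Qf j x \<le> pmf \<mu> x" for j x
    using pmf_bind_ge[of "geometric_pmf (1/2)" j Q x] by (simp only: \<mu>_def geo Q)
  have supp: "set_pmf \<mu> \<subseteq> alphabet"
  proof
    fix x assume "x \<in> set_pmf \<mu>"
    then obtain j where "x \<in> set_pmf (Q j)" by (auto simp: \<mu>_def)
    then have "Qf j x \<noteq> 0" using Q by (metis set_pmf_iff)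
    then show "x \<in> alphabet" using blk1 by (auto simp: Qf_def alphabet_def split: if_splits)
  qed
  have upper_f: "pmf \<mu> x \<le> f x" if x: "x \<in> alphabet" for x
    unfolding \<mu>_def
  proof (rule pmf_bind_le)
    fix j
    have "g x / c j \<le> g x / 1" using g0[of x] x c_ge1[of j] by (intro divide_left_mono) (auto simp: alphabet_def)
    then show "pmf (Q j) x \<le> f x" using f0[OF x] by (simp add: Q Qf_def g_def)
  qed
  \<comment> \<open>Only one block contains x. The resulting factor 2^j in the entropy compensates
    the mixing probability 2^-(j+1), which is why the block masses grow doubly
    exponentially.\<close>
  have upper_j: "pmf \<mu> x \<le> 1 / 2 ^ (2 ^ j)" if x: "x \<in> blk j" for x j
    unfolding \<mu>_def
  proof (rule pmf_bind_le)
    fix i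
    show "pmf (Q i) x \<le> 1 / 2 ^ (2 ^ j)"
    proof (cases "x \<in> blk i")
      case True
      then have "i = j" using blk_disj x by blast
      have "g x / c j \<le> 1 / 2 ^ (2 ^ j)" using c1[of j] g0[OF blk1[OF x]] by (intro frac_le) (auto simp: g_def)
      then show ?thesis using True \<open>i = j\<close> by (simp add: Q Qf_def)
    qed (simp add: Q Qf_def)
  qed
  let ?\<eta> = "\<lambda>x. - (pmf \<mu> x * log 2 (pmf \<mu> x))"
  have \<eta>_lower: "pmf \<mu> x * 2 ^ j \<le> ?\<eta> x" if x: "x \<in> blk j" for x j
  proof (cases "pmf \<mu> x = 0")
    case False
    then have p: "pmf \<mu> x > 0" by (simp add: order_less_le)
    have "log 2 (pmf \<mu> x) \<le> log 2 (1 / 2 ^ (2 ^ j))" using upper_j[OF x] p by (subst log_le_cancel_iff) auto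
    also have "\<dots> = - real (2 ^ j)" by (simp add: log_divide log_nat_power)
    finally have "pmf \<mu> x * 2 ^ j \<le> pmf \<mu> x * - log 2 (pmf \<mu> x)" using p by (intro mult_left_mono) auto
    then show ?thesis by simp
  qed simp
  have \<eta>0: "?\<eta> x \<ge> 0" for x
  proof (cases "pmf \<mu> x = 0")
    case False
    then have "pmf \<mu> x > 0" by (simp add: order_less_le)
    then have "log 2 (pmf \<mu> x) \<le> 0" using pmf_le_1[of \<mu> x] by (simp add: log_le_zero_cancel_iff)
    then show ?thesis by (simp add: mult_nonneg_nonpos)
  qed simp
  have blk_sum: "1/2 \<le> sum ?\<eta> (blk j)" for j
  proof -
    have "1/2 = (1/2) ^ Suc j * 2 ^ j * (\<Sum>x\<in>blk j. Qf j x)"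
    proof -
      have "(\<Sum>x\<in>blk j. Qf j x) = sum g (blk j) / c j"
        unfolding sum_divide_distrib by (rule sum.cong) (auto simp: Qf_def)
      also have "\<dots> = 1" using cpos[of j] by (simp add: c_def[symmetric])
      finally have "(\<Sum>x\<in>blk j. Qf j x) = 1" .
      then show ?thesis by (simp add: power_one_over)
    qed
    also have "\<dots> = (\<Sum>x\<in>blk j. (1/2) ^ Suc j * Qf j x * 2 ^ j)"
      unfolding sum_distrib_left by (intro sum.cong) (simp_all only: ac_simps)
    also have "\<dots> \<le> (\<Sum>x\<in>blk j. pmf \<mu> x * 2 ^ j)" by (intro sum_mono mult_right_mono lower) auto
    also have "\<dots> \<le> sum ?\<eta> (blk j)" by (intro sum_mono \<eta>_lower)
    finally show ?thesis .
  qed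
  have "\<mu> \<in> envelope_family f" using supp upper_f by (simp add: envelope_family_def prob_measures_def)
  then have "shannon_entropy \<mu> < \<infinity>" using fin by (auto simp: finite_entropy_def)
  then obtain m :: nat where "shannon_entropy \<mu> < ereal (real m)" using less_PInf_Ex_of_nat by auto
  then have r: "shannon_entropy \<mu> \<le> ereal (real m)" by (rule order_less_imp_le)
  obtain k :: nat where k: "real k > 2 * real m" using reals_Archimedean2 by blast
  have "real k / 2 = (\<Sum>j<k. 1/2)" by simp
  also have "\<dots> \<le> (\<Sum>j<k. sum ?\<eta> (blk j))" by (intro sum_mono blk_sum)
  also have "\<dots> = sum ?\<eta> (\<Union>j<k. blk j)"
    using blk_disj blk_fin by (intro sum.UNION_disjoint[symmetric]) auto
  finally have "ereal (real k / 2) \<le> (\<Sum>x\<in>(\<Union>j<k. blk j). ereal (?\<eta> x))" by simp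
  also have "\<dots> \<le> shannon_entropy \<mu>"
    unfolding shannon_entropy_def
  proof (subst nonneg_infsum_complete)
    show "(\<Sum>x\<in>(\<Union>j<k. blk j). ereal (?\<eta> x)) \<le> (SUP F\<in>{F. finite F \<and> F \<subseteq> alphabet}. \<Sum>x\<in>F. ereal (?\<eta> x))"
      by (rule SUP_upper) (use blk_fin blk1 in \<open>auto simp: alphabet_def\<close>)
  qed (use \<eta>0 in auto)
  also have "\<dots> \<le> ereal (real m)" by (rule r)
  finally show False using k by simp
qed

lemma infsum_tail_small:
  fixes f :: "nat \<Rightarrow> real"
  assumes s: "f summable_on {1..}" and f0: "\<And>x. x \<ge> 1 \<Longrightarrow> f x \<ge> 0" and e: "\<epsilon> > 0"
  shows "\<exists>k0\<ge>1. \<forall>k\<ge>k0. infsum f {k..} < \<epsilon>"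
proof -
  obtain F where F: "finite F" "F \<subseteq> {1..}" "dist (sum f F) (infsum f {1..}) \<le> \<epsilon> / 2"
    using infsum_finite_approximation[OF s, of "\<epsilon> / 2"] e by auto
  define k0 where "k0 = Suc (Max (insert 1 F))"
  have lt: "x < k0" if "x \<in> F" for x using F(1) that by (simp add: k0_def less_Suc_eq_le)
  have "infsum f {k..} < \<epsilon>" if k: "k \<ge> k0" for k
  proof -
    have k1: "k \<ge> 1" using k by (simp add: k0_def)
    have sk: "f summable_on {k..}" by (rule summable_on_subset_banach[OF s]) (use k1 in auto)
    have sF: "f summable_on F" using F(1) by simp
    have "infsum f F + infsum f {k..} = infsum f (F \<union> {k..})"
      using lt k by (intro infsum_Un_disjoint[OF sF sk, symmetric]) fastforce
    also have "\<dots> \<le> infsum f {1..}"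
      using f0 F(2) k1 sF sk by (intro infsum_mono_neutral s summable_on_union) auto
    finally have "sum f F + infsum f {k..} \<le> infsum f {1..}" using F(1) by simp
    moreover have "infsum f {1..} - sum f F \<le> \<epsilon> / 2" using F(3) unfolding dist_real_def by linarith
    ultimately show ?thesis using e by linarith
  qed
  then show ?thesis by (intro exI[of _ k0]) (simp add: k0_def)
qed

section \<open>Tails of the envelope and of the envelope distribution\<close>

locale envelope =
  fixes f :: "nat \<Rightarrow> real"
  assumes f0: "\<And>x. x \<ge> 1 \<Longrightarrow> f x \<ge> 0" and summable: "f summable_on {1..}"
begin

lemma summable_tail: "k \<ge> 1 \<Longrightarrow> f summable_on {k..}"
  by (rule summable_on_subset_banach[OF summable]) auto

lemma tail_nonneg: "k \<ge> 1 \<Longrightarrow> infsum f {k..} \<ge> 0"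
  using f0 by (intro infsum_nonneg) auto

lemma sum_le_tail: "k \<ge> 1 \<Longrightarrow> finite F \<Longrightarrow> F \<subseteq> {k..} \<Longrightarrow> sum f F \<le> infsum f {k..}"
  using finite_sum_le_infsum[OF summable_tail, of k F] f0 by auto

lemma tail_antimono: "1 \<le> k \<Longrightarrow> k \<le> l \<Longrightarrow> infsum f {l..} \<le> infsum f {k..}"
  using f0 by (intro infsum_mono_neutral summable_tail) auto

lemma env_tau: "env_tau f \<ge> 1" "infsum f {env_tau f..} \<le> 1"
proof -
  obtain k where "k \<ge> 1" "infsum f {k..} < 1" using infsum_tail_small[OF summable f0, of 1] by auto
  then have "k \<ge> 1 \<and> infsum f {k..} \<le> 1" by simp
  then have "env_tau f \<ge> 1 \<and> infsum f {env_tau f..} \<le> 1" unfolding env_tau_def by (rule LeastI)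
  then show "env_tau f \<ge> 1" "infsum f {env_tau f..} \<le> 1" by auto
qed

lemma env_tail_eq: "k \<ge> env_tau f \<Longrightarrow> env_tail f k = infsum f {k..}"
  unfolding env_tail_def by (intro infsum_cong) (auto simp: env_dist_def)

text \<open>Such a tail contains the point \<open>env_tau f\<close> - 1, which carries the missing
  mass. If \<open>env_tau f\<close> = 1, then k = 0 and this is the point 0 outside the
  alphabet.\<close>

lemma env_tail_eq_1:
  assumes k: "k < env_tau f"
  shows "env_tail f k = 1"
proof -
  let ?t = "env_tau f"
  have e: "infsum (env_dist f) {?t..} = infsum f {?t..}" by (intro infsum_cong) (auto simp: env_dist_def)
  have s: "env_dist f summable_on {?t..}"
    by (rule summable_on_cong[THEN iffD2, OF _ summable_tail[OF env_tau(1)]]) (auto simp: env_dist_def)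
  have "infsum (env_dist f) {k..} = infsum (env_dist f) ({k..<?t} \<union> {?t..})"
    using k by (intro arg_cong[of _ _ "infsum (env_dist f)"]) auto
  also have "\<dots> = infsum (env_dist f) {k..<?t} + infsum (env_dist f) {?t..}"
    by (intro infsum_Un_disjoint s) auto
  also have "infsum (env_dist f) {k..<?t} = sum (env_dist f) {k..<?t}" by simp
  also have "\<dots> = sum (env_dist f) {?t - 1}"
    using k by (intro sum.mono_neutral_right) (auto simp: env_dist_def)
  also have "\<dots> = 1 - infsum f {?t..}" using env_tau(1) by (simp add: env_dist_def)
  finally show ?thesis using e by (simp add: env_tail_def)
qed

lemma env_u_tail:
  assumes n: "n \<ge> 1"
  shows "env_tau f \<le> env_u f n + 1" "infsum f {env_u f n + 1..} < 1 / real n"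
proof -
  obtain k0 where k0: "\<forall>k\<ge>k0. infsum f {k..} < 1 / real n"
    using infsum_tail_small[OF summable f0, of "1 / real n"] n by auto
  define k where "k = max 1 (max k0 (env_tau f))"
  have "env_tail f (k + 1) < 1 / real n" using env_tail_eq[of "k + 1"] k0 by (simp add: k_def)
  then have "k \<ge> 1 \<and> env_tail f (k + 1) < 1 / real n" by (simp add: k_def)
  then have u: "env_u f n \<ge> 1 \<and> env_tail f (env_u f n + 1) < 1 / real n" unfolding env_u_def by (rule LeastI)
  have "1 / real n \<le> 1" using n by simp
  \<comment> \<open>A tail starting below \<open>env_tau f\<close> equals 1 and is not smaller than
    1/n. So the minimum is attained where the tail of the envelope distribution is that of
    f.\<close>
  then show t: "env_tau f \<le> env_u f n + 1" using u env_tail_eq_1[of "env_u f n + 1"] by fastforce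
  show "infsum f {env_u f n + 1..} < 1 / real n" using u env_tail_eq[OF t] by simp
qed

text \<open>Beyond \<open>k0\<close> the tail of f is below 1, so all terms f log (1 / f) are
  nonnegative and finite partial sums are bounded by the infinite one. There the two kinds of tails
  agree, so the condition speaks about f itself.\<close>

lemma tail_condition_bound:
  assumes "envelope_tail_condition f"
  obtains K k0 where "K \<ge> 0" "k0 \<ge> 1"
    "\<And>k F. k \<ge> k0 \<Longrightarrow> finite F \<Longrightarrow> F \<subseteq> {k..} \<Longrightarrow>
      (\<Sum>i\<in>F. f i * log 2 (1 / f i)) \<le> K * (infsum f {k..} * log 2 (1 / infsum f {k..}))"
proof -
  let ?A = "\<lambda>k. (\<Sum>\<^sub>\<infinity>i\<in>{k..}. ereal (f i * log 2 (1 / f i)))"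
  let ?D = "\<lambda>k. env_tail f k * log 2 (1 / env_tail f k)"
  have "limsup (\<lambda>k. ?A k / ereal (?D k)) < \<infinity>" using assms by (simp add: envelope_tail_condition_def)
  then obtain C :: nat where "limsup (\<lambda>k. ?A k / ereal (?D k)) < ereal (real C)" using less_PInf_Ex_of_nat by auto
  then have "\<forall>\<^sub>F k in sequentially. ?A k / ereal (?D k) < ereal (real C)" by (rule Limsup_lessD)
  then obtain k1 where k1: "\<And>k. k \<ge> k1 \<Longrightarrow> ?A k / ereal (?D k) < ereal (real C)" by (auto simp: eventually_sequentially)
  obtain k2 where k2: "\<And>k. k \<ge> k2 \<Longrightarrow> infsum f {k..} < 1"
    using infsum_tail_small[OF summable f0, of 1] by auto
  define k0 where "k0 = max (max k1 k2) (env_tau f)"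
  have k0_1: "k0 \<ge> 1" using env_tau(1) by (simp add: k0_def)
  show thesis
  proof (rule that[of "real C" k0])
    fix k F assume k: "k0 \<le> k" and F: "finite F" "F \<subseteq> {k..}"
    let ?t = "infsum f {k..}"
    have kk: "k \<ge> k1" "k \<ge> k2" "k \<ge> env_tau f" "k \<ge> 1" using k k0_1 by (auto simp: k0_def)
    have t: "0 \<le> ?t" "?t < 1" using tail_nonneg[OF kk(4)] k2[OF kk(2)] by auto
    have fi: "0 \<le> f i" "f i \<le> ?t" if "i \<in> {k..}" for i
      using f0[of i] sum_le_tail[OF kk(4), of "{i}"] that kk(4) by auto
    have h0: "f i * log 2 (1 / f i) \<ge> 0" if "i \<in> {k..}" for i
    proof (cases "f i = 0")
      case False
      then have "f i > 0" "f i \<le> 1" using fi[OF that] t(2) by auto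
      then show ?thesis by simp
    qed simp
    have D: "?D k = ?t * log 2 (1 / ?t)" using env_tail_eq[OF kk(3)] by simp
    show "(\<Sum>i\<in>F. f i * log 2 (1 / f i)) \<le> real C * (?t * log 2 (1 / ?t))"
    \<comment> \<open>A quotient with denominator 0 carries no information; in this case all
      \<open>f i\<close> vanish.\<close>
    proof (cases "?t = 0")
      case True
      then have "f i = 0" if "i \<in> F" for i using fi[of i] F(2) that by fastforce
      then show ?thesis using True by simp
    next
      case False
      then have tp: "?t > 0" using t by simp
      then have Dp: "?t * log 2 (1 / ?t) > 0" using t(2) by simp
      have "ereal (\<Sum>i\<in>F. f i * log 2 (1 / f i)) = (\<Sum>i\<in>F. ereal (f i * log 2 (1 / f i)))" by simp
      also have "\<dots> \<le> ?A k"
        by (subst nonneg_infsum_complete) (use F h0 in \<open>auto intro!: SUP_upper\<close>)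
      also have "\<dots> \<le> ereal (real C) * ereal (?t * log 2 (1 / ?t))"
      proof -
        have "?A k / ereal (?t * log 2 (1 / ?t)) < ereal (real C)" using k1[OF kk(1)] D by simp
        then show ?thesis using Dp by (simp add: ereal_divide_less_iff less_imp_le mult.commute)
      qed
      finally show ?thesis by simp
    qed
  qed (use k0_1 in auto)
qed

text \<open>With s = n t \<le> 1 the left side is s log n + s log (1 / s), and s log (1 / s) \<le>
  1.\<close>

lemma scaled_entropy_le:
  fixes t :: real
  assumes n: "n \<ge> 1" and t: "0 \<le> t" "t \<le> 1 / real n"
  shows "real n * (t * log 2 (1 / t)) \<le> log 2 (real n) + 1"
proof (cases "t = 0")
  case False
  let ?s = "real n * t"
  have s: "?s > 0" "?s \<le> 1" using t False n by (auto simp: field_simps)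
  have "log 2 (1 / t) = log 2 (real n * (1 / ?s))" using n by simp
  also have "\<dots> = log 2 (real n) + log 2 (1 / ?s)" using s n by (intro log_mult_pos) auto
  finally have "?s * log 2 (1 / t) = ?s * log 2 (real n) + ?s * log 2 (1 / ?s)" by (simp add: distrib_left)
  also have "?s * log 2 (real n) \<le> 1 * log 2 (real n)" using s n by (intro mult_right_mono) auto
  also have "?s * log 2 (1 / ?s) \<le> ?s * (1 / ?s)" using s by (intro mult_left_mono log2_le_self) auto
  finally have "?s * log 2 (1 / t) \<le> log 2 (real n) + ?s * (1 / ?s)" by simp
  moreover have "?s * (1 / ?s) = 1"
    by (rule right_inverse[unfolded inverse_eq_divide]) (use s in linarith)
  ultimately show ?thesis by (simp only: mult.assoc)
qed (use n in simp)

text \<open>For small n the cutoff \<open>env_u f n\<close> may lie before the range of the tail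
  condition. At most \<open>k0\<close> letters lie in between, and each of them contributes at most
  log n + 1 because its f is below 1/n; this adds \<open>k0\<close> to the constant.\<close>

lemma big_letters_entropy:
  assumes "envelope_tail_condition f"
  obtains K where "K \<ge> 0"
    "\<And>n F. n \<ge> 1 \<Longrightarrow> finite F \<Longrightarrow> F \<subseteq> {env_u f n + 1..} \<Longrightarrow>
      real n * (\<Sum>i\<in>F. f i * log 2 (1 / f i)) \<le> K * (log 2 (real n) + 1)"
proof (rule tail_condition_bound[OF assms])
  fix K k0
  assume K: "K \<ge> 0" and k0: "k0 \<ge> 1" and tail: "\<And>k F. k \<ge> k0 \<Longrightarrow> finite F \<Longrightarrow> F \<subseteq> {k..} \<Longrightarrow>
      (\<Sum>i\<in>F. f i * log 2 (1 / f i)) \<le> K * (infsum f {k..} * log 2 (1 / infsum f {k..}))"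
  show thesis
  proof (rule that[of "real k0 + K"])
    fix n F assume n: "n \<ge> 1" and F: "finite F" "F \<subseteq> {env_u f n + 1..}"
    let ?u = "env_u f n + 1" and ?h = "\<lambda>i. f i * log 2 (1 / f i)"
    define k where "k = max k0 ?u"
    have u1: "?u \<ge> 1" by simp
    have tk: "infsum f {k..} \<le> 1 / real n" "0 \<le> infsum f {k..}"
      using tail_antimono[OF u1, of k] env_u_tail(2)[OF n] tail_nonneg[of k] k0 by (auto simp: k_def)
    have fi: "0 \<le> f i" "f i \<le> 1 / real n" if "i \<in> {?u..}" for i
      using f0[of i] sum_le_tail[OF u1, of "{i}"] env_u_tail(2)[OF n] that by auto
    have l0: "log 2 (real n) + 1 \<ge> 0" using n by (simp add: add_nonneg_nonneg)
    have "real n * sum ?h (F \<inter> {..<k0}) = (\<Sum>i\<in>F \<inter> {..<k0}. real n * ?h i)" by (simp add: sum_distrib_left)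
    also have "\<dots> \<le> (\<Sum>i\<in>F \<inter> {..<k0}. log 2 (real n) + 1)"
      using F(2) fi by (intro sum_mono scaled_entropy_le[OF n]) auto
    also have "\<dots> = real (card (F \<inter> {..<k0})) * (log 2 (real n) + 1)" by simp
    also have "\<dots> \<le> real k0 * (log 2 (real n) + 1)"
      using card_mono[of "{..<k0}" "F \<inter> {..<k0}"] l0 by (intro mult_right_mono) auto
    finally have 1: "real n * sum ?h (F \<inter> {..<k0}) \<le> real k0 * (log 2 (real n) + 1)" .
    have "sum ?h (F - {..<k0}) \<le> K * (infsum f {k..} * log 2 (1 / infsum f {k..}))"
      using F by (intro tail) (auto simp: k_def)
    then have "real n * sum ?h (F - {..<k0}) \<le> real n * (K * (infsum f {k..} * log 2 (1 / infsum f {k..})))"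
      by (intro mult_left_mono) auto
    also have "\<dots> = K * (real n * (infsum f {k..} * log 2 (1 / infsum f {k..})))" by simp
    also have "\<dots> \<le> K * (log 2 (real n) + 1)" using K tk by (intro mult_left_mono scaled_entropy_le[OF n]) auto
    finally have 2: "real n * sum ?h (F - {..<k0}) \<le> K * (log 2 (real n) + 1)" .
    have "sum ?h F = sum ?h (F \<inter> {..<k0}) + sum ?h (F - {..<k0})"
      by (subst sum.union_disjoint[symmetric]) (use F in \<open>auto intro!: sum.cong\<close>)
    then show "real n * sum ?h F \<le> (real k0 + K) * (log 2 (real n) + 1)" using 1 2 by (simp add: distrib_left distrib_right)
  qed (use K in simp)
qed

text \<open>The reference distribution for large letters is f + 2^-x, normalised. The geometric
  summand keeps the logarithms finite where f vanishes, and G is taken at least 1 so that log G is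
  nonnegative.\<close>

lemma positive_dominating_pmf:
  obtains g :: "nat pmf" and G where "G \<ge> 1" "\<And>a. a \<in> alphabet \<Longrightarrow> pmf g a > 0"
    "\<And>a. a \<in> alphabet \<Longrightarrow> f a / G \<le> pmf g a"
proof -
  define r where "r x = (if x \<ge> 1 then f x + (1/2) ^ x else 0)" for x :: nat
  have geo: "(\<lambda>x. (1/2) ^ x :: real) summable_on {1..}"
    by (rule summable_on_subset_banach[of _ UNIV])
       (auto simp: summable_on_UNIV_nonneg_real_iff intro!: summable_geometric)
  have s1: "r summable_on {1..}"
    by (rule summable_on_cong[THEN iffD2, OF _ summable_on_add[OF summable geo]]) (auto simp: r_def)
  have r0: "r x \<ge> 0" for x using f0[of x] by (simp add: r_def)
  define G0 where "G0 = infsum r {1..}"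
  have s: "r summable_on UNIV"
    by (rule summable_on_cong_neutral[THEN iffD1, OF _ _ _ s1]) (auto simp: r_def)
  have G0_eq: "infsum r UNIV = G0" unfolding G0_def by (rule infsum_cong_neutral) (auto simp: r_def)
  have "r 1 \<le> G0" using finite_sum_le_infsum[OF s1, of "{1}"] r0 by (simp add: G0_def)
  then have G0: "G0 > 0" using f0[of 1] by (simp add: r_def)
  have nn: "(\<integral>\<^sup>+x. ennreal (r x / G0) \<partial>count_space UNIV) = 1"
  proof -
    have "(\<lambda>x. r x / G0) summable_on UNIV"
      using summable_on_cmult_left[OF s, of "1 / G0"] by (simp add: field_simps)
    then have "summable (\<lambda>x. r x / G0)" using r0 G0 by (subst (asm) summable_on_UNIV_nonneg_real_iff) auto
    moreover have "(\<Sum>x. r x / G0) = 1"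
    proof -
      have "((\<lambda>x. r x / G0) has_sum (G0 / G0)) UNIV"
        using has_sum_cmult_left[OF has_sum_infsum[OF s], of "1 / G0"] G0_eq by (simp add: field_simps)
      then have "(\<lambda>x. r x / G0) sums (G0 / G0)" by (rule has_sum_imp_sums)
      then show ?thesis using G0 sums_unique by fastforce
    qed
    ultimately have "(\<Sum>x. ennreal (r x / G0)) = ennreal 1" using r0 G0 by (subst suminf_ennreal2) auto
    then show ?thesis by (simp add: nn_integral_count_space_nat)
  qed
  define g where "g = embed_pmf (\<lambda>x. r x / G0)"
  have g: "pmf g x = r x / G0" for x unfolding g_def using r0 G0 nn by (intro pmf_embed_pmf) auto
  show thesis
  proof (rule that[of "max 1 G0" g])
    fix a assume "a \<in> alphabet"
    then have a: "a \<ge> 1" by (simp add: alphabet_def)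
    have "r a > 0" using f0[OF a] a by (auto simp: r_def intro!: add_nonneg_pos)
    then show "pmf g a > 0" using G0 by (simp add: g)
    have "f a / max 1 G0 \<le> f a / G0" using f0[OF a] G0 by (intro divide_left_mono) auto
    also have "\<dots> \<le> r a / G0" using a G0 by (intro divide_right_mono) (auto simp: r_def)
    finally show "f a / max 1 G0 \<le> pmf g a" by (simp add: g)
  qed simp
qed

end

theorem theorem4:
  fixes f :: "nat \<Rightarrow> real" and \<rho> :: "nat \<Rightarrow> nat \<Rightarrow> real" and d :: real
  assumes "\<And>x. x \<in> alphabet \<Longrightarrow> f x \<ge> 0"
    and "unbounded_distortion \<rho>"
    and "euclidean_consistent \<rho>"
    and "envelope_family f \<subseteq> finite_entropy"
    and "envelope_tail_condition f"
    and "d > 0"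
  shows "\<exists>\<xi> C0 C1 C2.
           semifaithful_scheme \<rho> d \<xi> \<and>
           (\<forall>n\<ge>1.
              (SUP \<mu>\<in>envelope_family f.
                 code_rate n (\<xi> n) (replicate_pmf n \<mu>) - optimal_rate \<rho> n d (replicate_pmf n \<mu>))
              \<le> ereal (C0 * (real (env_u f n) * log 2 (real n) / real n)
                       + C1 * (log 2 (real n) / real n)
                       + C2 * (1 / real n)))"
proof -
  interpret envelope f
    using assms(1) envelope_summable[OF assms(1,4)] by unfold_locales (auto simp: alphabet_def)
  have \<rho>: "\<rho> x x = 0" if "x \<in> alphabet" for x
    using assms(2) that by (auto simp: unbounded_distortion_def distortion_def)
  have \<rho>0: "\<rho> x y \<ge> 0" if "x \<in> alphabet" "y \<in> alphabet" for x y
    using assms(2) that by (cases "x = y") (auto simp: unbounded_distortion_def distortion_def less_imp_le)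
  obtain K where K: "K \<ge> 0" "\<And>n F. n \<ge> 1 \<Longrightarrow> finite F \<Longrightarrow> F \<subseteq> {env_u f n + 1..} \<Longrightarrow>
      real n * (\<Sum>i\<in>F. f i * log 2 (1 / f i)) \<le> K * (log 2 (real n) + 1)"
    using big_letters_entropy[OF assms(5)] by metis
  obtain g :: "nat pmf" and G where G: "G \<ge> 1" and g: "\<And>a. a \<in> alphabet \<Longrightarrow> pmf g a > 0"
    "\<And>a. a \<in> alphabet \<Longrightarrow> f a / G \<le> pmf g a"
    using positive_dominating_pmf by metis
  \<comment> \<open>From log (1 / g) \<le> log G + log (1 / f): beyond the cutoff f has mass at most
    1/n, which gives log G, and the entropy of its tail gives the other term.\<close>
  define E where "E n = log 2 G + K * (log 2 (real n) + 1)" for n :: nat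
  define R where "R n = (1 / real n) * (802 * (real (env_u f n) + 1) * log 2 (real n + 1) + 4 + 2 * E n)" for n :: nat
  have "\<exists>\<xi>. n \<ge> 1 \<longrightarrow> semifaithful_code \<rho> d n \<xi> \<and> (\<forall>\<mu>\<in>envelope_family f.
      code_rate n \<xi> (replicate_pmf n \<mu>) - optimal_rate \<rho> n d (replicate_pmf n \<mu>) \<le> ereal (R n))" for n
  proof (cases "n \<ge> 1")
    case n: True
    let ?U = "env_u f n"
    interpret distortion_block \<rho> d n ?U
      using n assms(6) \<rho> \<rho>0 by unfold_locales auto
    show ?thesis
    proof (rule universal_code_rate[OF g(1)])
      fix \<xi>
      assume code: "semifaithful_code \<rho> d n \<xi>" and rate: "\<And>\<mu> E. set_pmf \<mu> \<subseteq> alphabet \<Longrightarrow> E \<ge> 0 \<Longrightarrow>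
        of_nat n * (\<integral>\<^sup>+a. indicator {?U<..} a \<partial>measure_pmf \<mu>) \<le> 1 \<Longrightarrow>
        of_nat n * (\<integral>\<^sup>+a. ennreal (if a > ?U then log 2 (1 / pmf g a) else 0) \<partial>measure_pmf \<mu>) \<le> ennreal E \<Longrightarrow>
        code_rate n \<xi> (replicate_pmf n \<mu>) - optimal_rate \<rho> n d (replicate_pmf n \<mu>) \<le>
          ereal ((1 / real n) * (802 * (real ?U + 1) * lg + 4 + 2 * E))"
      have "code_rate n \<xi> (replicate_pmf n \<mu>) - optimal_rate \<rho> n d (replicate_pmf n \<mu>) \<le> ereal (R n)"
        if \<mu>: "\<mu> \<in> envelope_family f" for \<mu>
      proof -
        have supp: "set_pmf \<mu> \<subseteq> alphabet" and le: "\<And>a. a \<in> alphabet \<Longrightarrow> pmf \<mu> a \<le> f a"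
          using \<mu> by (auto simp: envelope_family_def prob_measures_def)
        have al: "a \<in> alphabet" if "a \<in> {?U + 1..}" for a using that by (simp add: alphabet_def)
        have sums: "sum f F \<le> 1 / real n" if "finite F" "F \<subseteq> {?U + 1..}" for F
          using sum_le_tail[OF _ that] env_u_tail(2)[OF n] by simp
        \<comment> \<open>Replacing \<open>\<mu>\<close> by f turns expectations over large letters
          into sums that do not depend on \<open>\<mu>\<close>, which makes the bound uniform over
          the family.\<close>
        have reduce: "(\<integral>\<^sup>+a. h a \<partial>measure_pmf \<mu>) \<le> ennreal c"
          if h: "\<And>a. a \<in> {?U + 1..} \<Longrightarrow> ennreal (pmf \<mu> a) * h a \<le> ennreal (h' a)" and h0: "\<And>a. a \<notin> {?U + 1..} \<Longrightarrow> h a = 0"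
            and h'0: "\<And>a. a \<in> {?U + 1..} \<Longrightarrow> h' a \<ge> 0"
            and hs: "\<And>F. finite F \<Longrightarrow> F \<subseteq> {?U + 1..} \<Longrightarrow> sum h' F \<le> c" for h h' c
        proof -
          have "(\<integral>\<^sup>+a. h a \<partial>measure_pmf \<mu>) = (\<integral>\<^sup>+a. ennreal (pmf \<mu> a) * h a \<partial>count_space UNIV)"
            by (rule nn_integral_measure_pmf)
          also have "\<dots> \<le> (\<integral>\<^sup>+a. ennreal (h' a) * indicator {?U + 1..} a \<partial>count_space UNIV)"
            using h h0 by (intro nn_integral_mono) (auto simp: indicator_def)
          also have "\<dots> = (\<integral>\<^sup>+a. ennreal (h' a) \<partial>count_space {?U + 1..})"
            by (simp add: nn_integral_count_space_indicator[symmetric])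
          also have "\<dots> \<le> ennreal c"
          proof (rule nn_integral_count_space_le)
            fix F assume F: "finite F" "F \<subseteq> {?U + 1..}"
            have "(\<Sum>a\<in>F. ennreal (h' a)) = ennreal (sum h' F)" using h'0 F(2) by (intro sum_ennreal) auto
            also have "\<dots> \<le> ennreal c" by (intro ennreal_leI hs F)
            finally show "(\<Sum>a\<in>F. ennreal (h' a)) \<le> ennreal c" .
          qed auto
          finally show ?thesis .
        qed
        have fa: "f a \<ge> 0" if "a \<in> {?U + 1..}" for a using f0[of a] that by simp
        have fa1: "f a \<le> 1" if "a \<in> {?U + 1..}" for a
        proof -
          have "f a \<le> 1 / real n" using sums[of "{a}"] that by simp
          also have "\<dots> \<le> 1" using n by simp
          finally show ?thesis .
        qed
        have scale: "of_nat n * z \<le> ennreal c" if "z \<le> ennreal (c / real n)" "c \<ge> 0" for z c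
        proof -
          have "of_nat n * z \<le> ennreal (real n) * ennreal (c / real n)"
            using that(1) by (simp add: ennreal_of_nat_eq_real_of_nat mult_left_mono)
          also have "\<dots> = ennreal (real n * (c / real n))" using that(2) by (intro ennreal_mult[symmetric]) auto
          finally show ?thesis using n by simp
        qed
        have b: "of_nat n * (\<integral>\<^sup>+a. indicator {?U<..} a \<partial>measure_pmf \<mu>) \<le> ennreal 1"
        proof (rule scale, rule reduce[of _ f])
          show "ennreal (pmf \<mu> a) * indicator {?U<..} a \<le> ennreal (f a)" if "a \<in> {?U + 1..}" for a
            using le[OF al[OF that]] by (auto simp: indicator_def intro: ennreal_leI)
        qed (use fa sums in auto)
        have lG: "log 2 G \<ge> 0" using G by simp
        have ln0: "log 2 (real n) \<ge> 0" using n by simp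
        have E0: "E n \<ge> 0" using lG K(1) ln0 by (simp add: E_def)
        have e: "of_nat n * (\<integral>\<^sup>+a. ennreal (if a > ?U then log 2 (1 / pmf g a) else 0) \<partial>measure_pmf \<mu>) \<le> ennreal (E n)"
        proof (rule scale[OF _ E0], rule reduce[of _ "\<lambda>a. f a * log 2 G + f a * log 2 (1 / f a)"])
          fix a assume a: "a \<in> {?U + 1..}"
          show "ennreal (pmf \<mu> a) * ennreal (if a > ?U then log 2 (1 / pmf g a) else 0) \<le>
              ennreal (f a * log 2 G + f a * log 2 (1 / f a))"
          proof (cases "f a = 0")
            case True
            then have "pmf \<mu> a = 0" using le[OF al[OF a]] by (simp add: order_antisym)
            then show ?thesis by simp
          next
            case False
            then have fp: "f a > 0" using fa[OF a] by simp
            have "1 / pmf g a \<le> 1 / (f a / G)"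
              using g[OF al[OF a]] fp G by (intro divide_left_mono mult_pos_pos) auto
            then have "log 2 (1 / pmf g a) \<le> log 2 (G * (1 / f a))"
              using g(1)[OF al[OF a]] fp G by (subst log_le_cancel_iff) auto
            also have "\<dots> = log 2 G + log 2 (1 / f a)" using fp G by (intro log_mult_pos) auto
            finally have l: "log 2 (1 / pmf g a) \<le> log 2 G + log 2 (1 / f a)" .
            have l0: "log 2 (1 / pmf g a) \<ge> 0" using g(1)[OF al[OF a]] by (simp add: pmf_le_1)
            have "pmf \<mu> a * log 2 (1 / pmf g a) \<le> f a * (log 2 G + log 2 (1 / f a))"
              using le[OF al[OF a]] l l0 fa[OF a] by (intro mult_mono) auto
            then have "ennreal (pmf \<mu> a * log 2 (1 / pmf g a)) \<le> ennreal (f a * log 2 G + f a * log 2 (1 / f a))"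
              by (intro ennreal_leI) (simp add: distrib_left)
            then show ?thesis using a by (simp add: ennreal_mult')
          qed
          show "0 \<le> f a * log 2 G + f a * log 2 (1 / f a)"
          proof (cases "f a = 0")
            case False
            then have "log 2 (1 / f a) \<ge> 0" using fa[OF a] fa1[OF a] by simp
            then show ?thesis using fa[OF a] lG by simp
          qed simp
        next
          fix F assume F: "finite F" "F \<subseteq> {?U + 1..}"
          have "sum f F * log 2 G \<le> (1 / real n) * log 2 G" using sums[OF F] lG by (rule mult_right_mono)
          moreover have "(\<Sum>i\<in>F. f i * log 2 (1 / f i)) \<le> K * (log 2 (real n) + 1) / real n"
            using K(2)[OF n F] n by (simp add: le_divide_eq mult.commute)
          ultimately show "(\<Sum>a\<in>F. f a * log 2 G + f a * log 2 (1 / f a)) \<le> E n / real n"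
            by (simp add: sum.distrib sum_distrib_right[symmetric] E_def add_divide_distrib)
        qed auto
        show ?thesis using rate[OF supp E0 _ e] b unfolding R_def lg_def by simp
      qed
      then show ?thesis using code by blast
    qed
  qed simp
  then have "\<forall>n. \<exists>\<xi>. n \<ge> 1 \<longrightarrow> semifaithful_code \<rho> d n \<xi> \<and> (\<forall>\<mu>\<in>envelope_family f.
      code_rate n \<xi> (replicate_pmf n \<mu>) - optimal_rate \<rho> n d (replicate_pmf n \<mu>) \<le> ereal (R n))" by (rule allI)
  from choice[OF this] obtain \<xi> where
    \<xi>0: "\<forall>n. n \<ge> 1 \<longrightarrow> semifaithful_code \<rho> d n (\<xi> n) \<and> (\<forall>\<mu>\<in>envelope_family f.
      code_rate n (\<xi> n) (replicate_pmf n \<mu>) - optimal_rate \<rho> n d (replicate_pmf n \<mu>) \<le> ereal (R n))" ..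
  have \<xi>: "semifaithful_code \<rho> d n (\<xi> n)"
    "\<And>\<mu>. \<mu> \<in> envelope_family f \<Longrightarrow>
      code_rate n (\<xi> n) (replicate_pmf n \<mu>) - optimal_rate \<rho> n d (replicate_pmf n \<mu>) \<le> ereal (R n)"
    if "n \<ge> 1" for n
    using \<xi>0[rule_format, OF that] by blast+
  \<comment> \<open>The first summand of C2 covers n = 1, where log n = 0 but log (n + 1) = 1. For n
    at least 2, log (n + 1) \<le> 2 log n turns 802 into 1604.\<close>
  define C2 where "C2 = 802 * (real (env_u f 1) + 1) + 4 + 2 * log 2 G + 2 * K"
  have R_le: "R n \<le> 1604 * (real (env_u f n) * log 2 (real n) / real n)
        + (1604 + 2 * K) * (log 2 (real n) / real n) + C2 * (1 / real n)" if n: "n \<ge> 1" for n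
  proof -
    let ?u = "real (env_u f n)" and ?l = "log 2 (real n)"
    have "802 * (?u + 1) * log 2 (real n + 1) \<le> 1604 * (?u * ?l) + 1604 * ?l + 802 * (real (env_u f 1) + 1)"
    proof (cases "n = 1")
      case True then show ?thesis by simp
    next
      case False
      then have n2: "real n \<ge> 2" using n by simp
      have "2 * real n \<le> real n * real n" using n2 by (intro mult_right_mono) auto
      then have "real n + 1 \<le> real n * real n" using n2 by linarith
      then have "log 2 (real n + 1) \<le> log 2 (real n * real n)" using n2 by (subst log_le_cancel_iff) auto
      also have "\<dots> = 2 * ?l" using n2 by (subst log_mult_pos) auto
      finally have "802 * (?u + 1) * log 2 (real n + 1) \<le> 802 * (?u + 1) * (2 * ?l)" by (intro mult_left_mono) auto
      then show ?thesis by (simp add: algebra_simps)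
    qed
    then have "802 * (?u + 1) * log 2 (real n + 1) + 4 + 2 * E n \<le> 1604 * (?u * ?l) + (1604 + 2 * K) * ?l + C2"
      unfolding E_def C2_def by (simp add: algebra_simps)
    then have "R n \<le> (1 / real n) * (1604 * (?u * ?l) + (1604 + 2 * K) * ?l + C2)"
      unfolding R_def by (intro mult_left_mono) auto
    also have "\<dots> = 1604 * (?u * ?l / real n) + (1604 + 2 * K) * (?l / real n) + C2 * (1 / real n)"
      by (simp add: add_divide_distrib)
    finally show ?thesis .
  qed
  have "(SUP \<mu>\<in>envelope_family f. code_rate n (\<xi> n) (replicate_pmf n \<mu>) - optimal_rate \<rho> n d (replicate_pmf n \<mu>))
     \<le> ereal (1604 * (real (env_u f n) * log 2 (real n) / real n)
        + (1604 + 2 * K) * (log 2 (real n) / real n) + C2 * (1 / real n))" if n: "n \<ge> 1" for n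
  proof (rule SUP_least)
    fix \<mu> assume "\<mu> \<in> envelope_family f"
    from \<xi>(2)[OF n this] show "code_rate n (\<xi> n) (replicate_pmf n \<mu>) - optimal_rate \<rho> n d (replicate_pmf n \<mu>)
     \<le> ereal (1604 * (real (env_u f n) * log 2 (real n) / real n)
        + (1604 + 2 * K) * (log 2 (real n) / real n) + C2 * (1 / real n))"
      by (rule order_trans) (simp add: R_le[OF n] del: times_divide_eq_right)
  qed
  moreover have "semifaithful_scheme \<rho> d \<xi>" using \<xi>(1) by (simp add: semifaithful_scheme_def)
  ultimately show ?thesis by blast
qed

end
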